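(* Let $N$ be a prime, $s\in\mathbb{N}$, and let $\boldsymbol{\gamma}=(\gamma_u)_{u\subseteq 1:s}$ be weights with $\gamma_u\ge0$. Put $c'=58/3$, $\gamma'_u=\gamma_u\left(c'/(4\pi^4)\right)^{|u|}$ and $\boldsymbol{\gamma}'^{1/2}=(\gamma_u'^{1/2})_{u\subseteq 1:s}$. The component-by-component (CBC) algorithm using the squared worst-case error $(e^{\mathrm{wor}}(P_{N,\boldsymbol{z}};\mathcal{H}(K_{1,\boldsymbol{\gamma}'^{1/2},s}^{\mathrm{kor}})))^2$ as a quality criterion finds a generating vector $\boldsymbol{z}\in\{1,\ldots,N-1\}^s$ such that $$e^{\mathrm{wor}}(P_{N,\boldsymbol{z}}^{\phi};\mathcal{H}(K_{2,\boldsymbol{\gamma},s}^{\mathrm{sob}}))\le\left(e^{\mathrm{wor}}(P_{N,\boldsymbol{z}};\mathcal{H}(K_{1,\boldsymbol{\gamma}'^{1/2},s}^{\mathrm{kor}}))\right)^2\le\frac{1}{(N-1)^{1/\lambda}}\left(\sum_{\emptyset\ne u\subseteq 1:s}\gamma_u^{\lambda/2}\left(\frac{2^{1-\lambda}c'^{\lambda/2}\zeta(2\lambda)}{\pi^{2\lambda}}\right)^{|u|}\right)^{1/\lambda}$$ holds for any $\lambda\in(1/2,1]$, where $\zeta$ is the Riemann zeta function.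
   Context: $\mathbb{N}$ is the set of positive integers, $1:s=\{1,\ldots,s\}$. For a reproducing kernel $K:[0,1]^s\times[0,1]^s\to\mathbb{R}$, $\mathcal{H}(K)$ is the reproducing kernel Hilbert space of real-valued functions with kernel $K$. Point sets are finite multisets (multiplicity counts). For a finite multiset $P\subset[0,1]^s$ and a normed function space $V$, the worst-case error is $$e^{\mathrm{wor}}(P;V)=\sup_{f\in V,\ \|f\|_V\le 1}\left|\frac{1}{|P|}\sum_{\boldsymbol{x}\in P}f(\boldsymbol{x})-\int_{[0,1]^s}f(\boldsymbol{x})\,d\boldsymbol{x}\right|.$$ The rank-1 lattice point set is $P_{N,\boldsymbol{z}}=\{\{n\boldsymbol{z}/N\} : 0\le n<N\}$ (componentwise fractional parts; $N$ points with multiplicity). With the tent transformation $\phi(x)=1-|2x-1|$ applied componentwise, $P_{N,\boldsymbol{z}}^{\phi}=\{\phi(\boldsymbol{x}):\boldsymbol{x}\in P_{N,\boldsymbol{z}}\}$ (as a multiset). Sobolev kernel: with $B_\tau$ the Bernoulli polynomial of degree $\tau$, $$K_{2,\boldsymbol{\gamma},s}^{\mathrm{sob}}(\boldsymbol{x},\boldsymbol{y})=1+\sum_{\emptyset\ne u\subseteq 1:s}\gamma_u\prod_{j\in u}\left[B_1(x_j)B_1(y_j)+\frac{B_2(x_j)B_2(y_j)}{4}-\frac{B_4(|x_j-y_j|)}{24}\right].$$ Korobov kernel: for weights $\boldsymbol{\eta}=(\eta_u)$, $\eta_u\ge 0$, and $\beta>1/2$, $$K_{\beta,\boldsymbol{\eta},s}^{\mathrm{kor}}(\boldsymbol{x},\boldsymbol{y})=1+\sum_{\emptyset\ne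 u\subseteq 1:s}\eta_u\prod_{j\in u}\sum_{h_j\in\mathbb{Z}\setminus\{0\}}\frac{e^{2\pi\mathrm{i}h_j(x_j-y_j)}}{|h_j|^{2\beta}}.$$ CBC algorithm with quality criterion $(e^{\mathrm{wor}}(P_{N,\boldsymbol{z}};\mathcal{H}(K_{\beta,\boldsymbol{\eta},s}^{\mathrm{kor}})))^2$: set $z_1=1$; then for $d=2,\ldots,s$ successively, with $z_1,\ldots,z_{d-1}$ already fixed, choose $z_d\in\{1,\ldots,N-1\}$ minimizing the $d$-dimensional criterion $(e^{\mathrm{wor}}(P_{N,(z_1,\ldots,z_d)};\mathcal{H}(K_{\beta,(\eta_u)_{u\subseteq 1:d},d}^{\mathrm{kor}})))^2$ as a function of $z_d$ (ties broken arbitrarily). The output is $\boldsymbol{z}=(z_1,\ldots,z_s)$. *)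

theory Defs
  imports "HOL-Analysis.Analysis"
begin

section \<open>Reproducing kernel Hilbert spaces\<close>

text \<open>A real-valued function on \<open>D\<close> is an element of \<open>extensional D\<close>, so that equality in
  \<open>H\<close> is equality on \<open>D\<close>. The values of \<open>ip\<close> outside \<open>H\<close> are irrelevant.\<close>

locale rkhs =
  fixes D :: "'x set"
    and K :: "'x \<Rightarrow> 'x \<Rightarrow> real"
    and H :: "('x \<Rightarrow> real) set"
    and ip :: "('x \<Rightarrow> real) \<Rightarrow> ('x \<Rightarrow> real) \<Rightarrow> real"
  assumes carrier_subset: "H \<subseteq> extensional D"
    and zero_closed: "(\<lambda>x\<in>D. 0) \<in> H"
    and add_closed: "\<lbrakk>f \<in> H; g \<in> H\<rbrakk> \<Longrightarrow> (\<lambda>x\<in>D. f x + g x) \<in> H"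
    and scale_closed: "f \<in> H \<Longrightarrow> (\<lambda>x\<in>D. c * f x) \<in> H"
    and ip_commute: "\<lbrakk>f \<in> H; g \<in> H\<rbrakk> \<Longrightarrow> ip f g = ip g f"
    and ip_add: "\<lbrakk>f \<in> H; g \<in> H; h \<in> H\<rbrakk> \<Longrightarrow> ip (\<lambda>x\<in>D. f x + g x) h = ip f h + ip g h"
    and ip_scale: "\<lbrakk>f \<in> H; h \<in> H\<rbrakk> \<Longrightarrow> ip (\<lambda>x\<in>D. c * f x) h = c * ip f h"
    and ip_nonneg: "f \<in> H \<Longrightarrow> 0 \<le> ip f f"
    and ip_definite: "\<lbrakk>f \<in> H; ip f f = 0\<rbrakk> \<Longrightarrow> f = (\<lambda>x\<in>D. 0)"
    and Cauchy_complete: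
      "\<lbrakk>\<And>n::nat. F n \<in> H;
        \<And>e. e > 0 \<Longrightarrow> \<exists>M. \<forall>m\<ge>M. \<forall>n\<ge>M.
            sqrt (ip (\<lambda>x\<in>D. F m x - F n x) (\<lambda>x\<in>D. F m x - F n x)) < e\<rbrakk>
       \<Longrightarrow> \<exists>f\<in>H. (\<lambda>n. sqrt (ip (\<lambda>x\<in>D. F n x - f x) (\<lambda>x\<in>D. F n x - f x))) \<longlonglongrightarrow> 0"
    and kernel_mem: "y \<in> D \<Longrightarrow> (\<lambda>x\<in>D. K x y) \<in> H"
    and reproducing: "\<lbrakk>f \<in> H; y \<in> D\<rbrakk> \<Longrightarrow> ip f (\<lambda>x\<in>D. K x y) = f y"

text \<open>A normed function space is a pair of its carrier and its norm.\<close>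

type_synonym 'x fun_space = "('x \<Rightarrow> real) set \<times> (('x \<Rightarrow> real) \<Rightarrow> real)"

text \<open>By the Moore--Aronszajn theorem, for a positive semidefinite \<open>K\<close> a pair as below exists,
  and its carrier and the norm on that carrier are uniquely determined, so the choice operator
  only fixes the irrelevant values of the norm outside the carrier.\<close>

definition RKHS :: "'x set \<Rightarrow> ('x \<Rightarrow> 'x \<Rightarrow> real) \<Rightarrow> 'x fun_space" where
  "RKHS D K = (SOME V. \<exists>ip. rkhs D K (fst V) ip \<and> snd V = (\<lambda>f. sqrt (ip f f)))"

section \<open>Worst-case error\<close>

text \<open>Points of \<open>[0,1]\<^sup>s\<close> are functions on the index set \<open>{1..s}\<close>.\<close>

definition cube :: "nat \<Rightarrow> (nat \<Rightarrow> real) set" where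
  "cube s = {1..s} \<rightarrow>\<^sub>E {0..1}"

definition cube_measure :: "nat \<Rightarrow> (nat \<Rightarrow> real) measure" where
  "cube_measure s = Pi\<^sub>M {1..s} (\<lambda>_. restrict_space lborel {0..1})"

lemma space_cube_measure: "space (cube_measure s) = cube s"
  by (simp add: cube_measure_def cube_def space_PiM space_restrict_space)

definition worst_case_error ::
    "nat \<Rightarrow> (nat \<Rightarrow> real) multiset \<Rightarrow> (nat \<Rightarrow> real) fun_space \<Rightarrow> real" where
  "worst_case_error s P V =
     (SUP f\<in>{f \<in> fst V. snd V f \<le> 1}.
        \<bar>(\<Sum>x\<in>#P. f x) / real (size P) - (\<integral>x. f x \<partial>cube_measure s)\<bar>)"

section \<open>Lattice point sets\<close>

definition lattice :: "nat \<Rightarrow> nat \<Rightarrow> (nat \<Rightarrow> nat) \<Rightarrow> (nat \<Rightarrow> real) multiset" where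
  "lattice N s z =
     image_mset (\<lambda>n. \<lambda>j\<in>{1..s}. frac (real n * real (z j) / real N)) (mset_set {0..<N})"

definition tent :: "real \<Rightarrow> real" where
  "tent x = 1 - \<bar>2 * x - 1\<bar>"

definition tent_points :: "nat \<Rightarrow> (nat \<Rightarrow> real) multiset \<Rightarrow> (nat \<Rightarrow> real) multiset" where
  "tent_points s P = image_mset (\<lambda>x. \<lambda>j\<in>{1..s}. tent (x j)) P"

section \<open>Bernoulli polynomials\<close>

fun bernoulli_number :: "nat \<Rightarrow> real" where
  "bernoulli_number n =
     (if n = 0 then 1
      else - (\<Sum>k<n. real ((n + 1) choose k) * bernoulli_number k) / real (n + 1))"

declare bernoulli_number.simps [simp del]

definition bernoulli_poly :: "nat \<Rightarrow> real \<Rightarrow> real" where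
  "bernoulli_poly n x = (\<Sum>k\<le>n. real (n choose k) * bernoulli_number k * x ^ (n - k))"

lemma bernoulli_number_values:
  "bernoulli_number 0 = 1" "bernoulli_number 1 = -1/2" "bernoulli_number 2 = 1/6"
  "bernoulli_number 3 = 0" "bernoulli_number 4 = -1/30"
proof -
  have rec: "bernoulli_number n = (if n = 0 then 1
      else - (\<Sum>k<n. real ((n + 1) choose k) * bernoulli_number k) / real (n + 1))" for n
    by (rule bernoulli_number.simps)
  show b0: "bernoulli_number 0 = 1"
    using rec[of 0] by simp
  show b1: "bernoulli_number 1 = -1/2"
    using rec[of 1] b0 by simp
  show b2: "bernoulli_number 2 = 1/6"
    using rec[of 2] b0 b1 by (simp add: eval_nat_numeral)
  show b3: "bernoulli_number 3 = 0"
    using rec[of 3] b0 b1 b2 by (simp add: eval_nat_numeral)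
  show "bernoulli_number 4 = -1/30"
    using rec[of 4] b0 b1 b2 b3 by (simp add: eval_nat_numeral)
qed

lemma bernoulli_poly_1: "bernoulli_poly 1 x = x - 1/2"
  using bernoulli_number_values by (simp add: bernoulli_poly_def)

lemma bernoulli_poly_2: "bernoulli_poly 2 x = x^2 - x + 1/6"
  using bernoulli_number_values by (simp add: bernoulli_poly_def eval_nat_numeral)

lemma bernoulli_poly_4: "bernoulli_poly 4 x = x^4 - 2 * x^3 + x^2 - 1/30"
  using bernoulli_number_values by (simp add: bernoulli_poly_def eval_nat_numeral)

section \<open>Kernels\<close>

definition sob_kernel ::
    "(nat set \<Rightarrow> real) \<Rightarrow> nat \<Rightarrow> (nat \<Rightarrow> real) \<Rightarrow> (nat \<Rightarrow> real) \<Rightarrow> real" where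
  "sob_kernel \<gamma> s x y =
     1 + (\<Sum>u\<in>Pow {1..s} - {{}}. \<gamma> u * (\<Prod>j\<in>u.
            bernoulli_poly 1 (x j) * bernoulli_poly 1 (y j)
          + bernoulli_poly 2 (x j) * bernoulli_poly 2 (y j) / 4
          - bernoulli_poly 4 \<bar>x j - y j\<bar> / 24))"

text \<open>The complex expression below is real, because the terms for \<open>h\<close> and \<open>-h\<close> are conjugate.\<close>

definition kor_kernel ::
    "real \<Rightarrow> (nat set \<Rightarrow> real) \<Rightarrow> nat \<Rightarrow> (nat \<Rightarrow> real) \<Rightarrow> (nat \<Rightarrow> real) \<Rightarrow> real" where
  "kor_kernel \<beta> \<eta> s x y =
     Re (1 + (\<Sum>u\<in>Pow {1..s} - {{}}. of_real (\<eta> u) * (\<Prod>j\<in>u.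
            \<Sum>\<^sub>\<infinity>h\<in>UNIV - {0::int}.
              exp (2 * of_real pi * \<i> * of_int h * of_real (x j - y j))
                / of_real (\<bar>real_of_int h\<bar> powr (2 * \<beta>)))))"

definition sob_space :: "(nat set \<Rightarrow> real) \<Rightarrow> nat \<Rightarrow> (nat \<Rightarrow> real) fun_space" where
  "sob_space \<gamma> s = RKHS (cube s) (sob_kernel \<gamma> s)"

definition kor_space :: "real \<Rightarrow> (nat set \<Rightarrow> real) \<Rightarrow> nat \<Rightarrow> (nat \<Rightarrow> real) fun_space" where
  "kor_space \<beta> \<eta> s = RKHS (cube s) (kor_kernel \<beta> \<eta> s)"

section \<open>Component-by-component construction\<close>

text \<open>\<open>crit d z\<close> is the criterion in dimension \<open>d\<close> and is meant to depend on \<open>z\<close> through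
  \<open>z 1, \<dots>, z d\<close> only. Ties are broken arbitrarily, so the algorithm is rendered as the
  set of its possible outputs.\<close>

definition cbc_output ::
    "nat \<Rightarrow> nat \<Rightarrow> (nat \<Rightarrow> (nat \<Rightarrow> nat) \<Rightarrow> real) \<Rightarrow> (nat \<Rightarrow> nat) set" where
  "cbc_output N s crit =
     {z. z 1 = 1 \<and>
         (\<forall>d\<in>{2..s}. z d \<in> {1..N - 1} \<and> (\<forall>c\<in>{1..N - 1}. crit d z \<le> crit d (z(d := c))))}"

definition kor_criterion ::
    "nat \<Rightarrow> real \<Rightarrow> (nat set \<Rightarrow> real) \<Rightarrow> nat \<Rightarrow> (nat \<Rightarrow> nat) \<Rightarrow> real" where
  "kor_criterion N \<beta> \<eta> d z = (worst_case_error d (lattice N d z) (kor_space \<beta> \<eta> d))\<^sup>2"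

section \<open>Riemann zeta function\<close>

text \<open>The Dirichlet series, which is the zeta function for real arguments greater than 1.\<close>

definition zeta :: "real \<Rightarrow> real" where
  "zeta \<sigma> = (\<Sum>n. 1 / real (Suc n) powr \<sigma>)"

end

(*
If a kernel K integrates to 1 in each argument, the squared worst-case error of a point set P is the
mean of K over P x P, minus 1. This follows from approximating the integral by sums over ever
finer grids, which are evaluations of finite combinations of kernel sections.

On a rank-1 lattice the one-dimensional Korobov factor at a/N is a finite Fourier sum over residues
r mod N with weights rho(r) = sum of |h|^-2 over the nonzero h = r mod N. Hence the squared Korobov
error is a weighted sum of rho-products over the dual lattice, and the component-by-component
bound is the usual averaging argument, with (sum a)^p <= sum a^p applied to finite sums only.

For the first inequality, the tent-transformed Sobolev factor has a double cosine series whose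
coefficient at cos(2 pi k x) cos(2 pi l y) lies between 0 and (58/3) / (pi^4 k^2 l^2), and the latter
is the coefficient of a multiple of the product of Korobov factors kappa(x) kappa(y). Functions on
pairs of lattice points with nonnegative cosine coefficients form a class closed under products
and limits, so the comparison survives the product over coordinates and yields the inequality
after summation over the lattice.
*)

theory Submission
  imports Defs "HOL-Probability.Probability"
begin

section \<open>Existence of reproducing kernel Hilbert spaces\<close>

text \<open>Why the Sobolev error is bounded by a square: \<open>tent x / 2\<close> is
  \<open>x\<close> or \<open>1 - x\<close>, so cos(k pi X) at X = \<open>tent x\<close> equals cos(2
  pi k x), and the half-period cosines of the Sobolev factor become characters of the untransformed
  lattice. The dominating function kappa(x) kappa(y) separates, so its double lattice sum is the
  square of a single sum, which is N times the dual-lattice sum in the squared Korobov error. The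
  squared Sobolev error is thus at most a sum of a_u^2, where the a_u add up to the squared Korobov
  error; hence the square roots of the weights. The constant 58/3 = 52/3 + 2 bounds the normalised
  cosine coefficients on the odd diagonal, where off-diagonal and diagonal parts add up. The divisor
  4 pi^4 matches kappa(x) = 2 sum cos(2 pi k x) / k^2, which enters twice. The spaces come from a
  choice operator, so nothing is known about them before existence of the Hilbert space is shown. A
  second obstacle is that the Fourier series of the Bernoulli polynomials are needed pointwise,
  although sum cos(2 pi k x) / k^2 cannot be differentiated twice term by term.\<close>

text \<open>A list of pairs stands for the finite signed combination of point evaluations with the
  given coefficients and nodes; concatenation is addition.\<close>

definition lin :: "(real \<times> 'x) list \<Rightarrow> ('x \<Rightarrow> real) \<Rightarrow> real" where
  "lin l f = (\<Sum>(c, x)\<leftarrow>l. c * f x)"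

text \<open>This is the inner product that the reproducing property forces on the corresponding
  combinations of kernel sections.\<close>

definition bil :: "('x \<Rightarrow> 'x \<Rightarrow> real) \<Rightarrow> (real \<times> 'x) list \<Rightarrow> (real \<times> 'x) list \<Rightarrow> real" where
  "bil K l m = lin l (\<lambda>x. lin m (K x))"

definition smul :: "real \<Rightarrow> (real \<times> 'x) list \<Rightarrow> (real \<times> 'x) list" where
  "smul a l = map (\<lambda>(c, x). (a * c, x)) l"

definition combs :: "'x set \<Rightarrow> (real \<times> 'x) list set" where
  "combs D = {l. snd ` set l \<subseteq> D}"

lemma lin_Nil [simp]: "lin [] f = 0" and lin_Cons [simp]: "lin (p # l) f = fst p * f (snd p) + lin l f"
  by (auto simp: lin_def split: prod.splits)

lemma lin_append [simp]: "lin (l @ m) f = lin l f + lin m f"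
  by (induction l) auto

lemma lin_smul [simp]: "lin (smul a l) f = a * lin l f"
  by (induction l) (auto simp: smul_def algebra_simps)

lemma lin_add: "lin l (\<lambda>x. f x + g x) = lin l f + lin l g"
  by (induction l) (auto simp: algebra_simps)

lemma lin_diff: "lin l (\<lambda>x. f x - g x) = lin l f - lin l g"
  by (induction l) (auto simp: algebra_simps)

lemma lin_scale: "lin l (\<lambda>x. c * f x) = c * lin l f"
  by (induction l) (auto simp: algebra_simps)

lemma lin_zero [simp]: "lin l (\<lambda>x. 0) = 0"
  by (induction l) auto

lemma lin_cong: "l \<in> combs D \<Longrightarrow> (\<And>x. x \<in> D \<Longrightarrow> f x = g x) \<Longrightarrow> lin l f = lin l g"
  by (induction l) (auto simp: combs_def)

lemma lin_tendsto:
  "l \<in> combs D \<Longrightarrow> (\<And>x. x \<in> D \<Longrightarrow> ((\<lambda>n. f n x) \<longlongrightarrow> g x) F) \<Longrightarrow> ((\<lambda>n. lin l (f n)) \<longlongrightarrow> lin l g) F"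
proof (induction l)
  case (Cons p l)
  then show ?case
    by (auto simp: combs_def intro!: tendsto_add tendsto_mult tendsto_const)
qed simp

lemma lin_lin_swap: "lin l (\<lambda>x. lin m (\<lambda>y. f x y)) = lin m (\<lambda>y. lin l (\<lambda>x. f x y))"
  by (induction l) (auto simp: lin_add lin_scale)

lemma combs_Nil [simp]: "[] \<in> combs D" and combs_append [simp]: "l @ m \<in> combs D \<longleftrightarrow> l \<in> combs D \<and> m \<in> combs D"
  and combs_smul [simp]: "l \<in> combs D \<Longrightarrow> smul a l \<in> combs D"
  and combs_Cons [simp]: "p # l \<in> combs D \<longleftrightarrow> snd p \<in> D \<and> l \<in> combs D"
  by (auto simp: combs_def smul_def)

lemma bil_append [simp]: "bil K (l @ l') m = bil K l m + bil K l' m" "bil K l (m @ m') = bil K l m + bil K l m'"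
  and bil_smul [simp]: "bil K (smul a l) m = a * bil K l m" "bil K l (smul a m) = a * bil K l m"
  by (auto simp: bil_def lin_add lin_scale)

lemma bil_sym:
  assumes "\<And>x y. x \<in> D \<Longrightarrow> y \<in> D \<Longrightarrow> K x y = K y x" "l \<in> combs D" "m \<in> combs D"
  shows "bil K l m = bil K m l"
proof -
  have "bil K l m = lin m (\<lambda>y. lin l (\<lambda>x. K x y))"
    unfolding bil_def by (rule lin_lin_swap)
  also have "\<dots> = bil K m l"
    unfolding bil_def by (intro lin_cong[OF assms(3)] lin_cong[OF assms(2)] assms(1))
  finally show ?thesis .
qed

definition psd :: "'x set \<Rightarrow> ('x \<Rightarrow> 'x \<Rightarrow> real) \<Rightarrow> bool" where
  "psd D K \<longleftrightarrow> (\<forall>x\<in>D. \<forall>y\<in>D. K x y = K y x) \<and> (\<forall>l\<in>combs D. 0 \<le> bil K l l)"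

text \<open>Additivity settles integer arguments. After subtraction of \<open>x * \<phi> 1\<close>
  the function has period 1, so its bound becomes global, and a globally bounded additive function
  is zero. This later gives homogeneity of the polarised inner product.\<close>

lemma additive_bounded_imp_linear:
  fixes \<phi> :: "real \<Rightarrow> real"
  assumes add: "\<And>x y. \<phi> (x + y) = \<phi> x + \<phi> y" and bd: "\<And>x. \<bar>x\<bar> \<le> 1 \<Longrightarrow> \<bar>\<phi> x\<bar> \<le> B"
  shows "\<phi> c = c * \<phi> 1"
proof -
  have z: "\<phi> 0 = 0" using add[of 0 0] by simp
  have nat: "\<phi> (real n * x) = real n * \<phi> x" for n x
    by (induction n) (auto simp: z add algebra_simps)
  have neg: "\<phi> (- x) = - \<phi> x" for x using add[of x "-x"] z by simp
  have int: "\<phi> (of_int k) = of_int k * \<phi> 1" for k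
  proof (cases "k \<ge> 0")
    case True
    then show ?thesis using nat[of "nat k" 1] by simp
  next
    case False
    then show ?thesis using nat[of "nat (-k)" 1] neg[of "of_int (-k)"] by simp
  qed
  define g where "g x = \<phi> x - x * \<phi> 1" for x
  have gb: "\<bar>g x\<bar> \<le> B + \<bar>\<phi> 1\<bar>" for x
  proof -
    have "\<phi> x = \<phi> (of_int \<lfloor>x\<rfloor>) + \<phi> (frac x)"
      using add[of "of_int \<lfloor>x\<rfloor>" "frac x"] by (simp add: frac_def)
    then have "g x = \<phi> (frac x) - frac x * \<phi> 1" by (simp add: g_def int frac_def algebra_simps)
    moreover have "\<bar>\<phi> (frac x)\<bar> \<le> B" by (rule bd) (simp add: abs_of_nonneg frac_lt_1 less_imp_le)
    moreover have "\<bar>frac x * \<phi> 1\<bar> \<le> 1 * \<bar>\<phi> 1\<bar>" unfolding abs_mult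
      by (intro mult_right_mono) (auto simp: frac_lt_1 less_imp_le)
    ultimately show ?thesis by linarith
  qed
  have "g c = 0"
  proof (rule ccontr)
    assume "g c \<noteq> 0"
    then obtain n where n: "real n * \<bar>g c\<bar> > B + \<bar>\<phi> 1\<bar>"
      using reals_Archimedean3[of "\<bar>g c\<bar>"] by auto
    have "g (real n * c) = real n * g c" by (simp add: g_def nat right_diff_distrib mult.assoc)
    then show False using gb[of "real n * c"] n by (simp add: abs_mult)
  qed
  then show ?thesis by (simp add: g_def)
qed

section \<open>The Hilbert space of a positive semidefinite kernel, built by duality\<close>

locale psd_kernel =
  fixes D :: "'x set" and K :: "'x \<Rightarrow> 'x \<Rightarrow> real"
  assumes psd: "psd D K"
begin

lemma K_sym: "x \<in> D \<Longrightarrow> y \<in> D \<Longrightarrow> K x y = K y x"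
  using psd by (auto simp: psd_def)

lemma bil_nonneg: "l \<in> combs D \<Longrightarrow> 0 \<le> bil K l l"
  using psd by (auto simp: psd_def)

lemma bil_commute: "l \<in> combs D \<Longrightarrow> m \<in> combs D \<Longrightarrow> bil K l m = bil K m l"
  using bil_sym[of D K] K_sym by blast

text \<open>Modelled on 2 <f,g> - |g|^2, which is at most |f|^2 with equality at g = f: the supremum
  over all combinations is therefore the squared norm of \<open>f\<close>.\<close>

definition val :: "('x \<Rightarrow> real) \<Rightarrow> (real \<times> 'x) list \<Rightarrow> real" where
  "val f l = 2 * lin l f - bil K l l"

text \<open>The space is the dual of the span of the kernel sections; the dual norm is a Legendre
  transform, for which the parallelogram law is a change of variables.\<close>

definition Hs :: "('x \<Rightarrow> real) set" where
  "Hs = {f. \<exists>B. \<forall>l\<in>combs D. val f l \<le> B}"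

definition nsq :: "('x \<Rightarrow> real) \<Rightarrow> real" where
  "nsq f = (SUP l\<in>combs D. val f l)"

lemma combs_ne: "combs D \<noteq> {}" using combs_Nil by blast

lemma val_le: "f \<in> Hs \<Longrightarrow> l \<in> combs D \<Longrightarrow> val f l \<le> nsq f"
  unfolding nsq_def by (rule cSUP_upper) (auto simp: Hs_def bdd_above_def)

lemma nsq_le: "(\<And>l. l \<in> combs D \<Longrightarrow> val f l \<le> B) \<Longrightarrow> nsq f \<le> B"
  unfolding nsq_def by (rule cSUP_least[OF combs_ne])

lemma HsI: "(\<And>l. l \<in> combs D \<Longrightarrow> val f l \<le> B) \<Longrightarrow> f \<in> Hs"
  by (auto simp: Hs_def)

lemma nsq_nonneg: "f \<in> Hs \<Longrightarrow> 0 \<le> nsq f"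
  using val_le[of f "[]"] by (simp add: val_def bil_def)

lemma val_cong: "l \<in> combs D \<Longrightarrow> (\<And>x. x \<in> D \<Longrightarrow> f x = g x) \<Longrightarrow> val f l = val g l"
  unfolding val_def by (metis lin_cong)

lemma nsq_cong: "(\<And>x. x \<in> D \<Longrightarrow> f x = g x) \<Longrightarrow> nsq f = nsq g"
  unfolding nsq_def by (intro SUP_cong refl val_cong) auto

lemma Hs_cong: "(\<And>x. x \<in> D \<Longrightarrow> f x = g x) \<Longrightarrow> f \<in> Hs \<longleftrightarrow> g \<in> Hs"
  unfolding Hs_def using val_cong[of _ f g] by auto

lemma zero_Hs: "(\<lambda>x. 0) \<in> Hs" and nsq_zero: "nsq (\<lambda>x. 0) = 0"
proof -
  have b: "val (\<lambda>x. 0) l \<le> 0" if "l \<in> combs D" for l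
    using bil_nonneg[OF that] by (simp add: val_def)
  show h: "(\<lambda>x. 0) \<in> Hs" using b by (rule HsI)
  show "nsq (\<lambda>x. 0) = 0" using nsq_le[OF b] nsq_nonneg[OF h] by simp
qed

lemma scale_bound:
  assumes f: "f \<in> Hs"
  shows "(\<lambda>x. c * f x) \<in> Hs" "nsq (\<lambda>x. c * f x) \<le> c\<^sup>2 * nsq f"
proof -
  have b: "val (\<lambda>x. c * f x) l \<le> c\<^sup>2 * nsq f" if l: "l \<in> combs D" for l
  proof (cases "c = 0")
    case True
    then show ?thesis using bil_nonneg[OF l] by (simp add: val_def)
  next
    case False
    have "val (\<lambda>x. c * f x) l = c\<^sup>2 * val f (smul (1 / c) l)"
      using False by (simp add: val_def lin_scale field_simps power2_eq_square)
    also have "\<dots> \<le> c\<^sup>2 * nsq f" by (intro mult_left_mono val_le f combs_smul l) auto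
    finally show ?thesis .
  qed
  show "(\<lambda>x. c * f x) \<in> Hs" using b by (rule HsI)
  show "nsq (\<lambda>x. c * f x) \<le> c\<^sup>2 * nsq f" using b by (rule nsq_le)
qed

text \<open>Scaling back by \<open>1 / c\<close> turns the one-sided bound into an equality.\<close>

lemma nsq_scale:
  assumes f: "f \<in> Hs" shows "nsq (\<lambda>x. c * f x) = c\<^sup>2 * nsq f"
proof (cases "c = 0")
  case True
  then show ?thesis by (simp add: nsq_zero)
next
  case False
  have "nsq (\<lambda>x. (1 / c) * (c * f x)) \<le> (1 / c)\<^sup>2 * nsq (\<lambda>x. c * f x)"
    by (rule scale_bound(2)[OF scale_bound(1)[OF f]])
  then have "c\<^sup>2 * nsq f \<le> nsq (\<lambda>x. c * f x)"
    using False by (simp add: power_divide pos_le_divide_eq mult.commute)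
  then show ?thesis using scale_bound(2)[OF f, of c] by simp
qed

lemma add_Hs: assumes f: "f \<in> Hs" and g: "g \<in> Hs" shows "(\<lambda>x. f x + g x) \<in> Hs"
proof (rule HsI)
  fix l assume l: "l \<in> combs D"
  have "val (\<lambda>x. f x + g x) l = 2 * val f (smul (1/2) l) + 2 * val g (smul (1/2) l)"
    by (simp add: val_def lin_add)
  also have "\<dots> \<le> 2 * nsq f + 2 * nsq g"
    using val_le[OF f, of "smul (1/2) l"] val_le[OF g, of "smul (1/2) l"] l by simp
  finally show "val (\<lambda>x. f x + g x) l \<le> 2 * nsq f + 2 * nsq g" .
qed

lemma diff_Hs: assumes f: "f \<in> Hs" and g: "g \<in> Hs" shows "(\<lambda>x. f x - g x) \<in> Hs"
  using add_Hs[OF f scale_bound(1)[OF g, of "-1"]] by simp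

lemma parallelogram_le:
  assumes f: "f \<in> Hs" and g: "g \<in> Hs"
  shows "nsq (\<lambda>x. f x + g x) + nsq (\<lambda>x. f x - g x) \<le> 2 * nsq f + 2 * nsq g"
proof -
  have *: "val (\<lambda>x. f x + g x) a + val (\<lambda>x. f x - g x) b \<le> 2 * nsq f + 2 * nsq g"
    if a: "a \<in> combs D" and b: "b \<in> combs D" for a b
  proof -
    \<comment> \<open>With c = (a + b)/2 and d = (a - b)/2 the quadratic parts match: the forms at
      \<open>a\<close> and \<open>b\<close> add up to twice those at \<open>c\<close> and
      \<open>d\<close>.\<close>
    define c where "c = smul (1/2) (a @ b)"
    define d where "d = smul (1/2) (a @ smul (-1) b)"
    have "val (\<lambda>x. f x + g x) a + val (\<lambda>x. f x - g x) b = 2 * val f c + 2 * val g d"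
      using bil_commute[OF a b] by (simp add: val_def lin_add lin_diff c_def d_def algebra_simps)
    moreover have "val f c \<le> nsq f" "val g d \<le> nsq g"
      unfolding c_def d_def using a b by (auto intro!: val_le f g)
    ultimately show ?thesis by linarith
  qed
  have "nsq (\<lambda>x. f x + g x) \<le> 2 * nsq f + 2 * nsq g - val (\<lambda>x. f x - g x) b" if "b \<in> combs D" for b
    using *[OF _ that] by (intro nsq_le) (simp add: algebra_simps)
  then have "nsq (\<lambda>x. f x - g x) \<le> 2 * nsq f + 2 * nsq g - nsq (\<lambda>x. f x + g x)"
    by (intro nsq_le) (simp add: algebra_simps)
  then show ?thesis by simp
qed

text \<open>The reverse inequality is the same inequality for \<open>f + g\<close> and
  \<open>f - g\<close>, whose sum and difference are \<open>2 f\<close> and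
  \<open>2 g\<close>.\<close>

lemma parallelogram:
  assumes f: "f \<in> Hs" and g: "g \<in> Hs"
  shows "nsq (\<lambda>x. f x + g x) + nsq (\<lambda>x. f x - g x) = 2 * nsq f + 2 * nsq g"
proof -
  have "nsq (\<lambda>x. (f x + g x) + (f x - g x)) + nsq (\<lambda>x. (f x + g x) - (f x - g x))
      \<le> 2 * nsq (\<lambda>x. f x + g x) + 2 * nsq (\<lambda>x. f x - g x)"
    by (rule parallelogram_le[OF add_Hs[OF f g] diff_Hs[OF f g]])
  moreover have "nsq (\<lambda>x. (f x + g x) + (f x - g x)) = 4 * nsq f"
    using nsq_scale[OF f, of 2] by simp
  moreover have "nsq (\<lambda>x. (f x + g x) - (f x - g x)) = 4 * nsq g"
    using nsq_scale[OF g, of 2] by (simp add: algebra_simps)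
  ultimately show ?thesis using parallelogram_le[OF f g] by simp
qed

definition sip :: "('x \<Rightarrow> real) \<Rightarrow> ('x \<Rightarrow> real) \<Rightarrow> real" where
  "sip f g = (nsq (\<lambda>x. f x + g x) - nsq (\<lambda>x. f x - g x)) / 4"

lemma sip_cong: "(\<And>x. x \<in> D \<Longrightarrow> f x = f' x) \<Longrightarrow> (\<And>x. x \<in> D \<Longrightarrow> g x = g' x) \<Longrightarrow> sip f g = sip f' g'"
  unfolding sip_def by (metis (no_types, lifting) nsq_cong)

lemma nsq_minus_commute:
  assumes "f \<in> Hs" "g \<in> Hs" shows "nsq (\<lambda>x. f x - g x) = nsq (\<lambda>x. g x - f x)"
  using nsq_scale[OF diff_Hs[OF assms], of "-1"] by simp

lemma sip_commute: "f \<in> Hs \<Longrightarrow> g \<in> Hs \<Longrightarrow> sip f g = sip g f"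
  using nsq_minus_commute[of f g] by (simp add: sip_def add.commute)

lemma sip_self: "f \<in> Hs \<Longrightarrow> sip f f = nsq f"
  using nsq_scale[of f 2] by (simp add: sip_def nsq_zero)

lemma sip_zero: "h \<in> Hs \<Longrightarrow> sip (\<lambda>x. 0) h = 0"
  using nsq_minus_commute[OF zero_Hs, of h] by (simp add: sip_def)

text \<open>Jordan-von Neumann argument: subtract the parallelogram laws centred at
  \<open>f + h\<close> and at \<open>f - h\<close>.\<close>

lemma sip_add_diff:
  assumes f: "f \<in> Hs" and g: "g \<in> Hs" and h: "h \<in> Hs"
  shows "sip (\<lambda>x. f x + g x) h + sip (\<lambda>x. f x - g x) h = 2 * sip f h"
proof -
  have "nsq (\<lambda>x. (f x + h x) + g x) + nsq (\<lambda>x. (f x + h x) - g x) = 2 * nsq (\<lambda>x. f x + h x) + 2 * nsq g"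
    by (rule parallelogram[OF add_Hs[OF f h] g])
  moreover have "nsq (\<lambda>x. (f x - h x) + g x) + nsq (\<lambda>x. (f x - h x) - g x) = 2 * nsq (\<lambda>x. f x - h x) + 2 * nsq g"
    by (rule parallelogram[OF diff_Hs[OF f h] g])
  ultimately show ?thesis by (simp add: sip_def algebra_simps add_divide_distrib diff_divide_distrib)
qed

lemma sip_add:
  assumes a: "a \<in> Hs" and b: "b \<in> Hs" and h: "h \<in> Hs"
  shows "sip (\<lambda>x. a x + b x) h = sip a h + sip b h"
proof -
  have dbl: "sip (\<lambda>x. 2 * f x) h = 2 * sip f h" if f: "f \<in> Hs" for f
    using sip_add_diff[OF f f h] sip_zero[OF h] by simp
  \<comment> \<open>The half sum and half difference of \<open>a\<close> and \<open>b\<close>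
    recover \<open>a\<close> and \<open>b\<close> as their sum and difference.\<close>
  have "sip (\<lambda>x. (1/2) * (a x + b x) + (1/2) * (a x - b x)) h
      + sip (\<lambda>x. (1/2) * (a x + b x) - (1/2) * (a x - b x)) h = 2 * sip (\<lambda>x. (1/2) * (a x + b x)) h"
    by (rule sip_add_diff[OF scale_bound(1)[OF add_Hs[OF a b]] scale_bound(1)[OF diff_Hs[OF a b]] h])
  moreover have "(\<lambda>x. (1/2) * (a x + b x) + (1/2) * (a x - b x)) = a"
    "(\<lambda>x. (1/2) * (a x + b x) - (1/2) * (a x - b x)) = b"
    by (auto simp: field_simps)
  moreover have "sip (\<lambda>x. 2 * ((1/2) * (a x + b x))) h = 2 * sip (\<lambda>x. (1/2) * (a x + b x)) h"
    by (rule dbl[OF scale_bound(1)[OF add_Hs[OF a b]]])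
  moreover have "(\<lambda>x. 2 * ((1/2) * (a x + b x))) = (\<lambda>x. a x + b x)"
    by auto
  ultimately show ?thesis by metis
qed

lemma sip_scale:
  assumes f: "f \<in> Hs" and h: "h \<in> Hs"
  shows "sip (\<lambda>x. c * f x) h = c * sip f h"
proof -
  have "sip (\<lambda>x. c * f x) h = c * sip (\<lambda>x. 1 * f x) h"
  proof (rule additive_bounded_imp_linear)
    show "sip (\<lambda>xa. (x + y) * f xa) h = sip (\<lambda>xa. x * f xa) h + sip (\<lambda>x. y * f x) h" for x y
      using sip_add[OF scale_bound(1)[OF f, of x] scale_bound(1)[OF f, of y] h]
      by (simp add: distrib_right)
    fix x :: real assume x: "\<bar>x\<bar> \<le> 1"
    have g: "(\<lambda>t. x * f t) \<in> Hs" by (rule scale_bound(1)[OF f])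
    \<comment> \<open>Two nonnegative numbers with bounded sum have bounded difference; the
      parallelogram law makes this uniform over \<open>x\<close> in [-1,1].\<close>
    have "nsq (\<lambda>t. x * f t + h t) + nsq (\<lambda>t. x * f t - h t) = 2 * (x\<^sup>2 * nsq f) + 2 * nsq h"
      using parallelogram[OF g h] by (simp add: nsq_scale[OF f])
    moreover have "x\<^sup>2 * nsq f \<le> 1 * nsq f"
      by (intro mult_right_mono nsq_nonneg f) (use x abs_square_le_1 in auto)
    moreover have "0 \<le> nsq (\<lambda>t. x * f t + h t)" "0 \<le> nsq (\<lambda>t. x * f t - h t)"
      by (intro nsq_nonneg add_Hs diff_Hs g h)+
    ultimately have "\<bar>nsq (\<lambda>t. x * f t + h t) - nsq (\<lambda>t. x * f t - h t)\<bar> \<le> 2 * nsq f + 2 * nsq h"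
      by linarith
    then show "\<bar>sip (\<lambda>t. x * f t) h\<bar> \<le> (2 * nsq f + 2 * nsq h) / 4"
      by (simp add: sip_def)
  qed
  then show ?thesis by simp
qed

text \<open>Adding \<open>t * K x y\<close> to the function is undone by translating the combination
  by \<open>- t\<close> times evaluation at \<open>y\<close>; completing the square leaves the terms
  without \<open>l\<close>.\<close>

lemma kernel_shift_le:
  assumes f: "f \<in> Hs" and y: "y \<in> D"
  shows "(\<lambda>x. f x + t * K x y) \<in> Hs" "nsq (\<lambda>x. f x + t * K x y) \<le> nsq f + 2 * t * f y + t\<^sup>2 * K y y"
proof -
  have *: "val (\<lambda>x. f x + t * K x y) l \<le> nsq f + 2 * t * f y + t\<^sup>2 * K y y" if l: "l \<in> combs D" for l
  proof -
    define b where "b = l @ smul (- t) [(1, y)]"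
    have b: "b \<in> combs D" using l y by (simp add: b_def)
    have e: "bil K l [(1, y)] = lin l (\<lambda>x. K x y)" by (simp add: bil_def)
    have "bil K [(1, y)] l = bil K l [(1, y)]" using bil_commute[of "[(1, y)]" l] y l by simp
    then have "val (\<lambda>x. f x + t * K x y) l = val f b + 2 * t * f y + t\<^sup>2 * K y y"
      by (simp add: val_def b_def lin_add lin_scale e) (simp add: bil_def algebra_simps power2_eq_square)
    then show ?thesis using val_le[OF f b] by simp
  qed
  show "(\<lambda>x. f x + t * K x y) \<in> Hs" using * by (rule HsI)
  show "nsq (\<lambda>x. f x + t * K x y) \<le> nsq f + 2 * t * f y + t\<^sup>2 * K y y" using * by (rule nsq_le)
qed

lemma kernel_shift:
  assumes f: "f \<in> Hs" and y: "y \<in> D"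
  shows "nsq (\<lambda>x. f x + t * K x y) = nsq f + 2 * t * f y + t\<^sup>2 * K y y"
proof -
  have "nsq (\<lambda>x. (f x + t * K x y) + (- t) * K x y)
      \<le> nsq (\<lambda>x. f x + t * K x y) + 2 * (- t) * (f y + t * K y y) + (- t)\<^sup>2 * K y y"
    by (rule kernel_shift_le[OF kernel_shift_le(1)[OF f y] y])
  then show ?thesis using kernel_shift_le(2)[OF f y, of t] by (simp add: algebra_simps power2_eq_square)
qed

lemma kernel_Hs: "y \<in> D \<Longrightarrow> (\<lambda>x. K x y) \<in> Hs"
  using kernel_shift_le(1)[OF zero_Hs, of y 1] by simp

text \<open>In the polarisation formula the shifts by \<open>t = 1\<close> and \<open>t = -1\<close>
  differ by exactly \<open>4 * f y\<close>.\<close>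

lemma sip_kernel: "f \<in> Hs \<Longrightarrow> y \<in> D \<Longrightarrow> sip f (\<lambda>x. K x y) = f y"
  using kernel_shift[of f y 1] kernel_shift[of f y "-1"] by (simp add: sip_def)

text \<open>Only the multiples \<open>e\<close> and \<open>- e\<close> of the evaluation at
  \<open>x\<close> are tested. The optimal multiple would involve division by \<open>K x x\<close>,
  which may be zero.\<close>

lemma point_bound:
  assumes f: "f \<in> Hs" and x: "x \<in> D" and e: "nsq f \<le> e\<^sup>2" "0 < e"
  shows "\<bar>f x\<bar> \<le> e * (1 + K x x) / 2"
proof -
  have "val f [(t, x)] \<le> e\<^sup>2" for t
    using val_le[OF f, of "[(t, x)]"] x e by simp
  then have "2 * (t * f x) - t * (t * K x x) \<le> e\<^sup>2" for t by (simp add: val_def bil_def)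
  from this[of e] this[of "- e"] have "e * \<bar>f x\<bar> \<le> e * (e * (1 + K x x) / 2)"
    by (auto simp: abs_if power2_eq_square algebra_simps)
  then show ?thesis using e(2) by simp
qed

lemma nsq_zero_imp_zero: "\<lbrakk>f \<in> Hs; nsq f = 0; x \<in> D\<rbrakk> \<Longrightarrow> f x = 0"
proof (rule ccontr)
  assume f: "f \<in> Hs" and n: "nsq f = 0" and x: "x \<in> D" and nz: "f x \<noteq> 0"
  have K: "0 \<le> K x x" using bil_nonneg[of "[(1, x)]"] x by (simp add: bil_def)
  \<comment> \<open>Chosen so that the point bound reads
    \<open>\<bar>f x\<bar> \<le> \<bar>f x\<bar> / 2\<close>.\<close>
  define e where "e = \<bar>f x\<bar> / (1 + K x x)"
  have "\<bar>f x\<bar> \<le> e * (1 + K x x) / 2"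
    by (rule point_bound[OF f x]) (use n nz K in \<open>auto simp: e_def\<close>)
  also have "\<dots> = \<bar>f x\<bar> / 2" using K by (simp add: e_def)
  finally show False using nz by simp
qed

text \<open>Norm-Cauchy sequences converge pointwise by \<open>point_bound\<close>, and the norm is
  lower semicontinuous for pointwise limits because it is a supremum of functionals that see
  finitely many points.\<close>

lemma complete_Hs:
  assumes F: "\<And>n::nat. F n \<in> Hs"
    and C: "\<And>e. e > 0 \<Longrightarrow> \<exists>M. \<forall>m\<ge>M. \<forall>n\<ge>M. nsq (\<lambda>x. F m x - F n x) \<le> e\<^sup>2"
  shows "\<exists>f\<in>Hs. \<forall>e>0. \<exists>M. \<forall>m\<ge>M. nsq (\<lambda>x. F m x - f x) \<le> e\<^sup>2"
proof -
  have conv: "\<exists>a. (\<lambda>n. F n x) \<longlonglongrightarrow> a" if x: "x \<in> D" for x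
  proof -
    have K: "0 \<le> K x x" using bil_nonneg[of "[(1, x)]"] x by (simp add: bil_def)
    have "Cauchy (\<lambda>n. F n x)"
    proof (rule metric_CauchyI)
      fix e :: real assume e: "0 < e"
      define d where "d = e / (1 + K x x)"
      have d: "0 < d" using e K by (simp add: d_def)
      obtain M where M: "\<forall>m\<ge>M. \<forall>n\<ge>M. nsq (\<lambda>x. F m x - F n x) \<le> d\<^sup>2" using C[OF d] by blast
      have "dist (F m x) (F n x) < e" if "m \<ge> M" "n \<ge> M" for m n
      proof -
        have "\<bar>F m x - F n x\<bar> \<le> d * (1 + K x x) / 2"
          by (rule point_bound[OF diff_Hs[OF F F] x]) (use M that d in auto)
        also have "\<dots> < e" using e K by (simp add: d_def)
        finally show ?thesis by (simp add: dist_real_def)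
      qed
      then show "\<exists>M. \<forall>m\<ge>M. \<forall>n\<ge>M. dist (F m x) (F n x) < e" by blast
    qed
    then show ?thesis using real_Cauchy_convergent convergent_def by blast
  qed
  define f where "f x = lim (\<lambda>n. F n x)" for x
  have f: "(\<lambda>n. F n x) \<longlonglongrightarrow> f x" if "x \<in> D" for x
    unfolding f_def using conv[OF that] by (metis limI)
  \<comment> \<open>The limit in \<open>n\<close> is taken for a fixed \<open>l\<close>; the
    threshold \<open>M\<close> does not depend on \<open>l\<close>, so the supremum over
    \<open>l\<close> can be taken afterwards.\<close>
  have key: "val (\<lambda>x. F m x - f x) l \<le> e\<^sup>2"
    if M: "\<forall>m\<ge>M. \<forall>n\<ge>M. nsq (\<lambda>x. F m x - F n x) \<le> e\<^sup>2" and m: "m \<ge> M" and l: "l \<in> combs D" for e M m l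
  proof (rule tendsto_le[OF sequentially_bot])
    show "(\<lambda>n. e\<^sup>2) \<longlonglongrightarrow> e\<^sup>2" by simp
    show "(\<lambda>n. val (\<lambda>x. F m x - F n x) l) \<longlonglongrightarrow> val (\<lambda>x. F m x - f x) l"
      unfolding val_def by (intro tendsto_intros lin_tendsto[OF l] f)
    have "val (\<lambda>x. F m x - F n x) l \<le> e\<^sup>2" if "n \<ge> M" for n
      using val_le[OF diff_Hs[OF F[of m] F[of n]] l] M m that by fastforce
    then show "\<forall>\<^sub>F n in sequentially. val (\<lambda>x. F m x - F n x) l \<le> e\<^sup>2"
      using eventually_sequentially by blast
  qed
  obtain M where M: "\<forall>m\<ge>M. \<forall>n\<ge>M. nsq (\<lambda>x. F m x - F n x) \<le> 1\<^sup>2" using C[of 1] by auto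
  have "(\<lambda>x. F M x - f x) \<in> Hs" using key[OF M order_refl] by (rule HsI)
  from diff_Hs[OF F[of M] this] have fH: "f \<in> Hs" by simp
  have "\<exists>M. \<forall>m\<ge>M. nsq (\<lambda>x. F m x - f x) \<le> e\<^sup>2" if e: "0 < e" for e
  proof -
    obtain M where M: "\<forall>m\<ge>M. \<forall>n\<ge>M. nsq (\<lambda>x. F m x - F n x) \<le> e\<^sup>2" using C[OF e] by blast
    then show ?thesis using key[OF M] nsq_le by blast
  qed
  then show ?thesis using fH by blast
qed

theorem moore_aronszajn: "rkhs D K (Hs \<inter> extensional D) sip"
proof
  \<comment> \<open>\<open>Hs\<close> ignores values outside \<open>D\<close>, whereas
    \<open>rkhs\<close> asks for extensional functions; restriction passes from one to the
    other.\<close>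
  have R: "(\<lambda>x\<in>D. f x) \<in> Hs \<inter> extensional D" if "f \<in> Hs" for f
    using that Hs_cong[of "\<lambda>x\<in>D. f x" f] by auto
  show "(\<lambda>x\<in>D. 0) \<in> Hs \<inter> extensional D" by (rule R[OF zero_Hs])
  show "(\<lambda>x\<in>D. f x + g x) \<in> Hs \<inter> extensional D" if "f \<in> Hs \<inter> extensional D" "g \<in> Hs \<inter> extensional D" for f g
    using that by (intro R add_Hs) auto
  show "(\<lambda>x\<in>D. c * f x) \<in> Hs \<inter> extensional D" if "f \<in> Hs \<inter> extensional D" for f c
    using that by (intro R scale_bound(1)) auto
  show "sip f g = sip g f" if "f \<in> Hs \<inter> extensional D" "g \<in> Hs \<inter> extensional D" for f g
    using that by (intro sip_commute) auto
  show "sip (\<lambda>x\<in>D. f x + g x) h = sip f h + sip g h"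
    if "f \<in> Hs \<inter> extensional D" "g \<in> Hs \<inter> extensional D" "h \<in> Hs \<inter> extensional D" for f g h
    using sip_cong[of "\<lambda>x\<in>D. f x + g x" "\<lambda>x. f x + g x" h h] sip_add[of f g h] that by auto
  show "sip (\<lambda>x\<in>D. c * f x) h = c * sip f h" if "f \<in> Hs \<inter> extensional D" "h \<in> Hs \<inter> extensional D" for f h c
    using sip_cong[of "\<lambda>x\<in>D. c * f x" "\<lambda>x. c * f x" h h] sip_scale[of f h c] that by auto
  show "0 \<le> sip f f" if "f \<in> Hs \<inter> extensional D" for f
    using that sip_self nsq_nonneg by auto
  show "f = (\<lambda>x\<in>D. 0)" if "f \<in> Hs \<inter> extensional D" "sip f f = 0" for f
    using that sip_self nsq_zero_imp_zero by (intro ext) (auto simp: extensional_def)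
  show "(\<lambda>x\<in>D. K x y) \<in> Hs \<inter> extensional D" if "y \<in> D" for y
    by (rule R[OF kernel_Hs[OF that]])
  show "sip f (\<lambda>x\<in>D. K x y) = f y" if "f \<in> Hs \<inter> extensional D" "y \<in> D" for f y
    using sip_cong[of f f "\<lambda>x\<in>D. K x y" "\<lambda>x. K x y"] sip_kernel[of f y] that by auto
  fix F :: "nat \<Rightarrow> 'x \<Rightarrow> real"
  assume F: "\<And>n. F n \<in> Hs \<inter> extensional D"
    and C: "\<And>e. e > 0 \<Longrightarrow> \<exists>M. \<forall>m\<ge>M. \<forall>n\<ge>M.
            sqrt (sip (\<lambda>x\<in>D. F m x - F n x) (\<lambda>x\<in>D. F m x - F n x)) < e"
  have FH: "F n \<in> Hs" for n using F by auto
  have eq: "sip (\<lambda>x\<in>D. f x - g x) (\<lambda>x\<in>D. f x - g x) = nsq (\<lambda>x. f x - g x)" if "f \<in> Hs" "g \<in> Hs" for f g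
    using sip_cong[of "\<lambda>x\<in>D. f x - g x" "\<lambda>x. f x - g x" "\<lambda>x\<in>D. f x - g x" "\<lambda>x. f x - g x"]
      sip_self[OF diff_Hs[OF that]] by auto
  have "\<exists>M. \<forall>m\<ge>M. \<forall>n\<ge>M. nsq (\<lambda>x. F m x - F n x) \<le> e\<^sup>2" if "e > 0" for e
    using C[OF that] that by (simp add: eq[OF FH FH]) (meson real_less_lsqrt real_sqrt_le_iff less_imp_le sqrt_le_D)
  from complete_Hs[OF FH this] obtain f where fH: "f \<in> Hs"
    and lim: "\<forall>e>0. \<exists>M. \<forall>m\<ge>M. nsq (\<lambda>x. F m x - f x) \<le> e\<^sup>2" by blast
  define g where "g = (\<lambda>x\<in>D. f x)"
  have g: "g \<in> Hs \<inter> extensional D" unfolding g_def by (rule R[OF fH])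
  have gl: "nsq (\<lambda>x. F m x - g x) = nsq (\<lambda>x. F m x - f x)" for m
    by (rule nsq_cong) (simp add: g_def)
  have "(\<lambda>n. sqrt (sip (\<lambda>x\<in>D. F n x - g x) (\<lambda>x\<in>D. F n x - g x))) \<longlonglongrightarrow> 0"
  proof (rule LIMSEQ_I)
    fix r :: real assume r: "0 < r"
    obtain M where M: "\<forall>m\<ge>M. nsq (\<lambda>x. F m x - f x) \<le> (r/2)\<^sup>2" using lim r half_gt_zero by blast
    have "norm (sqrt (sip (\<lambda>x\<in>D. F n x - g x) (\<lambda>x\<in>D. F n x - g x)) - 0) < r" if "n \<ge> M" for n
    proof -
      have "sqrt (nsq (\<lambda>x. F n x - f x)) \<le> r / 2"
        using M that r by (intro real_le_lsqrt) (auto)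
      then show ?thesis
        using r g eq[OF FH, of g n] nsq_nonneg[OF diff_Hs[OF FH fH], of n] by (simp add: gl)
    qed
    then show "\<exists>M. \<forall>n\<ge>M. norm (sqrt (sip (\<lambda>x\<in>D. F n x - g x) (\<lambda>x\<in>D. F n x - g x)) - 0) < r"
      by blast
  qed
  then show "\<exists>f\<in>Hs \<inter> extensional D. (\<lambda>n. sqrt (sip (\<lambda>x\<in>D. F n x - f x) (\<lambda>x\<in>D. F n x - f x))) \<longlonglongrightarrow> 0"
    using g by blast
qed auto

end

text \<open>Everything later known about the chosen space comes through this: whichever pair the
  choice operator selects, its norm is induced by an inner product satisfying
  \<open>rkhs\<close>.\<close>

lemma RKHS_rkhs:
  assumes "psd D K"
  obtains ip where "rkhs D K (fst (RKHS D K)) ip" "snd (RKHS D K) = (\<lambda>f. sqrt (ip f f))"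
proof -
  interpret psd_kernel D K by unfold_locales fact
  have "\<exists>V ip. rkhs D K (fst V) ip \<and> snd V = (\<lambda>f. sqrt (ip f f))"
    using moore_aronszajn by (intro exI[of _ "(Hs \<inter> extensional D, \<lambda>f. sqrt (sip f f))"] exI[of _ sip]) simp
  then have "\<exists>ip. rkhs D K (fst (RKHS D K)) ip \<and> snd (RKHS D K) = (\<lambda>f. sqrt (ip f f))"
    unfolding RKHS_def by (rule someI_ex)
  then show ?thesis using that by blast
qed

section \<open>Worst-case error as a quadratic form\<close>

context rkhs
begin

definition comb :: "(real \<times> 'x) list \<Rightarrow> 'x \<Rightarrow> real" where
  "comb l = (\<lambda>x\<in>D. lin l (\<lambda>y. K x y))"

lemma ip_zero: "h \<in> H \<Longrightarrow> ip (\<lambda>x\<in>D. 0) h = 0"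
  using ip_scale[OF zero_closed, of h 0] by (simp cong: restrict_cong)

lemma kernel_sym: "x \<in> D \<Longrightarrow> y \<in> D \<Longrightarrow> K x y = K y x"
  using reproducing[OF kernel_mem, of y x] reproducing[OF kernel_mem, of x y]
    ip_commute[OF kernel_mem kernel_mem, of x y] by simp

lemma comb_Cons:
  "comb (p # l) = (\<lambda>x\<in>D. (\<lambda>x\<in>D. fst p * (\<lambda>x\<in>D. K x (snd p)) x) x + comb l x)"
  by (auto simp: comb_def)

lemma comb_Nil: "comb [] = (\<lambda>x\<in>D. 0)"
  by (auto simp: comb_def)

lemma comb_mem: "l \<in> combs D \<Longrightarrow> comb l \<in> H"
proof (induction l)
  case Nil
  then show ?case using zero_closed by (simp only: comb_Nil)
next
  case (Cons p l)
  then show ?case unfolding comb_Cons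
    by (intro add_closed scale_closed kernel_mem) auto
qed

text \<open>\<open>comb l\<close> is the Riesz representer of the functional
  \<open>lin l\<close>.\<close>

lemma ip_comb: "l \<in> combs D \<Longrightarrow> f \<in> H \<Longrightarrow> ip f (comb l) = lin l f"
proof (induction l)
  case Nil
  then show ?case using ip_zero[of f] ip_commute[OF zero_closed, of f] by (simp only: comb_Nil lin_Nil)
next
  case (Cons p l)
  let ?k = "\<lambda>x\<in>D. fst p * (\<lambda>x\<in>D. K x (snd p)) x"
  have k: "(\<lambda>x\<in>D. K x (snd p)) \<in> H" "?k \<in> H" "comb l \<in> H" "comb (p # l) \<in> H"
    using Cons.prems by (auto intro!: kernel_mem scale_closed comb_mem simp del: restrict_apply)
  have "ip f (comb (p # l)) = ip (comb (p # l)) f"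
    by (rule ip_commute[OF Cons.prems(2) k(4)])
  also have "\<dots> = ip ?k f + ip (comb l) f"
    unfolding comb_Cons by (rule ip_add[OF k(2,3) Cons.prems(2)])
  also have "ip ?k f = fst p * ip (\<lambda>x\<in>D. K x (snd p)) f"
    by (rule ip_scale[OF k(1) Cons.prems(2)])
  also have "ip (\<lambda>x\<in>D. K x (snd p)) f = f (snd p)"
    using ip_commute[OF k(1) Cons.prems(2)] reproducing[OF Cons.prems(2)] Cons.prems(1) by simp
  also have "ip (comb l) f = lin l f"
    using ip_commute[OF k(3) Cons.prems(2)] Cons by simp
  finally show ?case by simp
qed

lemma ip_comb_comb: "l \<in> combs D \<Longrightarrow> ip (comb l) (comb l) = bil K l l"
  using ip_comb[OF _ comb_mem, of l l] lin_cong[of l D "comb l" "\<lambda>x. lin l (K x)"]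
  by (simp add: bil_def comb_def)

lemma cauchy_schwarz:
  assumes f: "f \<in> H" and g: "g \<in> H"
  shows "\<bar>ip f g\<bar> \<le> sqrt (ip f f) * sqrt (ip g g)"
proof (cases "ip g g = 0")
  case True
  then have "ip f g = 0" using ip_definite[OF g] ip_zero[OF f] ip_commute[OF f g] by simp
  then show ?thesis using True by simp
next
  case False
  then have pos: "0 < ip g g" using ip_nonneg[OF g] by simp
  \<comment> \<open>This \<open>t\<close> makes \<open>h\<close> the component of \<open>f\<close>
    orthogonal to \<open>g\<close>.\<close>
  define t where "t = - (ip f g / ip g g)"
  define k where "k = (\<lambda>x\<in>D. t * g x)"
  define h where "h = (\<lambda>x\<in>D. f x + k x)"
  have k: "k \<in> H" unfolding k_def by (rule scale_closed[OF g])
  have h: "h \<in> H" unfolding h_def by (rule add_closed[OF f k])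
  have kx: "ip k x = t * ip g x" if "x \<in> H" for x unfolding k_def by (rule ip_scale[OF g that])
  have hx: "ip h x = ip f x + t * ip g x" if "x \<in> H" for x
    unfolding h_def using ip_add[OF f k that] kx[OF that] by simp
  have "ip h h = ip f f + t * ip f g + t * ip f g + t * t * ip g g"
    using hx[OF h] ip_commute[OF f h] ip_commute[OF g h] hx[OF f] hx[OF g] ip_commute[OF f g]
    by (simp add: algebra_simps)
  also have "\<dots> = ip f f - (ip f g)\<^sup>2 / ip g g"
    using pos by (simp add: t_def field_simps power2_eq_square)
  finally have "(ip f g)\<^sup>2 \<le> ip f f * ip g g"
    using ip_nonneg[OF h] pos by (simp add: pos_divide_le_eq)
  then have "sqrt ((ip f g)\<^sup>2) \<le> sqrt (ip f f * ip g g)" by (rule real_sqrt_le_mono)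
  then show ?thesis by (simp add: real_sqrt_mult)
qed

lemma lin_le: "l \<in> combs D \<Longrightarrow> f \<in> H \<Longrightarrow> \<bar>lin l f\<bar> \<le> sqrt (ip f f) * sqrt (bil K l l)"
  using cauchy_schwarz[OF _ comb_mem, of f l] ip_comb ip_comb_comb by simp

end

section \<open>The integral as a limit of finite combinations of point evaluations\<close>

text \<open>The nodes are the values of the simple function and the weights are the measures of its
  fibres. The list serves all integrands at once, measurable or not.\<close>

lemma quadrature_list:
  assumes "prob_space M" "simple_function M g" "\<And>x. x \<in> space M \<Longrightarrow> g x \<in> D"
  obtains l where "l \<in> combs D" "\<And>f::_ \<Rightarrow> real. lin l f = (\<integral>x. f (g x) \<partial>M)"
proof -
  interpret prob_space M by fact
  have fin: "finite (g ` space M)" using assms(2) by (rule simple_functionD)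
  then obtain ys where ys: "set ys = g ` space M" "distinct ys"
    using finite_distinct_list by blast
  define l where "l = map (\<lambda>y. (measure M (g -` {y} \<inter> space M), y)) ys"
  have meas: "g -` {y} \<inter> space M \<in> sets M" for y using assms(2) by (rule simple_functionD)
  have "lin l f = (\<integral>x. f (g x) \<partial>M)" for f :: "_ \<Rightarrow> real"
  proof -
    have "lin l f = (\<Sum>y\<in>g ` space M. measure M (g -` {y} \<inter> space M) * f y)"
      by (simp add: lin_def l_def o_def sum_list_distinct_conv_sum_set[OF ys(2)] ys(1))
    also have "\<dots> = (\<Sum>y\<in>g ` space M. \<integral>x. f y * indicator (g -` {y} \<inter> space M) x \<partial>M)"
      by (simp add: meas mult.commute)
    also have "\<dots> = (\<integral>x. (\<Sum>y\<in>g ` space M. f y * indicator (g -` {y} \<inter> space M) x) \<partial>M)"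
      by (subst Bochner_Integration.integral_sum) (auto simp: meas emeasure_finite less_top[symmetric])
    also have "\<dots> = (\<integral>x. f (g x) \<partial>M)"
    proof (rule Bochner_Integration.integral_cong[OF refl])
      fix x assume x: "x \<in> space M"
      have "(\<Sum>y\<in>g ` space M. f y * indicator (g -` {y} \<inter> space M) x)
          = (\<Sum>y\<in>g ` space M. if y = g x then f y else 0)"
        using x by (intro sum.cong) (auto simp: indicator_def)
      also have "\<dots> = f (g x)" using x fin by simp
      finally show "(\<Sum>y\<in>g ` space M. f y * indicator (g -` {y} \<inter> space M) x) = f (g x)" .
    qed
    finally show ?thesis .
  qed
  moreover have "l \<in> combs D" using assms(3) ys by (auto simp: combs_def l_def)
  ultimately show ?thesis using that by blast
qed

text \<open>Measurability of \<open>f\<close> is obtained here as well: each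
  \<open>f (G n x)\<close> is a simple function, and \<open>f\<close> is their pointwise
  limit.\<close>

lemma simple_integral_tendsto:
  fixes f :: "_ \<Rightarrow> real"
  assumes "prob_space M" and G: "\<And>n. simple_function M (G n)" "\<And>n x. x \<in> space M \<Longrightarrow> G n x \<in> space M"
    and lim: "\<And>x. x \<in> space M \<Longrightarrow> (\<lambda>n. f (G n x)) \<longlonglongrightarrow> f x"
    and bd: "\<And>x. x \<in> space M \<Longrightarrow> \<bar>f x\<bar> \<le> B"
  shows "integrable M f" "(\<lambda>n. \<integral>x. f (G n x) \<partial>M) \<longlonglongrightarrow> (\<integral>x. f x \<partial>M)"
proof -
  interpret prob_space M by fact
  have m: "(\<lambda>x. f (G n x)) \<in> borel_measurable M" for n
    by (intro borel_measurable_simple_function simple_function_compose1[OF G(1)])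
  have mf: "f \<in> borel_measurable M" using lim m by (rule borel_measurable_LIMSEQ_real)
  show "integrable M f" by (rule integrable_const_bound[where B = B]) (use bd mf in auto)
  show "(\<lambda>n. \<integral>x. f (G n x) \<partial>M) \<longlonglongrightarrow> (\<integral>x. f x \<partial>M)"
    by (rule integral_dominated_convergence[where w = "\<lambda>_. B"]) (use bd lim m mf G(2) in auto)
qed

lemma lin_map_const: "lin (map (\<lambda>x. (c, x)) xs) f = c * (\<Sum>x\<in>#mset xs. f x)"
  by (induction xs) (auto simp: algebra_simps)

text \<open>Cauchy-Schwarz against the representers of "mean over P minus n-th quadrature" gives the
  upper bound. The same representers, normalised, are asymptotically extremal and give the lower
  bound, so the representer of the integral itself is never formed.\<close>

theorem worst_case_error_formula:
  fixes K :: "'x \<Rightarrow> 'x \<Rightarrow> real"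
  assumes "rkhs D K H ip" and "prob_space M" and D: "space M = D"
    and G: "\<And>n. simple_function M (G n)" "\<And>n x. x \<in> D \<Longrightarrow> G n x \<in> D"
    and cont1: "\<And>x y. \<lbrakk>x \<in> D; y \<in> D\<rbrakk> \<Longrightarrow> (\<lambda>n. K x (G n y)) \<longlonglongrightarrow> K x y"
    and cont2: "\<And>x y. \<lbrakk>x \<in> D; y \<in> D\<rbrakk> \<Longrightarrow> (\<lambda>n. K (G n x) (G n y)) \<longlonglongrightarrow> K x y"
    and bd: "\<And>x y. \<lbrakk>x \<in> D; y \<in> D\<rbrakk> \<Longrightarrow> \<bar>K x y\<bar> \<le> C"
    and one: "\<And>x. x \<in> D \<Longrightarrow> (\<integral>y. K x y \<partial>M) = 1"
    and P: "P \<noteq> {#}" "set_mset P \<subseteq> D"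
  shows "1 \<le> (\<Sum>x\<in>#P. \<Sum>y\<in>#P. K x y) / (real (size P))\<^sup>2" (is ?A)
    and "(SUP f\<in>{f \<in> H. sqrt (ip f f) \<le> 1}. \<bar>(\<Sum>x\<in>#P. f x) / real (size P) - (\<integral>x. f x \<partial>M)\<bar>)
        = sqrt ((\<Sum>x\<in>#P. \<Sum>y\<in>#P. K x y) / (real (size P))\<^sup>2 - 1)" (is "?S = _")
proof -
  interpret rkhs D K H ip by fact
  interpret prob_space M by fact
  define E where "E = (\<Sum>x\<in>#P. \<Sum>y\<in>#P. K x y) / (real (size P))\<^sup>2"
  define err where "err f = \<bar>(\<Sum>x\<in>#P. f x) / real (size P) - (\<integral>x. f x \<partial>M)\<bar>" for f
  obtain xs where xs: "mset xs = P" using ex_mset by blast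
  define \<pi> where "\<pi> = map (\<lambda>x. (1 / real (size P), x)) xs"
  have \<pi>: "\<pi> \<in> combs D" using P(2) xs by (auto simp: combs_def \<pi>_def)
  have lin\<pi>: "lin \<pi> f = (\<Sum>x\<in>#P. f x) / real (size P)" for f
    by (simp add: \<pi>_def lin_map_const flip: xs)
  have E: "E = bil K \<pi> \<pi>"
  proof -
    have "bil K \<pi> \<pi> = lin \<pi> (\<lambda>x. (1 / real (size P)) * (\<Sum>y\<in>#P. K x y))"
      by (simp add: bil_def lin\<pi>)
    then show ?thesis unfolding lin_scale by (simp add: lin\<pi> E_def power2_eq_square)
  qed
  have "\<exists>l. l \<in> combs D \<and> (\<forall>f::_ \<Rightarrow> real. lin l f = (\<integral>x. f (G n x) \<partial>M))" for n
    using quadrature_list[OF assms(2) G(1)[of n], of D] G(2) D by metis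
  then obtain \<mu> where \<mu>: "\<And>n. \<mu> n \<in> combs D"
    and lin\<mu>: "\<And>n (f::_ \<Rightarrow> real). lin (\<mu> n) f = (\<integral>x. f (G n x) \<partial>M)" by metis
  have quad: "integrable M f" "(\<lambda>n. lin (\<mu> n) f) \<longlonglongrightarrow> (\<integral>x. f x \<partial>M)"
    if "\<And>x. x \<in> D \<Longrightarrow> (\<lambda>n. f (G n x)) \<longlonglongrightarrow> f x" "\<And>x. x \<in> D \<Longrightarrow> \<bar>f x\<bar> \<le> B" for f B
    unfolding lin\<mu> using simple_integral_tendsto[OF assms(2), where G = G and f = f and B = B] that G D by auto
  have pt: "\<bar>f x\<bar> \<le> sqrt (ip f f) * sqrt C" if f: "f \<in> H" and x: "x \<in> D" for f x
  proof -
    have "\<bar>f x\<bar> \<le> sqrt (ip f f) * sqrt (K x x)"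
      using lin_le[of "[(1, x)]" f] f x by (simp add: bil_def)
    also have "\<dots> \<le> sqrt (ip f f) * sqrt C"
      using bd[OF x x] ip_nonneg[OF f] by (intro mult_left_mono) auto
    finally show ?thesis .
  qed
  \<comment> \<open>Elements of the space inherit continuity from the kernel: the squared norm of
    the difference of two point evaluations is the second difference of \<open>K\<close>.\<close>
  have fcont: "(\<lambda>n. f (G n x)) \<longlonglongrightarrow> f x" if f: "f \<in> H" and x: "x \<in> D" for f x
  proof (rule LIM_zero_cancel, rule tendsto_rabs_zero_cancel, rule tendsto_sandwich[OF _ _ tendsto_const])
    let ?b = "\<lambda>n. K (G n x) (G n x) - 2 * K x (G n x) + K x x"
    have "\<bar>f (G n x) - f x\<bar> \<le> sqrt (ip f f) * sqrt (?b n)" for n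
      using lin_le[of "[(1, G n x), (-1, x)]" f] f x G(2)[OF x, of n] kernel_sym[OF x G(2)[OF x, of n]]
      by (simp add: bil_def algebra_simps)
    then show "\<forall>\<^sub>F n in sequentially. \<bar>f (G n x) - f x\<bar> \<le> sqrt (ip f f) * sqrt (?b n)" by simp
    have "(\<lambda>n. sqrt (ip f f) * sqrt (?b n)) \<longlonglongrightarrow> sqrt (ip f f) * sqrt (K x x - 2 * K x x + K x x)"
      by (intro tendsto_intros cont1 cont2 x)
    then show "(\<lambda>n. sqrt (ip f f) * sqrt (?b n)) \<longlonglongrightarrow> 0" by simp
  qed auto
  have Hint: "integrable M f" "(\<lambda>n. lin (\<mu> n) f) \<longlonglongrightarrow> (\<integral>x. f x \<partial>M)" if "f \<in> H" for f
    using quad[OF fcont[OF that] pt[OF that]] by auto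
  have mid: "(\<lambda>n. bil K \<pi> (\<mu> n)) \<longlonglongrightarrow> 1"
  proof -
    have "(\<lambda>n. lin (\<mu> n) (K x)) \<longlonglongrightarrow> 1" if "x \<in> D" for x
      using quad(2)[of "K x" C] cont1[OF that] bd[OF that] one[OF that] by auto
    then have "(\<lambda>n. bil K \<pi> (\<mu> n)) \<longlonglongrightarrow> lin \<pi> (\<lambda>x. 1)"
      unfolding bil_def by (intro lin_tendsto[OF \<pi>])
    moreover have "lin \<pi> (\<lambda>x. 1) = 1" using P(1) by (simp add: lin\<pi>)
    ultimately show ?thesis by simp
  qed
  \<comment> \<open>Here both arguments are discretised with the same \<open>n\<close>, so the inner
    and outer integrals need dominated convergence one after the other.\<close>
  have last: "(\<lambda>n. bil K (\<mu> n) (\<mu> n)) \<longlonglongrightarrow> 1"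
  proof -
    let ?q = "\<lambda>n x. \<integral>y. K (G n x) (G n y) \<partial>M"
    have m: "(\<lambda>y. h (G n y)) \<in> borel_measurable M" for n and h :: "_ \<Rightarrow> real"
      by (intro borel_measurable_simple_function simple_function_compose1[OF G(1)])
    have mK: "K x \<in> borel_measurable M" if "x \<in> D" for x
      using quad(1)[of "K x" C] cont1[OF that] bd[OF that] by auto
    have "(\<lambda>n. ?q n x) \<longlonglongrightarrow> (\<integral>y. K x y \<partial>M)" if x: "x \<in> D" for x
      by (rule integral_dominated_convergence[where w = "\<lambda>_. C"])
         (use x bd G(2) D cont2 m[of "K _"] mK[OF x] in auto)
    then have q: "(\<lambda>n. ?q n x) \<longlonglongrightarrow> 1" if "x \<in> D" for x using one that by simp
    have qb: "\<bar>?q n x\<bar> \<le> C" if x: "x \<in> D" for n x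
    proof -
      have "\<bar>?q n x\<bar> \<le> (\<integral>y. \<bar>K (G n x) (G n y)\<bar> \<partial>M)" by (rule integral_abs_bound)
      also have "\<dots> \<le> (\<integral>y. C \<partial>M)"
        by (rule integral_mono[OF integrable_const_bound[where B = C]])
           (use bd G(2) D x m[of "\<lambda>z. \<bar>K _ z\<bar>"] in auto)
      finally show ?thesis by (simp add: prob_space)
    qed
    have "(\<lambda>n. \<integral>x. ?q n x \<partial>M) \<longlonglongrightarrow> (\<integral>x. 1 \<partial>M)"
      by (rule integral_dominated_convergence[where w = "\<lambda>_. C"])
         (use q qb D m[of "\<lambda>z. \<integral>y. K z (G _ y) \<partial>M"] in auto)
    then show ?thesis by (simp add: bil_def lin\<mu> prob_space)
  qed
  \<comment> \<open>The n-th approximation of the quadrature error functional; its squared norm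
    tends to \<open>E - 2 + 1\<close>.\<close>
  define \<delta> where "\<delta> n = \<pi> @ smul (-1) (\<mu> n)" for n
  have \<delta>: "\<delta> n \<in> combs D" for n using \<pi> \<mu> by (simp add: \<delta>_def)
  define b where "b n = bil K (\<delta> n) (\<delta> n)" for n
  have "b n = E - 2 * bil K \<pi> (\<mu> n) + bil K (\<mu> n) (\<mu> n)" for n
    using bil_sym[OF kernel_sym \<mu>[of n] \<pi>] by (simp add: b_def \<delta>_def E)
  then have "b = (\<lambda>n. E - 2 * bil K \<pi> (\<mu> n) + bil K (\<mu> n) (\<mu> n))" by auto
  moreover have "(\<lambda>n. E - 2 * bil K \<pi> (\<mu> n) + bil K (\<mu> n) (\<mu> n)) \<longlonglongrightarrow> E - 2 * 1 + 1"
    by (intro tendsto_intros mid last)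
  ultimately have b: "b \<longlonglongrightarrow> E - 1" by simp
  have b0: "0 \<le> b n" for n using ip_nonneg[OF comb_mem[OF \<delta>]] by (simp add: b_def ip_comb_comb[OF \<delta>])
  have E1: "0 \<le> E - 1" by (rule LIMSEQ_le_const[OF b]) (use b0 in auto)
  then show ?A by (simp add: E_def)
  have upper: "err f \<le> sqrt (E - 1)" if f: "f \<in> H" "sqrt (ip f f) \<le> 1" for f
  proof (rule LIMSEQ_le)
    have "(\<lambda>n. \<bar>lin \<pi> f - lin (\<mu> n) f\<bar>) \<longlonglongrightarrow> \<bar>lin \<pi> f - (\<integral>x. f x \<partial>M)\<bar>"
      by (intro tendsto_intros Hint f)
    then show "(\<lambda>n. \<bar>lin (\<delta> n) f\<bar>) \<longlonglongrightarrow> err f" by (simp add: \<delta>_def err_def lin\<pi>)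
    show "(\<lambda>n. sqrt (b n)) \<longlonglongrightarrow> sqrt (E - 1)" by (intro tendsto_intros b)
    have "\<bar>lin (\<delta> n) f\<bar> \<le> sqrt (b n)" for n
    proof -
      have "\<bar>lin (\<delta> n) f\<bar> \<le> sqrt (ip f f) * sqrt (b n)" unfolding b_def by (rule lin_le[OF \<delta> f(1)])
      also have "\<dots> \<le> 1 * sqrt (b n)" using f(2) b0 by (intro mult_right_mono) auto
      finally show ?thesis by simp
    qed
    then show "\<exists>N. \<forall>n\<ge>N. \<bar>lin (\<delta> n) f\<bar> \<le> sqrt (b n)" by blast
  qed
  have zero: "(\<lambda>x\<in>D. 0) \<in> {f \<in> H. sqrt (ip f f) \<le> 1}"
    using zero_closed ip_zero[OF zero_closed] by simp
  have sup: "err f \<le> ?S" if "f \<in> H" "sqrt (ip f f) \<le> 1" for f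
    unfolding err_def
    by (rule cSUP_upper) (use that upper in \<open>auto simp: bdd_above_def err_def\<close>)
  have "sqrt (E - 1) \<le> ?S"
  \<comment> \<open>The extremal functions are normalised by a quantity tending to
    \<open>sqrt (E - 1)\<close>, so a vanishing limit is treated apart; there the zero function
    suffices.\<close>
  proof (cases "E = 1")
    case True
    have "0 \<le> err (\<lambda>x\<in>D. 0)" by (simp add: err_def)
    then show ?thesis using sup[of "\<lambda>x\<in>D. 0"] zero True by simp
  next
    case False
    then have pos: "0 < E - 1" using E1 by simp
    have int: "(\<integral>x. comb l x \<partial>M) = lin l (\<lambda>x. 1)" if "l \<in> combs D" for l
      using that
    proof (induction l)
      case Nil
      have "(\<integral>x. comb [] x \<partial>M) = (\<integral>x. 0 \<partial>M)"
        by (rule Bochner_Integration.integral_cong) (auto simp: comb_def D)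
      then show ?case by simp
    next
      case (Cons p l)
      then have p: "snd p \<in> D" and l: "l \<in> combs D" by auto
      have "(\<integral>x. comb (p # l) x \<partial>M) = (\<integral>x. fst p * K (snd p) x + comb l x \<partial>M)"
        by (rule Bochner_Integration.integral_cong) (use p in \<open>auto simp: comb_def D kernel_sym\<close>)
      also have "\<dots> = (\<integral>x. fst p * K (snd p) x \<partial>M) + (\<integral>x. comb l x \<partial>M)"
        by (rule Bochner_Integration.integral_add)
           (use quad(1)[of "K (snd p)" C] cont1[OF p] bd[OF p] Hint(1)[OF comb_mem[OF l]] in auto)
      also have "\<dots> = fst p + lin l (\<lambda>x. 1)" using Cons.IH[OF l] one[OF p] by simp
      finally show ?case by simp
    qed
    have ln: "sqrt (b n) \<noteq> 0 \<Longrightarrow> \<bar>bil K \<pi> (\<delta> n)\<bar> / sqrt (b n) \<le> ?S" for n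
    proof -
      assume nz: "sqrt (b n) \<noteq> 0"
      define l where "l = smul (1 / sqrt (b n)) (\<delta> n)"
      have l: "l \<in> combs D" using \<delta> by (simp add: l_def)
      have "ip (comb l) (comb l) = (1 / sqrt (b n)) * (1 / sqrt (b n)) * b n"
        by (simp add: ip_comb_comb[OF l]) (simp add: l_def b_def)
      also have "\<dots> = 1" using nz b0[of n] by simp
      finally have n1: "sqrt (ip (comb l) (comb l)) \<le> 1" by simp
      \<comment> \<open>Both quadratures in \<open>\<delta> n\<close> have total mass 1, and every
        kernel section has integral 1, so the test function has mean zero and its error is its mean
        over \<open>P\<close>.\<close>
      have "(\<integral>x. comb l x \<partial>M) = 0"
        using P(1) by (simp add: int[OF l]) (simp add: l_def \<delta>_def lin\<pi> lin\<mu> prob_space)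
      moreover have "lin \<pi> (comb l) = lin \<pi> (\<lambda>x. lin l (K x))"
        by (rule lin_cong[OF \<pi>]) (simp add: comb_def)
      ultimately have "err (comb l) = \<bar>bil K \<pi> l\<bar>" by (simp add: err_def bil_def flip: lin\<pi>)
      also have "\<dots> = \<bar>bil K \<pi> (\<delta> n)\<bar> / sqrt (b n)" using b0[of n] by (simp add: l_def abs_mult)
      finally show ?thesis using sup[OF comb_mem[OF l] n1] by simp
    qed
    have "(\<lambda>n. bil K \<pi> (\<delta> n)) = (\<lambda>n. E - bil K \<pi> (\<mu> n))" by (simp add: \<delta>_def E)
    moreover have "(\<lambda>n. E - bil K \<pi> (\<mu> n)) \<longlonglongrightarrow> E - 1" by (intro tendsto_intros mid)
    ultimately have "(\<lambda>n. bil K \<pi> (\<delta> n)) \<longlonglongrightarrow> E - 1" by simp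
    then have lim: "(\<lambda>n. \<bar>bil K \<pi> (\<delta> n)\<bar> / sqrt (b n)) \<longlonglongrightarrow> \<bar>E - 1\<bar> / sqrt (E - 1)"
      using pos by (intro tendsto_intros b) auto
    have eq: "\<bar>E - 1\<bar> / sqrt (E - 1) = sqrt (E - 1)"
      using pos by (simp add: real_div_sqrt)
    have "\<forall>\<^sub>F n in sequentially. \<bar>bil K \<pi> (\<delta> n)\<bar> / sqrt (b n) \<le> ?S"
      using order_tendstoD(1)[OF b pos] by eventually_elim (use ln in auto)
    from tendsto_upperbound[OF lim this sequentially_bot] show ?thesis by (simp only: eq)
  qed
  moreover have "?S \<le> sqrt (E - 1)"
    by (rule cSUP_least) (use zero upper in \<open>auto simp: err_def\<close>)
  ultimately show "?S = sqrt ((\<Sum>x\<in>#P. \<Sum>y\<in>#P. K x y) / (real (size P))\<^sup>2 - 1)"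
    by (simp add: E_def)
qed

section \<open>The unit cube with rounding to a grid\<close>

abbreviation unit_measure :: "real measure" where
  "unit_measure \<equiv> restrict_space lborel {0..1}"

lemma prob_space_unit: "prob_space unit_measure"
  by (rule prob_space_restrict_space) auto

lemma prob_space_cube: "prob_space (cube_measure s)"
  unfolding cube_measure_def by (intro prob_space_PiM prob_space_unit)

text \<open>Rounding down keeps points inside the cube and leaves finitely many values;
  \<open>Suc n\<close> keeps the mesh defined at \<open>n = 0\<close>.\<close>

definition grid :: "nat \<Rightarrow> nat \<Rightarrow> (nat \<Rightarrow> real) \<Rightarrow> nat \<Rightarrow> real" where
  "grid s n x = (\<lambda>j\<in>{1..s}. of_int \<lfloor>real (Suc n) * x j\<rfloor> / real (Suc n))"

lemma grid_coord:
  assumes "x \<in> {0..1::real}"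
  shows "of_int \<lfloor>real (Suc n) * x\<rfloor> / real (Suc n) \<in> (\<lambda>k. real k / real (Suc n)) ` {..Suc n}"
proof -
  have "0 \<le> real (Suc n) * x" "real (Suc n) * x \<le> real (Suc n)"
    using assms by (auto intro: mult_left_le)
  then have "0 \<le> \<lfloor>real (Suc n) * x\<rfloor>" "\<lfloor>real (Suc n) * x\<rfloor> \<le> int (Suc n)" by linarith+
  then show ?thesis by (intro image_eqI[of _ _ "nat \<lfloor>real (Suc n) * x\<rfloor>"]) auto
qed

lemma grid_cube:
  assumes "x \<in> cube s" shows "grid s n x \<in> cube s"
proof -
  have "of_int \<lfloor>real (Suc n) * x j\<rfloor> / real (Suc n) \<in> {0..1::real}" if "j \<in> {1..s}" for j
  proof -
    have "x j \<in> {0..1}" using assms that by (auto simp: cube_def)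
    from grid_coord[OF this, of n]
    obtain k where "k \<le> Suc n" "of_int \<lfloor>real (Suc n) * x j\<rfloor> / real (Suc n) = real k / real (Suc n)"
      by blast
    then show ?thesis by (simp only:) simp
  qed
  then show ?thesis unfolding cube_def grid_def by (intro restrict_PiE_iff[THEN iffD2] ballI)
qed

lemma grid_simple: "simple_function (cube_measure s) (grid s n)"
  unfolding simple_function_def
proof (intro conjI ballI)
  have "grid s n ` cube s \<subseteq> {1..s} \<rightarrow>\<^sub>E (\<lambda>k. real k / real (Suc n)) ` {..Suc n}"
    unfolding cube_def grid_def
    by (intro image_subsetI restrict_PiE_iff[THEN iffD2] ballI grid_coord) (auto simp: PiE_iff)
  then show "finite (grid s n ` space (cube_measure s))"
    unfolding space_cube_measure by (rule finite_subset) (intro finite_PiE finite_imageI; simp)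
  fix y assume "y \<in> grid s n ` space (cube_measure s)"
  then have y: "y \<in> extensional {1..s}" by (auto simp: grid_def)
  have "grid s n -` {y} \<inter> space (cube_measure s)
      = {x \<in> space (cube_measure s). \<forall>j\<in>{1..s}. of_int \<lfloor>real (Suc n) * x j\<rfloor> / real (Suc n) = y j}"
    using y by (auto simp: grid_def extensional_def fun_eq_iff restrict_def)
  also have "\<dots> \<in> sets (cube_measure s)"
  proof -
    have [measurable]: "(\<lambda>x. x j) \<in> borel_measurable (cube_measure s)" if "j \<in> {1..s}" for j
      using measurable_component_singleton[OF that, of "\<lambda>_. unit_measure"]
      unfolding cube_measure_def by (rule measurable_compose) (rule measurable_restrict_space1, simp)
    show ?thesis by measurable
  qed
  finally show "grid s n -` {y} \<inter> space (cube_measure s) \<in> sets (cube_measure s)" .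
qed

lemma grid_tendsto: "j \<in> {1..s} \<Longrightarrow> (\<lambda>n. grid s n x j) \<longlonglongrightarrow> x j"
proof (rule LIM_zero_cancel, rule tendsto_rabs_zero_cancel, rule tendsto_sandwich[OF _ _ tendsto_const])
  assume j: "j \<in> {1..s}"
  have "\<bar>grid s n x j - x j\<bar> \<le> 1 / real (Suc n)" for n
  proof -
    have "\<bar>of_int \<lfloor>real (Suc n) * x j\<rfloor> - real (Suc n) * x j\<bar> \<le> 1" by linarith
    moreover have "grid s n x j - x j = (of_int \<lfloor>real (Suc n) * x j\<rfloor> - real (Suc n) * x j) / real (Suc n)"
      using j by (simp add: grid_def field_simps)
    ultimately show ?thesis by (simp add: divide_right_mono)
  qed
  then show "\<forall>\<^sub>F n in sequentially. \<bar>grid s n x j - x j\<bar> \<le> 1 / real (Suc n)" by simp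
  show "(\<lambda>n. 1 / real (Suc n)) \<longlonglongrightarrow> 0" by (rule LIMSEQ_Suc[OF lim_1_over_n])
qed auto

text \<open>Only coordinates in \<open>{1..s}\<close> are required to converge, so the property also
  says that \<open>K\<close> depends on these coordinates alone.\<close>

definition seq_continuous :: "nat \<Rightarrow> ((nat \<Rightarrow> real) \<Rightarrow> (nat \<Rightarrow> real) \<Rightarrow> real) \<Rightarrow> bool" where
  "seq_continuous s K \<longleftrightarrow> (\<forall>X Y x y.
     (\<forall>j\<in>{1..s}. (\<lambda>n. X n j) \<longlonglongrightarrow> x j) \<longrightarrow> (\<forall>j\<in>{1..s}. (\<lambda>n. Y n j) \<longlonglongrightarrow> y j) \<longrightarrow>
     (\<lambda>n::nat. K (X n) (Y n)) \<longlonglongrightarrow> K x y)"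

lemma seq_continuousD:
  "\<lbrakk>seq_continuous s K; \<And>j. j \<in> {1..s} \<Longrightarrow> (\<lambda>n. X n j) \<longlonglongrightarrow> x j;
    \<And>j. j \<in> {1..s} \<Longrightarrow> (\<lambda>n. Y n j) \<longlonglongrightarrow> y j\<rbrakk> \<Longrightarrow> (\<lambda>n. K (X n) (Y n)) \<longlonglongrightarrow> K x y"
  unfolding seq_continuous_def by blast

theorem worst_case_error_cube:
  assumes K: "psd (cube s) K" and cont: "seq_continuous s K"
    and bd: "\<And>x y. \<lbrakk>x \<in> cube s; y \<in> cube s\<rbrakk> \<Longrightarrow> \<bar>K x y\<bar> \<le> C"
    and one: "\<And>x. x \<in> cube s \<Longrightarrow> (\<integral>y. K x y \<partial>cube_measure s) = 1"
    and P: "P \<noteq> {#}" "set_mset P \<subseteq> cube s"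
  shows "1 \<le> (\<Sum>x\<in>#P. \<Sum>y\<in>#P. K x y) / (real (size P))\<^sup>2"
    and "worst_case_error s P (RKHS (cube s) K)
        = sqrt ((\<Sum>x\<in>#P. \<Sum>y\<in>#P. K x y) / (real (size P))\<^sup>2 - 1)"
proof -
  obtain ip where ip: "rkhs (cube s) K (fst (RKHS (cube s) K)) ip"
    "snd (RKHS (cube s) K) = (\<lambda>f. sqrt (ip f f))" using RKHS_rkhs[OF K] .
  have "(\<lambda>n. K x (grid s n y)) \<longlonglongrightarrow> K x y" "(\<lambda>n. K (grid s n x) (grid s n y)) \<longlonglongrightarrow> K x y" for x y
    by (intro seq_continuousD[OF cont] grid_tendsto tendsto_const; assumption)+
  note * = worst_case_error_formula[where G = "grid s" and K = K and C = C,
      OF ip(1) prob_space_cube space_cube_measure grid_simple grid_cube this bd one P]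
  show "1 \<le> (\<Sum>x\<in>#P. \<Sum>y\<in>#P. K x y) / (real (size P))\<^sup>2" by (rule *(1))
  show "worst_case_error s P (RKHS (cube s) K)
        = sqrt ((\<Sum>x\<in>#P. \<Sum>y\<in>#P. K x y) / (real (size P))\<^sup>2 - 1)"
    using *(2) by (simp add: worst_case_error_def ip(2))
qed

section \<open>Fourier series of the Bernoulli polynomials\<close>

text \<open>The coefficient \<open>a n\<close> belongs to frequency \<open>n + 1\<close>; there is
  no constant term.\<close>

definition cos_series :: "(nat \<Rightarrow> real) \<Rightarrow> real \<Rightarrow> real" where
  "cos_series a t = (\<Sum>n. a n * cos (2 * pi * real (Suc n) * t))"

definition sin_series :: "(nat \<Rightarrow> real) \<Rightarrow> real \<Rightarrow> real" where
  "sin_series a t = (\<Sum>n. a n * sin (2 * pi * real (Suc n) * t))"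

abbreviation clausen_cos :: "nat \<Rightarrow> real \<Rightarrow> real" where
  "clausen_cos p \<equiv> cos_series (\<lambda>n. 1 / real (Suc n) ^ p)"

lemma summable_trig:
  assumes "summable (\<lambda>n. \<bar>a n\<bar>)"
  shows "summable (\<lambda>n. a n * cos (2 * pi * real (Suc n) * t))"
    "summable (\<lambda>n. a n * sin (2 * pi * real (Suc n) * t))"
  by (rule summable_comparison_test'[OF assms, of 0]; simp add: abs_mult mult_left_le)+

lemma summable_of_weighted:
  assumes "summable (\<lambda>n. \<bar>a n\<bar> * real (Suc n))" shows "summable (\<lambda>n. \<bar>a n :: real\<bar>)"
  by (rule summable_comparison_test'[OF assms, of 0]) (simp add: mult_le_cancel_left1)

lemma cos_series_deriv:
  assumes "summable (\<lambda>n. \<bar>a n\<bar> * real (Suc n))"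
  shows "(cos_series a has_real_derivative - 2 * pi * sin_series (\<lambda>n. a n * real (Suc n)) t) (at t)"
proof -
  let ?f = "\<lambda>n x. a n * cos (2 * pi * real (Suc n) * x)"
  let ?f' = "\<lambda>n x. - 2 * pi * (a n * real (Suc n) * sin (2 * pi * real (Suc n) * x))"
  have "((\<lambda>x. \<Sum>n. ?f n x) has_field_derivative (\<Sum>n. ?f' n t)) (at t)"
  proof (rule has_field_derivative_series'(2)[of UNIV ?f ?f' 0])
    show "(?f n has_field_derivative ?f' n x) (at x within UNIV)" for n x
      by (auto intro!: derivative_eq_intros simp: algebra_simps)
    show "uniformly_convergent_on UNIV (\<lambda>n x. \<Sum>i<n. ?f' i x)"
    proof (rule Weierstrass_m_test')
      show "norm (?f' n x) \<le> 2 * pi * (\<bar>a n\<bar> * real (Suc n))" for n x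
        using mult_left_mono[OF abs_sin_le_one[of "2 * pi * real (Suc n) * x"], of "2 * pi * (\<bar>a n\<bar> * real (Suc n))"]
        by (simp add: abs_mult mult_ac del: of_nat_Suc)
      show "summable (\<lambda>n. 2 * pi * (\<bar>a n\<bar> * real (Suc n)))" by (rule summable_mult[OF assms])
    qed
    show "summable (\<lambda>n. ?f n 0)" by (rule summable_trig(1)[OF summable_of_weighted[OF assms]])
  qed auto
  moreover have "(\<Sum>n. ?f' n t) = - 2 * pi * sin_series (\<lambda>n. a n * real (Suc n)) t"
    unfolding sin_series_def
    by (rule suminf_mult, rule summable_trig(2)) (use assms in \<open>simp add: abs_mult\<close>)
  moreover have "cos_series a = (\<lambda>x. \<Sum>n. ?f n x)" by (auto simp: cos_series_def)
  ultimately show ?thesis by simp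
qed

lemma sin_series_deriv:
  assumes "summable (\<lambda>n. \<bar>a n\<bar> * real (Suc n))"
  shows "(sin_series a has_real_derivative 2 * pi * cos_series (\<lambda>n. a n * real (Suc n)) t) (at t)"
proof -
  let ?f = "\<lambda>n x. a n * sin (2 * pi * real (Suc n) * x)"
  let ?f' = "\<lambda>n x. 2 * pi * (a n * real (Suc n) * cos (2 * pi * real (Suc n) * x))"
  have "((\<lambda>x. \<Sum>n. ?f n x) has_field_derivative (\<Sum>n. ?f' n t)) (at t)"
  proof (rule has_field_derivative_series'(2)[of UNIV ?f ?f' 0])
    show "(?f n has_field_derivative ?f' n x) (at x within UNIV)" for n x
      by (auto intro!: derivative_eq_intros simp: algebra_simps)
    show "uniformly_convergent_on UNIV (\<lambda>n x. \<Sum>i<n. ?f' i x)"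
    proof (rule Weierstrass_m_test')
      show "norm (?f' n x) \<le> 2 * pi * (\<bar>a n\<bar> * real (Suc n))" for n x
        using mult_left_mono[OF abs_cos_le_one[of "2 * pi * real (Suc n) * x"], of "2 * pi * (\<bar>a n\<bar> * real (Suc n))"]
        by (simp add: abs_mult mult_ac del: of_nat_Suc)
      show "summable (\<lambda>n. 2 * pi * (\<bar>a n\<bar> * real (Suc n)))" by (rule summable_mult[OF assms])
    qed
    show "summable (\<lambda>n. ?f n 0)" by simp
  qed auto
  moreover have "(\<Sum>n. ?f' n t) = 2 * pi * cos_series (\<lambda>n. a n * real (Suc n)) t"
    unfolding cos_series_def
    by (rule suminf_mult, rule summable_trig(1)) (use assms in \<open>simp add: abs_mult\<close>)
  moreover have "sin_series a = (\<lambda>x. \<Sum>n. ?f n x)" by (auto simp: sin_series_def)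
  ultimately show ?thesis by simp
qed

lemma cos_reflect: "cos (2 * pi * real n * (1 - t)) = cos (2 * pi * real n * t)"
proof -
  have "cos (2 * pi * real n * (1 - t)) = cos (2 * pi * real n - 2 * pi * real n * t)"
    by (simp add: algebra_simps)
  also have "\<dots> = cos (2 * pi * real n * t)"
    using cos_integer_2pi[of "real n"] sin_integer_2pi[of "real n"] by (simp add: cos_diff)
  finally show ?thesis .
qed

lemma cos_series_reflect: "cos_series a (1 - t) = cos_series a t"
  unfolding cos_series_def by (simp only: cos_reflect)

lemma sin_series_half: "sin_series a (1/2) = 0"
proof -
  have "sin (2 * pi * real (Suc n) * (1/2)) = 0" for n
    using sin_npi2[of "Suc n"] by (simp add: mult.commute)
  then show ?thesis by (simp only: sin_series_def) simp
qed

text \<open>Expansion at a critical point. It is used with c = 1/2, where the sine series of the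
  first derivative vanishes.\<close>

lemma taylor_second_order:
  fixes f :: "real \<Rightarrow> real"
  assumes "\<And>x. (f has_real_derivative f' x) (at x)" "\<And>x. (f' has_real_derivative f'' x) (at x)"
    and "t < c" "f' c = 0"
  obtains \<xi> where "t < \<xi>" "\<xi> < c" "f t - f c = f'' \<xi> / 2 * (t - c)\<^sup>2"
proof -
  define d where "d = (\<lambda>m::nat. if m = 0 then f else if m = 1 then f' else f'')"
  have "\<exists>\<xi>. t < \<xi> \<and> \<xi> < c \<and> f t = (\<Sum>m<2. d m c / fact m * (t - c) ^ m) + d 2 \<xi> / fact 2 * (t - c)\<^sup>2"
    by (rule Taylor_down[where b = c]) (use assms in \<open>auto simp: d_def less_2_cases_iff\<close>)
  then show ?thesis using that assms(4) by (auto simp: d_def eval_nat_numeral)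
qed

text \<open>The series is the real part of z/(1 - z) with z = r exp(2 pi i t); adding 1/2 turns it
  into half the Poisson kernel.\<close>

lemma poisson_series:
  assumes r: "0 < r" "r < 1"
  shows "cos_series (\<lambda>n. r ^ Suc n) t + 1/2
    = (1 - r\<^sup>2) / (2 * ((1 - r)\<^sup>2 + 2 * r * (1 - cos (2 * pi * t))))"
proof -
  define \<theta> where "\<theta> = 2 * pi * t"
  define z where "z = rcis r \<theta>"
  have nz: "norm z < 1" using r by (simp add: z_def)
  have "(\<lambda>n. z * z ^ n) sums (z * (1 / (1 - z)))"
    by (intro sums_mult geometric_sums nz)
  then have "(\<lambda>n. Re (z * z ^ n)) sums Re (z * (1 / (1 - z)))" by (rule sums_Re)
  moreover have "Re (z * z ^ n) = r ^ Suc n * cos (2 * pi * real (Suc n) * t)" for n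
  proof -
    have "z * z ^ n = z ^ Suc n" by simp
    also have "\<dots> = rcis (r ^ Suc n) (real (Suc n) * \<theta>)" by (simp only: z_def DeMoivre2)
    finally show ?thesis by (simp add: \<theta>_def mult_ac del: of_nat_Suc power_Suc)
  qed
  ultimately have e: "cos_series (\<lambda>n. r ^ Suc n) t = Re (z / (1 - z))"
    by (simp add: cos_series_def sums_iff)
  have c1: "cos \<theta> \<le> 1" by simp
  have "0 < (1 - r)\<^sup>2" using r by simp
  moreover have "0 \<le> 2 * r * (1 - cos \<theta>)" using r c1 by simp
  ultimately have D: "0 < (1 - r)\<^sup>2 + 2 * r * (1 - cos \<theta>)" by linarith
  have half: "a / d + 1/2 = (2 * a + d) / (2 * d)" if "0 < d" for a d :: real
    using that by (simp add: field_simps)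
  have s: "(sin \<theta>)\<^sup>2 = 1 - (cos \<theta>)\<^sup>2" by (simp add: sin_squared_eq)
  have n: "(Re (1 - z))\<^sup>2 + (Im (1 - z))\<^sup>2 = (1 - r)\<^sup>2 + 2 * r * (1 - cos \<theta>)"
    by (simp add: z_def power_mult_distrib s power2_diff) (simp add: algebra_simps power2_eq_square)
  have "Re (z / (1 - z)) = (r * cos \<theta> * (1 - r * cos \<theta>) - r\<^sup>2 * (sin \<theta>)\<^sup>2)
      / ((1 - r)\<^sup>2 + 2 * r * (1 - cos \<theta>))"
    unfolding Re_divide n by (simp add: z_def power2_eq_square)
  also have "r * cos \<theta> * (1 - r * cos \<theta>) - r\<^sup>2 * (sin \<theta>)\<^sup>2 = r * cos \<theta> - r\<^sup>2"
    unfolding s by (simp add: algebra_simps power2_eq_square)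
  finally have "Re (z / (1 - z)) + 1/2
      = (2 * (r * cos \<theta> - r\<^sup>2) + ((1 - r)\<^sup>2 + 2 * r * (1 - cos \<theta>))) / (2 * ((1 - r)\<^sup>2 + 2 * r * (1 - cos \<theta>)))"
    using half[OF D] by simp
  also have "2 * (r * cos \<theta> - r\<^sup>2) + ((1 - r)\<^sup>2 + 2 * r * (1 - cos \<theta>)) = 1 - r\<^sup>2"
    by (simp add: power2_eq_square algebra_simps)
  finally show ?thesis unfolding e \<theta>_def .
qed

lemma summable_inv_power: "2 \<le> p \<Longrightarrow> summable (\<lambda>n. 1 / real (Suc n) ^ p)"
  using inverse_power_summable[of p, where 'a = real] summable_Suc_iff[of "\<lambda>n. inverse (real n ^ p)"]
  by (simp add: inverse_eq_divide)

text \<open>The half shift multiplies frequency m by (-1)^m, so odd frequencies cancel and even ones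
  double.\<close>

lemma cos_series_distribution:
  assumes "summable (\<lambda>n. \<bar>1 / real (Suc n) ^ p\<bar>)"
  shows "clausen_cos p (t / 2) + clausen_cos p ((t + 1) / 2)
    = 2 / 2 ^ p * clausen_cos p t"
proof -
  let ?a = "\<lambda>n. 1 / real (Suc n) ^ p"
  let ?f = "\<lambda>n. ?a n * cos (2 * pi * real (Suc n) * (t / 2)) + ?a n * cos (2 * pi * real (Suc n) * ((t + 1) / 2))"
  have sg: "cos (2 * pi * real m * ((t + 1) / 2)) = (-1) ^ m * cos (2 * pi * real m * (t / 2))" for m
  proof -
    have "2 * pi * real m * ((t + 1) / 2) = 2 * pi * real m * (t / 2) + real m * pi"
      by (simp add: field_simps)
    then show ?thesis by (simp add: cos_add sin_npi cos_npi)
  qed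
  have "?f sums (cos_series ?a (t / 2) + cos_series ?a ((t + 1) / 2))"
    unfolding cos_series_def by (intro sums_add summable_sums summable_trig assms)
  moreover have "?f sums (2 / 2 ^ p * cos_series ?a t)"
  proof (subst sums_mono_reindex[of "\<lambda>k. 2 * k + 1", symmetric])
    show "strict_mono (\<lambda>k::nat. 2 * k + 1)" by (auto simp: strict_mono_def)
    show "?f n = 0" if "n \<notin> range (\<lambda>k. 2 * k + 1)" for n
    proof -
      \<comment> \<open>An even index carries the odd frequency \<open>n + 1\<close>.\<close>
      have "even n" using that by (metis oddE rangeI)
      then show ?thesis unfolding sg by simp
    qed
    have "?f (2 * k + 1) = 2 / 2 ^ p * (?a k * cos (2 * pi * real (Suc k) * t))" for k
    proof -
      have m: "real (Suc (2 * k + 1)) = 2 * real (Suc k)" by simp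
      have "2 * pi * real (Suc (2 * k + 1)) * (t / 2) = 2 * pi * real (Suc k) * t"
        unfolding m by (simp add: algebra_simps)
      then have "?f (2 * k + 1) = ?a (2 * k + 1) * cos (2 * pi * real (Suc k) * t)
          + ?a (2 * k + 1) * ((-1) ^ Suc (2 * k + 1) * cos (2 * pi * real (Suc k) * t))"
        by (simp only: sg)
      also have "\<dots> = 2 * (?a (2 * k + 1) * cos (2 * pi * real (Suc k) * t))" by simp
            also have "\<dots> = 2 / 2 ^ p * (?a k * cos (2 * pi * real (Suc k) * t))"
        unfolding m power_mult_distrib by simp
      finally show ?thesis .
    qed
    then show "(\<lambda>k. ?f (2 * k + 1)) sums (2 / 2 ^ p * cos_series ?a t)"
      unfolding cos_series_def by (simp only:) (intro sums_mult summable_sums summable_trig assms)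
  qed
  ultimately show ?thesis by (rule sums_unique2)
qed

text \<open>Differentiation determines a function only up to a constant; the distribution relation with
  factor \<open>q \<noteq> 2\<close> forces this constant to vanish.\<close>

lemma zero_of_distribution:
  fixes p :: "real \<Rightarrow> real"
  assumes lo: "\<And>t. \<lbrakk>0 < t; t < 1/2\<rbrakk> \<Longrightarrow> p t = p (1/2)" and refl: "\<And>t. p (1 - t) = p t"
    and dist: "\<And>t. p (t / 2) + p ((t + 1) / 2) = q * p t" and q: "q < 1" and t: "0 \<le> t" "t \<le> 1"
  shows "p t = 0"
proof -
  have const: "p t = p (1/2)" if "0 < t" "t < 1" for t
  proof -
    consider "t < 1/2" | "t = 1/2" | "1 - t < 1/2" by linarith
    then show ?thesis
    proof cases
      case 2
      then show ?thesis by (simp only:)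
    qed (use lo[of t] lo[of "1 - t"] refl[of t] that in auto)
  qed
  have "p (1/4) + p (3/4) = q * p (1/2)" using dist[of "1/2"] by simp
  then have "2 * p (1/2) = q * p (1/2)" using const[of "1/4"] const[of "3/4"] by simp
  then have h: "p (1/2) = 0" using q by auto
  \<comment> \<open>Constancy covers only the open interval. At the endpoints the relation couples
    the endpoint to \<open>p (1/2) = 0\<close>, and \<open>q < 1\<close> finishes.\<close>
  have "p 0 = q * p 0" using dist[of 0] h by simp
  then have 0: "p 0 = 0" using q by auto
  have "p 1 = q * p 1" using dist[of 1] h by simp
  then have 1: "p 1 = 0" using q by auto
  consider "t = 0" | "t = 1" | "0 < t \<and> t < 1" using t by linarith
  then show ?thesis using h 0 1 const[of t] by cases auto
qed

text \<open>The termwise second derivative diverges, so the series is replaced by its Abel means, whose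
  second derivative is \<open>2 \<pi>\<^sup>2\<close> up to a multiple of the Poisson kernel.\<close>

lemma cos_series_2_diff:
  assumes t: "0 < t" "t < 1/2"
  shows "clausen_cos 2 t - clausen_cos 2 (1/2)
    = pi\<^sup>2 * (t - 1/2)\<^sup>2"
proof -
  define r where "r k = real (Suc k) / real (Suc (Suc k))" for k
  have r: "0 < r k" "r k < 1" for k by (auto simp: r_def)
  have rlim: "r \<longlonglongrightarrow> 1"
    unfolding r_def using LIMSEQ_Suc[OF LIMSEQ_n_over_Suc_n[where 'a = real]] by simp
  define S where "S \<rho> = cos_series (\<lambda>n. \<rho> ^ Suc n / real (Suc n) ^ 2)" for \<rho>
  have lim: "(\<lambda>k. S (r k) x) \<longlonglongrightarrow> clausen_cos 2 x" for x
    unfolding S_def cos_series_def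
  proof (rule tannerys_theorem[THEN conjunct2, THEN conjunct2])
    show "(\<lambda>k. r k ^ Suc n / (real (Suc n))\<^sup>2 * cos (2 * pi * real (Suc n) * x))
        \<longlonglongrightarrow> 1 / (real (Suc n))\<^sup>2 * cos (2 * pi * real (Suc n) * x)" for n
      using tendsto_power[OF rlim, of "Suc n"] by (intro tendsto_intros) auto
    have "norm (r k ^ Suc n / (real (Suc n))\<^sup>2 * cos (2 * pi * real (Suc n) * x)) \<le> 1 / real (Suc n) ^ 2" for n k
    proof -
      have "\<bar>r k ^ Suc n / (real (Suc n))\<^sup>2\<bar> * \<bar>cos (2 * pi * real (Suc n) * x)\<bar> \<le> 1 / (real (Suc n))\<^sup>2 * 1"
        using r[of k] power_le_one[of "r k" "Suc n"]
        by (intro mult_mono) (auto simp: abs_of_pos divide_right_mono simp del: power_Suc of_nat_Suc)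
      then show ?thesis by (simp only: real_norm_def abs_mult mult_1_right)
    qed
    then show "\<forall>\<^sub>F (n, k) in sequentially \<times>\<^sub>F sequentially.
        norm (r k ^ Suc n / (real (Suc n))\<^sup>2 * cos (2 * pi * real (Suc n) * x)) \<le> 1 / real (Suc n) ^ 2"
      by (intro always_eventually) auto
    show "summable (\<lambda>n. 1 / real (Suc n) ^ 2)" by (rule summable_inv_power) simp
  qed simp
  \<comment> \<open>A lower bound for 1 - cos(2 pi x) on [t, 1/2]: it keeps the Poisson denominator
    away from zero uniformly in the unknown Taylor point.\<close>
  define c where "c = 1 - cos (2 * pi * t)"
  have c: "0 < c"
    using cos_monotone_0_pi[of 0 "2 * pi * t"] t by (simp add: c_def)
  have bound: "\<bar>(S \<rho> t - S \<rho> (1/2)) - pi\<^sup>2 * (t - 1/2)\<^sup>2\<bar> \<le> pi\<^sup>2 * ((1 - \<rho>\<^sup>2) / (2 * \<rho> * c)) * (t - 1/2)\<^sup>2"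
    if \<rho>: "0 < \<rho>" "\<rho> < 1" for \<rho>
  proof -
    have geo: "summable (\<lambda>n. \<rho> ^ Suc n)" using \<rho> by (simp add: summable_geometric)
    have a1: "summable (\<lambda>n. \<bar>\<rho> ^ Suc n / real (Suc n)\<bar> * real (Suc n))"
      using geo \<rho> by (simp add: abs_of_pos)
    have a2: "summable (\<lambda>n. \<bar>\<rho> ^ Suc n / (real (Suc n))\<^sup>2\<bar> * real (Suc n))"
    proof (rule summable_comparison_test'[OF geo, of 0])
      show "norm (\<bar>\<rho> ^ Suc n / (real (Suc n))\<^sup>2\<bar> * real (Suc n)) \<le> \<rho> ^ Suc n" for n
      proof -
        have "norm (\<bar>\<rho> ^ Suc n / (real (Suc n))\<^sup>2\<bar> * real (Suc n)) = \<rho> ^ Suc n / real (Suc n)"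
          using \<rho> by (simp add: abs_of_pos power2_eq_square field_simps del: of_nat_Suc)
        also have "\<dots> \<le> \<rho> ^ Suc n / 1" using \<rho> by (intro divide_left_mono) auto
        finally show ?thesis by simp
      qed
    qed
    have d1: "(S \<rho> has_real_derivative - 2 * pi * sin_series (\<lambda>n. \<rho> ^ Suc n / real (Suc n)) x) (at x)" for x
      using cos_series_deriv[OF a2, of x] unfolding S_def
      by (simp add: power2_eq_square field_simps del: of_nat_Suc power_Suc)
    have d2: "((\<lambda>x. - 2 * pi * sin_series (\<lambda>n. \<rho> ^ Suc n / real (Suc n)) x)
        has_real_derivative - 2 * pi * (2 * pi * cos_series (\<lambda>n. \<rho> ^ Suc n) x)) (at x)" for x
      using DERIV_cmult[OF sin_series_deriv[OF a1, of x], of "- 2 * pi"] by simp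
    obtain \<xi> where \<xi>: "t < \<xi>" "\<xi> < 1/2"
      "S \<rho> t - S \<rho> (1/2) = - 2 * pi * (2 * pi * cos_series (\<lambda>n. \<rho> ^ Suc n) \<xi>) / 2 * (t - 1/2)\<^sup>2"
      using taylor_second_order[OF d1 d2 t(2)] sin_series_half by auto
    define D where "D = (1 - \<rho>)\<^sup>2 + 2 * \<rho> * (1 - cos (2 * pi * \<xi>))"
    have "cos (2 * pi * \<xi>) \<le> cos (2 * pi * t)"
      using \<xi> t by (intro cos_monotone_0_pi_le) auto
    then have "c \<le> 1 - cos (2 * pi * \<xi>)" by (simp add: c_def)
    then have "2 * \<rho> * c \<le> 2 * \<rho> * (1 - cos (2 * pi * \<xi>))" using \<rho> by simp
    moreover have "0 \<le> (1 - \<rho>)\<^sup>2" by simp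
    ultimately have D: "2 * \<rho> * c \<le> D" unfolding D_def by linarith
    have p: "0 < 2 * \<rho> * c" using \<rho> c by simp
    have r2: "0 \<le> 1 - \<rho>\<^sup>2" using \<rho> by (simp add: power_le_one)
    \<comment> \<open>\<open>e\<close> is the Poisson part, which vanishes as the radius tends to 1;
      the remaining -1/2 produces the term pi^2 (t - 1/2)^2.\<close>
    define e where "e = (1 - \<rho>\<^sup>2) / D / 2"
    have cs: "cos_series (\<lambda>n. \<rho> ^ Suc n) \<xi> = e - 1/2"
      using poisson_series[OF \<rho>, of \<xi>] by (simp add: e_def flip: D_def)
    have dbl: "2 * (x / 2) = x" for x :: real by simp
    have "0 < D * (2 * \<rho> * c)" using mult_pos_pos[OF less_le_trans[OF p D] p] .
    then have "(1 - \<rho>\<^sup>2) / D \<le> (1 - \<rho>\<^sup>2) / (2 * \<rho> * c)"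
      by (rule divide_left_mono[OF D r2])
    moreover have "2 * e = (1 - \<rho>\<^sup>2) / D" unfolding e_def by (rule dbl)
    ultimately have e2: "2 * e \<le> (1 - \<rho>\<^sup>2) / (2 * \<rho> * c)" by (simp only:)
    have ring_id: "- 2 * pi * (2 * pi * (e - 1/2)) / 2 * q - pi\<^sup>2 * q = - (pi\<^sup>2 * (2 * e) * q)" for e q
      by (simp add: power2_eq_square field_simps)
    have "(S \<rho> t - S \<rho> (1/2)) - pi\<^sup>2 * (t - 1/2)\<^sup>2 = - (pi\<^sup>2 * (2 * e) * (t - 1/2)\<^sup>2)"
      unfolding \<xi>(3) cs using ring_id[of e "(t - 1/2)\<^sup>2"] .
    moreover have "0 \<le> e" using r2 D p by (simp add: e_def)
    ultimately have "\<bar>(S \<rho> t - S \<rho> (1/2)) - pi\<^sup>2 * (t - 1/2)\<^sup>2\<bar> = pi\<^sup>2 * (2 * e) * (t - 1/2)\<^sup>2"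
      by (simp add: abs_mult)
    also have "\<dots> \<le> pi\<^sup>2 * ((1 - \<rho>\<^sup>2) / (2 * \<rho> * c)) * (t - 1/2)\<^sup>2"
      by (intro mult_right_mono mult_left_mono e2) auto
    finally show ?thesis .
  qed
  have "(\<lambda>k. (S (r k) t - S (r k) (1/2)) - pi\<^sup>2 * (t - 1/2)\<^sup>2) \<longlonglongrightarrow> 0"
  proof (rule Lim_null_comparison)
    show "\<forall>\<^sub>F k in sequentially. norm (S (r k) t - S (r k) (1/2) - pi\<^sup>2 * (t - 1/2)\<^sup>2)
        \<le> pi\<^sup>2 * ((1 - (r k)\<^sup>2) / (2 * r k * c)) * (t - 1/2)\<^sup>2"
      using bound[OF r] by simp
    have "(\<lambda>k. pi\<^sup>2 * ((1 - (r k)\<^sup>2) / (2 * r k * c)) * (t - 1/2)\<^sup>2)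
        \<longlonglongrightarrow> pi\<^sup>2 * ((1 - 1\<^sup>2) / (2 * 1 * c)) * (t - 1/2)\<^sup>2"
      by (intro tendsto_intros rlim) (use c in auto)
    then show "(\<lambda>k. pi\<^sup>2 * ((1 - (r k)\<^sup>2) / (2 * r k * c)) * (t - 1/2)\<^sup>2) \<longlonglongrightarrow> 0" by simp
  qed
  moreover have "(\<lambda>k. (S (r k) t - S (r k) (1/2)) - pi\<^sup>2 * (t - 1/2)\<^sup>2) \<longlonglongrightarrow>
      (clausen_cos 2 t - clausen_cos 2 (1/2)) - pi\<^sup>2 * (t - 1/2)\<^sup>2"
    by (intro tendsto_intros lim)
  ultimately show ?thesis using LIMSEQ_unique by fastforce
qed

text \<open>The series and the quadratic obey the same reflection and the same distribution
  relation, with factor 2/2^2 = 1/2, so their difference is constant and hence zero.\<close>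

theorem cos_series_2:
  assumes "0 \<le> t" "t \<le> 1"
  shows "clausen_cos 2 t = pi\<^sup>2 * (t\<^sup>2 - t + 1/6)"
proof -
  let ?C = "clausen_cos 2"
  define p where "p t = ?C t - pi\<^sup>2 * (t\<^sup>2 - t + 1/6)" for t
  have lo: "p t = p (1/2)" if "0 < t" "t < 1/2" for t
    using cos_series_2_diff[OF that] by (simp add: p_def power2_eq_square algebra_simps)
  have refl: "p (1 - t) = p t" for t
    by (simp add: p_def cos_series_reflect) (simp add: power2_eq_square algebra_simps)
  have "p t = 0"
  proof (rule zero_of_distribution[where p = p and q = "1/2"])
    show "p (t / 2) + p ((t + 1) / 2) = 1/2 * p t" for t
      using cos_series_distribution[of 2 t] summable_inv_power[of 2]
      by (simp add: p_def power2_eq_square) (simp add: field_simps)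
  qed (use assms lo refl in auto)
  then show ?thesis by (simp add: p_def)
qed

text \<open>Two termwise differentiations are legitimate here and lead back to
  \<open>cos_series_2\<close>, so the second derivative of the difference vanishes on [0,1]. The
  distribution factor is 2/2^4 = 1/8.\<close>

theorem cos_series_4:
  assumes "0 \<le> t" "t \<le> 1"
  shows "clausen_cos 4 t = - (pi ^ 4 / 3) * (t ^ 4 - 2 * t ^ 3 + t\<^sup>2 - 1/30)"
proof -
  let ?C = "clausen_cos 4"
  define p where "p t = ?C t + (pi ^ 4 / 3) * (t ^ 4 - 2 * t ^ 3 + t\<^sup>2 - 1/30)" for t
  define p' where "p' t = - 2 * pi * sin_series (\<lambda>n. 1 / real (Suc n) ^ 3) t
      + (pi ^ 4 / 3) * (4 * t ^ 3 - 6 * t\<^sup>2 + 2 * t)" for t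
  define p'' where "p'' t = - 2 * pi * (2 * pi * clausen_cos 2 t)
      + (pi ^ 4 / 3) * (12 * t\<^sup>2 - 12 * t + 2)" for t
  have e4: "1 / real (Suc n) ^ 4 * real (Suc n) = 1 / real (Suc n) ^ 3" for n
    by (simp add: eval_nat_numeral field_simps del: of_nat_Suc)
  have e3: "1 / real (Suc n) ^ 3 * real (Suc n) = 1 / real (Suc n) ^ 2" for n
    by (simp add: eval_nat_numeral field_simps del: of_nat_Suc)
  have s4: "summable (\<lambda>n. \<bar>1 / real (Suc n) ^ 4\<bar> * real (Suc n))"
    using summable_inv_power[of 3] e4 by simp
  have s3: "summable (\<lambda>n. \<bar>1 / real (Suc n) ^ 3\<bar> * real (Suc n))"
    using summable_inv_power[of 2] e3 by simp
  have d1: "(p has_real_derivative p' x) (at x)" for x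
    unfolding p_def p'_def
    by (rule derivative_eq_intros cos_series_deriv[OF s4] refl)+ (simp add: e4 eval_nat_numeral)
  have d2: "(p' has_real_derivative p'' x) (at x)" for x
    unfolding p'_def p''_def
    by (rule derivative_eq_intros sin_series_deriv[OF s3] refl)+ (simp add: e3 eval_nat_numeral)
  have p'0: "p' (1/2) = 0" by (simp add: p'_def sin_series_half power2_eq_square power3_eq_cube)
  have lo: "p t = p (1/2)" if t: "0 < t" "t < 1/2" for t
  proof -
    obtain \<xi> where \<xi>: "t < \<xi>" "\<xi> < 1/2" "p t - p (1/2) = p'' \<xi> / 2 * (t - 1/2)\<^sup>2"
      using taylor_second_order[OF d1 d2 t(2) p'0] .
    have "clausen_cos 2 \<xi> = pi\<^sup>2 * (\<xi>\<^sup>2 - \<xi> + 1/6)"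
      by (rule cos_series_2) (use \<xi> t in auto)
    then have "p'' \<xi> = 0" unfolding p''_def by (simp only:) (simp add: eval_nat_numeral algebra_simps)
    then show ?thesis using \<xi> by simp
  qed
  have refl: "p (1 - t) = p t" for t
    by (simp add: p_def cos_series_reflect) (simp add: eval_nat_numeral algebra_simps)
  have "p t = 0"
  proof (rule zero_of_distribution[where p = p and q = "1/8"])
    show "p (t / 2) + p ((t + 1) / 2) = 1/8 * p t" for t
    proof -
      define Q :: "real \<Rightarrow> real" where "Q t = t ^ 4 - 2 * t ^ 3 + t\<^sup>2 - 1/30" for t
      define k :: real where "k = pi ^ 4 / 3"
      have "Q (t / 2) + Q ((t + 1) / 2) = 1/8 * Q t"
        by (simp add: Q_def eval_nat_numeral field_simps)
      then have "k * Q (t / 2) + k * Q ((t + 1) / 2) = k * (1/8 * Q t)"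
        by (simp only: flip: distrib_left)
      moreover have "?C (t / 2) + ?C ((t + 1) / 2) = 1/8 * ?C t"
        using cos_series_distribution[of 4 t] summable_inv_power[of 4] by simp
      moreover have p: "p t = ?C t + k * Q t" for t by (simp add: p_def Q_def k_def)
      ultimately show ?thesis unfolding p by (simp add: algebra_simps)
    qed
  qed (use assms lo refl in auto)
  then show ?thesis by (simp add: p_def)
qed

section \<open>Product kernels\<close>

text \<open>Positivity is propagated through products of kernels by the pointwise multipliers of the cone
  of functions on which given functionals are nonnegative. For the functionals of positive
  semidefiniteness this replaces the Schur product theorem; below it is also used with
  the cosine coefficients on a lattice.\<close>

definition dual_cone :: "(real \<times> 'p) list set \<Rightarrow> ('p \<Rightarrow> real) set" where
  "dual_cone T = {W. \<forall>l\<in>T. 0 \<le> lin l W}"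

text \<open>Multiplying two multipliers composes the maps they induce on the cone, so closure under
  products is immediate. Once the constant 1 lies in the cone, every multiplier does.\<close>

definition multipliers :: "(real \<times> 'p) list set \<Rightarrow> ('p \<Rightarrow> real) set" where
  "multipliers T = {M. \<forall>W\<in>dual_cone T. (\<lambda>p. M p * W p) \<in> dual_cone T}"

lemma cone_add: "W \<in> dual_cone T \<Longrightarrow> V \<in> dual_cone T \<Longrightarrow> (\<lambda>p. W p + V p) \<in> dual_cone T"
  by (auto simp: dual_cone_def lin_add)

lemma cone_scale: "0 \<le> c \<Longrightarrow> W \<in> dual_cone T \<Longrightarrow> (\<lambda>p. c * W p) \<in> dual_cone T"
  by (auto simp: dual_cone_def lin_scale)

lemma cone_limit:
  assumes "\<And>n::nat. W n \<in> dual_cone T" "\<And>p. (\<lambda>n. W n p) \<longlonglongrightarrow> V p"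
  shows "V \<in> dual_cone T"
proof -
  have "0 \<le> lin l V" if l: "l \<in> T" for l
  proof (rule LIMSEQ_le_const)
    show "(\<lambda>n. lin l (W n)) \<longlonglongrightarrow> lin l V"
      by (rule lin_tendsto[of l UNIV]) (use assms(2) in \<open>auto simp: combs_def\<close>)
  qed (use assms(1) l in \<open>auto simp: dual_cone_def\<close>)
  then show ?thesis by (simp add: dual_cone_def)
qed

lemma multiplier_cone: "M \<in> multipliers T \<Longrightarrow> W \<in> dual_cone T \<Longrightarrow> (\<lambda>p. M p * W p) \<in> dual_cone T"
  by (simp add: multipliers_def)

lemma multiplier_add: "M \<in> multipliers T \<Longrightarrow> M' \<in> multipliers T \<Longrightarrow> (\<lambda>p. M p + M' p) \<in> multipliers T"
  unfolding multipliers_def using cone_add by (fastforce simp: distrib_right)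

lemma multiplier_const: "0 \<le> c \<Longrightarrow> (\<lambda>p. c) \<in> multipliers T"
  by (simp add: multipliers_def cone_scale)

lemma multiplier_mult: "M \<in> multipliers T \<Longrightarrow> M' \<in> multipliers T \<Longrightarrow> (\<lambda>p. M p * M' p) \<in> multipliers T"
  by (simp add: multipliers_def mult.assoc)

lemma multiplier_scale: "0 \<le> c \<Longrightarrow> M \<in> multipliers T \<Longrightarrow> (\<lambda>p. c * M p) \<in> multipliers T"
  by (rule multiplier_mult[OF multiplier_const])

lemma multiplier_sum: "(\<And>i. i \<in> I \<Longrightarrow> M i \<in> multipliers T) \<Longrightarrow> (\<lambda>p. \<Sum>i\<in>I. M i p) \<in> multipliers T"
proof (induction I rule: infinite_finite_induct)
  case (insert i I)
  then have "(\<lambda>p. M i p + (\<Sum> i\<in>I. M i p)) \<in> multipliers T" by (intro multiplier_add) auto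
  then show ?case using insert.hyps by simp
qed (simp_all add: multiplier_const)

lemma multiplier_prod: "(\<And>i. i \<in> I \<Longrightarrow> M i \<in> multipliers T) \<Longrightarrow> (\<lambda>p. \<Prod>i\<in>I. M i p) \<in> multipliers T"
proof (induction I rule: infinite_finite_induct)
  case (insert i I)
  then have "(\<lambda>p. M i p * (\<Prod> i\<in>I. M i p)) \<in> multipliers T" by (intro multiplier_mult) auto
  then show ?case using insert.hyps by simp
qed (simp_all add: multiplier_const)

text \<open>Pointwise convergence suffices because each functional is a finite combination of
  evaluations.\<close>

lemma multiplier_limit:
  assumes "\<And>n::nat. M n \<in> multipliers T" "\<And>p. (\<lambda>n. M n p) \<longlonglongrightarrow> M' p"
  shows "M' \<in> multipliers T"
  unfolding multipliers_def
proof (intro CollectI ballI)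
  fix W assume "W \<in> dual_cone T"
  then have *: "(\<lambda>p. M n p * W p) \<in> dual_cone T" for n by (rule multiplier_cone[OF assms(1)])
  show "(\<lambda>p. M' p * W p) \<in> dual_cone T"
    by (rule cone_limit[where W = "\<lambda>n p. M n p * W p", OF *]) (intro tendsto_mult tendsto_const assms(2))
qed

text \<open>The tensor square of a combination; as a functional on functions of two variables it is
  the quadratic form whose sign defines positive semidefiniteness.\<close>

definition square :: "(real \<times> 'x) list \<Rightarrow> (real \<times> 'x \<times> 'x) list" where
  "square l = concat (map (\<lambda>(c, x). map (\<lambda>(d, y). (c * d, (x, y))) l) l)"

lemma lin_square: "lin (square l) W = lin l (\<lambda>x. lin l (\<lambda>y. W (x, y)))"
proof -
  have 1: "lin (map (\<lambda>(d, y). (c * d, (x, y))) m) W = c * lin m (\<lambda>y. W (x, y))" for c x m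
    by (induction m) (auto simp: algebra_simps)
  have "lin (concat (map (\<lambda>(c, x). map (\<lambda>(d, y). (c * d, (x, y))) l) m)) W
      = lin m (\<lambda>x. lin l (\<lambda>y. W (x, y)))" for m
    by (induction m) (auto simp: 1)
  then show ?thesis by (simp add: square_def)
qed

definition squares :: "'x set \<Rightarrow> (real \<times> 'x \<times> 'x) list set" where
  "squares D = square ` combs D"

lemma cone_squares_iff: "W \<in> dual_cone (squares D) \<longleftrightarrow> (\<forall>l\<in>combs D. 0 \<le> lin l (\<lambda>x. lin l (\<lambda>y. W (x, y))))"
  by (auto simp: dual_cone_def squares_def lin_square)

lemma one_cone_squares: "(\<lambda>p. 1) \<in> dual_cone (squares D)"
proof -
  have "lin l (\<lambda>x. lin l (\<lambda>y. 1)) = lin l (\<lambda>x. 1) * lin l (\<lambda>y. 1)" for l :: "(real \<times> 'a) list"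
    using lin_scale[of l "lin l (\<lambda>y. 1)" "\<lambda>x. 1"] by simp
  then show ?thesis by (simp add: cone_squares_iff)
qed

text \<open>The factor \<open>f\<close> can be absorbed into the coefficients of the combination,
  and the result is again a tensor square.\<close>

lemma rank_one_multiplier: "(\<lambda>(x, y). f x * f y) \<in> multipliers (squares D)"
  unfolding multipliers_def
proof (intro CollectI ballI)
  fix W assume W: "W \<in> dual_cone (squares D)"
  show "(\<lambda>p. (case p of (x, y) \<Rightarrow> f x * f y) * W p) \<in> dual_cone (squares D)"
    unfolding cone_squares_iff
  proof
    fix l assume l: "l \<in> combs D"
    define m where "m = map (\<lambda>(c, x). (c * f x, x)) l"
    have m: "m \<in> combs D" using l by (auto simp: m_def combs_def)
    have e: "lin m g = lin l (\<lambda>x. f x * g x)" for g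
      unfolding m_def by (induction l) auto
    have "lin l (\<lambda>x. lin l (\<lambda>y. (f x * f y) * W (x, y))) = lin m (\<lambda>x. lin m (\<lambda>y. W (x, y)))"
      by (simp add: e mult.assoc lin_scale)
    then show "0 \<le> lin l (\<lambda>x. lin l (\<lambda>y. (case (x, y) of (x, y) \<Rightarrow> f x * f y) * W (x, y)))"
      using W m by (simp add: cone_squares_iff)
  qed
qed

text \<open>By the addition theorem each cosine of a difference is a sum of two rank-one kernels,
  and the coefficients are nonnegative.\<close>

lemma cos_series_multiplier:
  assumes "summable (\<lambda>n. \<bar>a n\<bar>)" "\<And>n. 0 \<le> a n"
  shows "(\<lambda>(x, y). cos_series a (h x - h y)) \<in> multipliers (squares D)"
proof (rule multiplier_limit)
  let ?c = "\<lambda>n. 2 * pi * real (Suc n)"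
  show "(\<lambda>p. \<Sum>n<N. a n * ((case p of (x, y) \<Rightarrow> cos (?c n * h x) * cos (?c n * h y))
      + (case p of (x, y) \<Rightarrow> sin (?c n * h x) * sin (?c n * h y)))) \<in> multipliers (squares D)" for N
    by (intro multiplier_sum multiplier_scale multiplier_add rank_one_multiplier assms)
  fix p :: "'a \<times> 'a"
  obtain x y where p: "p = (x, y)" by fastforce
  have "(\<lambda>n. a n * cos (?c n * (h x - h y))) sums cos_series a (h x - h y)"
    unfolding cos_series_def by (intro summable_sums summable_trig assms)
  then show "(\<lambda>N. \<Sum>n<N. a n * ((case p of (x, y) \<Rightarrow> cos (?c n * h x) * cos (?c n * h y))
      + (case p of (x, y) \<Rightarrow> sin (?c n * h x) * sin (?c n * h y))))
      \<longlonglongrightarrow> (case p of (x, y) \<Rightarrow> cos_series a (h x - h y))"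
    by (simp add: p sums_def right_diff_distrib cos_diff del: of_nat_Suc)
qed

lemma integrable_unit:
  fixes f :: "real \<Rightarrow> real"
  assumes "continuous_on {0..1} f" shows "integrable unit_measure f"
  using borel_integrable_atLeastAtMost'[OF assms]
  by (subst integrable_restrict_space) (simp_all add: set_integrable_def)

section \<open>Worst-case errors for products of mean-zero factors\<close>

definition product_kernel ::
    "(nat set \<Rightarrow> real) \<Rightarrow> nat \<Rightarrow> (real \<Rightarrow> real \<Rightarrow> real) \<Rightarrow> (nat \<Rightarrow> real) \<Rightarrow> (nat \<Rightarrow> real) \<Rightarrow> real" where
  "product_kernel \<gamma> s g x y = 1 + (\<Sum>u\<in>Pow {1..s} - {{}}. \<gamma> u * (\<Prod>j\<in>u. g (x j) (y j)))"

text \<open>The conditions on a one-dimensional factor that carry over to the weighted product: the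
  multiplier condition yields positivity, and the vanishing mean makes the product kernel integrate
  to 1.\<close>

locale kernel_factor =
  fixes g :: "real \<Rightarrow> real \<Rightarrow> real"
  assumes sym: "g x y = g y x"
    and cont: "continuous_on UNIV (\<lambda>(x, y). g x y)"
    and mean: "x \<in> {0..1} \<Longrightarrow> (\<integral>y. g x y \<partial>unit_measure) = 0"
    and multiplier: "j \<in> {1..s} \<Longrightarrow> (\<lambda>(x, y). g (x j) (y j)) \<in> multipliers (squares (cube s))"
begin

lemma psd_product_kernel:
  assumes "\<And>u. u \<subseteq> {1..s} \<Longrightarrow> 0 \<le> \<gamma> u"
  shows "psd (cube s) (product_kernel \<gamma> s g)"
proof -
  have "(\<lambda>p. 1 + (\<Sum>u\<in>Pow {1..s} - {{}}. \<gamma> u * (\<Prod>j\<in>u. (case p of (x, y) \<Rightarrow> g (x j) (y j)))))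
      \<in> multipliers (squares (cube s))"
    by (intro multiplier_add multiplier_const multiplier_sum multiplier_scale multiplier_prod multiplier)
       (use assms in auto)
  from multiplier_cone[OF this one_cone_squares]
  show ?thesis
    by (simp add: psd_def cone_squares_iff bil_def product_kernel_def[abs_def] sym)
qed

lemma tendsto_g: "X \<longlonglongrightarrow> x \<Longrightarrow> Y \<longlonglongrightarrow> y \<Longrightarrow> (\<lambda>n::nat. g (X n) (Y n)) \<longlonglongrightarrow> g x y"
  using continuous_on_tendsto_compose[OF cont, of "\<lambda>n. (X n, Y n)" "(x, y)"]
  by (simp add: tendsto_Pair)

lemma seq_continuous_product_kernel: "seq_continuous s (product_kernel \<gamma> s g)"
  unfolding seq_continuous_def product_kernel_def
  by (intro allI impI tendsto_intros tendsto_g) auto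

lemma g_bounded: obtains B where "\<And>x y. x \<in> {0..1} \<Longrightarrow> y \<in> {0..1} \<Longrightarrow> \<bar>g x y\<bar> \<le> B"
proof -
  have "compact ((\<lambda>(x, y). g x y) ` ({0..1} \<times> {0..1}))"
    by (intro compact_continuous_image continuous_on_subset[OF cont] compact_Times) auto
  then obtain B where "\<forall>z\<in>(\<lambda>(x, y). g x y) ` ({0..1} \<times> {0..1}). norm z \<le> B"
    using compact_imp_bounded bounded_iff by blast
  then show ?thesis using that by fastforce
qed

lemma product_kernel_bounded:
  obtains C where "\<And>x y. x \<in> cube s \<Longrightarrow> y \<in> cube s \<Longrightarrow> \<bar>product_kernel \<gamma> s g x y\<bar> \<le> C"
proof -
  obtain B where B: "\<And>x y. x \<in> {0..1} \<Longrightarrow> y \<in> {0..1} \<Longrightarrow> \<bar>g x y\<bar> \<le> B" using g_bounded by blast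
  have "\<bar>product_kernel \<gamma> s g x y\<bar> \<le> 1 + (\<Sum>u\<in>Pow {1..s} - {{}}. \<bar>\<gamma> u\<bar> * (\<Prod>j\<in>u. B))"
    if xy: "x \<in> cube s" "y \<in> cube s" for x y
  proof -
    have "\<bar>\<Sum>u\<in>Pow {1..s} - {{}}. \<gamma> u * (\<Prod>j\<in>u. g (x j) (y j))\<bar>
        \<le> (\<Sum>u\<in>Pow {1..s} - {{}}. \<bar>\<gamma> u * (\<Prod>j\<in>u. g (x j) (y j))\<bar>)" by (rule sum_abs)
    also have "\<dots> \<le> (\<Sum>u\<in>Pow {1..s} - {{}}. \<bar>\<gamma> u\<bar> * (\<Prod>j\<in>u. B))"
    proof (rule sum_mono)
      fix u assume u: "u \<in> Pow {1..s} - {{}}"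
      have "x j \<in> {0..1}" "y j \<in> {0..1}" if "j \<in> u" for j
        using xy u that by (auto simp: cube_def PiE_iff)
      then have "(\<Prod>j\<in>u. \<bar>g (x j) (y j)\<bar>) \<le> (\<Prod>j\<in>u. B)" by (intro prod_mono conjI B) auto
      then show "\<bar>\<gamma> u * (\<Prod>j\<in>u. g (x j) (y j))\<bar> \<le> \<bar>\<gamma> u\<bar> * (\<Prod>j\<in>u. B)"
        by (simp add: abs_mult abs_prod mult_left_mono)
    qed
    finally show ?thesis unfolding product_kernel_def by linarith
  qed
  then show ?thesis using that by blast
qed

lemma integrable_g: "integrable unit_measure (g x)"
proof -
  have "continuous_on UNIV ((\<lambda>(x, y). g x y) \<circ> (\<lambda>y. (x, y)))"
    by (intro continuous_on_compose continuous_on_subset[OF cont] continuous_on_Pair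
        continuous_on_const continuous_on_id) auto
  then have "continuous_on UNIV (g x)" by (simp add: o_def)
  then have "continuous_on {0..1} (g x)" by (rule continuous_on_subset) simp
  then show ?thesis by (rule integrable_unit)
qed

lemma integral_product_kernel:
  assumes x: "x \<in> cube s"
  shows "(\<integral>y. product_kernel \<gamma> s g x y \<partial>cube_measure s) = 1"
proof -
  interpret I: prob_space "unit_measure" by (rule prob_space_unit)
  interpret S: prob_space "cube_measure s" by (rule prob_space_cube)
  interpret P: product_sigma_finite "\<lambda>_::nat. unit_measure"
    by unfold_locales
  have fac: "integrable (cube_measure s) (\<lambda>y. \<Prod>j\<in>u. g (x j) (y j)) \<and>
      (\<integral>y. (\<Prod>j\<in>u. g (x j) (y j)) \<partial>cube_measure s) = 0" if u: "u \<in> Pow {1..s} - {{}}" for u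
  proof -
    \<comment> \<open>Padding with 1 outside \<open>u\<close> turns the product over
      \<open>u\<close> into a product over all coordinates, as Fubini for the product measure
      requires.\<close>
    let ?h = "\<lambda>j y. if j \<in> u then g (x j) y else 1"
    have e: "(\<Prod>j\<in>u. g (x j) (y j)) = (\<Prod>j\<in>{1..s}. ?h j (y j))" for y
      using u by (intro prod.mono_neutral_cong_left) auto
    have i: "integrable unit_measure (?h j)" for j
      by (cases "j \<in> u") (simp_all add: integrable_g I.integrable_const)
    obtain k where k: "k \<in> u" using u by blast
    have "x k \<in> {0..1}" using x u k by (auto simp: cube_def PiE_iff)
    then have z: "(\<integral>y. ?h k y \<partial>unit_measure) = 0" using mean k by simp
    have "(\<integral>y. (\<Prod>j\<in>{1..s}. ?h j (y j)) \<partial>cube_measure s)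
        = (\<Prod>j\<in>{1..s}. \<integral>y. ?h j y \<partial>unit_measure)"
      unfolding cube_measure_def by (rule P.product_integral_prod) (auto intro: i)
    also have "\<dots> = 0" using z k u by (intro prod_zero bexI[of _ k]) auto
    moreover have "integrable (cube_measure s) (\<lambda>y. \<Prod>j\<in>{1..s}. ?h j (y j))"
      unfolding cube_measure_def by (rule P.product_integrable_prod) (auto intro: i)
    ultimately show ?thesis unfolding e by simp
  qed
  have "(\<integral>y. product_kernel \<gamma> s g x y \<partial>cube_measure s)
      = (\<integral>y. 1 \<partial>cube_measure s) + (\<integral>y. (\<Sum>u\<in>Pow {1..s} - {{}}. \<gamma> u * (\<Prod>j\<in>u. g (x j) (y j))) \<partial>cube_measure s)"
    unfolding product_kernel_def
    by (rule Bochner_Integration.integral_add)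
       (intro S.integrable_const Bochner_Integration.integrable_sum integrable_mult_right fac[THEN conjunct1]; assumption)+
  also have "(\<integral>y. (\<Sum>u\<in>Pow {1..s} - {{}}. \<gamma> u * (\<Prod>j\<in>u. g (x j) (y j))) \<partial>cube_measure s)
      = (\<Sum>u\<in>Pow {1..s} - {{}}. \<integral>y. \<gamma> u * (\<Prod>j\<in>u. g (x j) (y j)) \<partial>cube_measure s)"
    by (rule Bochner_Integration.integral_sum) (use fac in auto)
  also have "\<dots> = 0" using fac by simp
  finally show ?thesis by (simp add: S.prob_space)
qed

text \<open>The leading 1 of the kernel contributes \<open>(real (size P))\<^sup>2\<close> to the
  double sum, which cancels the subtracted 1 in the general formula.\<close>

theorem worst_case_error_product_kernel:
  assumes \<gamma>: "\<And>u. u \<subseteq> {1..s} \<Longrightarrow> 0 \<le> \<gamma> u" and P: "P \<noteq> {#}" "set_mset P \<subseteq> cube s"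
  shows "(worst_case_error s P (RKHS (cube s) (product_kernel \<gamma> s g)))\<^sup>2
      = (\<Sum>u\<in>Pow {1..s} - {{}}. \<gamma> u * (\<Sum>x\<in>#P. \<Sum>y\<in>#P. \<Prod>j\<in>u. g (x j) (y j))) / (real (size P))\<^sup>2"
proof -
  obtain C where "\<And>x y. x \<in> cube s \<Longrightarrow> y \<in> cube s \<Longrightarrow> \<bar>product_kernel \<gamma> s g x y\<bar> \<le> C"
    using product_kernel_bounded by blast
  note * = worst_case_error_cube[OF psd_product_kernel[OF \<gamma>] seq_continuous_product_kernel this
      integral_product_kernel P]
  have sw: "(\<Sum>x\<in>#P. \<Sum>u\<in>U. f u x) = (\<Sum>u\<in>U. \<Sum>x\<in>#P. f u x)" if "finite U" for U and f :: "nat set \<Rightarrow> _ \<Rightarrow> real"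
    using that by (induction P) (auto simp: sum.distrib)
  have c: "(\<Sum>x\<in>#P. (1::real)) = real (size P)" for P :: "(nat \<Rightarrow> real) multiset"
    by (induction P) auto
  have "(\<Sum>x\<in>#P. \<Sum>y\<in>#P. product_kernel \<gamma> s g x y)
      = (real (size P))\<^sup>2 + (\<Sum>u\<in>Pow {1..s} - {{}}. \<gamma> u * (\<Sum>x\<in>#P. \<Sum>y\<in>#P. \<Prod>j\<in>u. g (x j) (y j)))"
    by (simp add: product_kernel_def sum_mset.distrib sw sum_mset_distrib_left c power2_eq_square
        flip: sum_mset_distrib_left)
  then show ?thesis using * P(1) by (simp add: add_divide_distrib)
qed

end

section \<open>The Sobolev and Korobov factors as instances\<close>

lemma integral_unit_FTC:
  fixes f F :: "real \<Rightarrow> real"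
  assumes "\<And>x. (F has_real_derivative f x) (at x)" "continuous_on UNIV f"
  shows "(\<integral>x. f x \<partial>unit_measure) = F 1 - F 0"
proof -
  have "(\<integral>x. indicator {0..1} x *\<^sub>R f x \<partial>lborel) = F 1 - F 0"
  proof (rule integral_FTC_Icc)
    show "(F has_vector_derivative f x) (at x within {0..1})" for x
      using assms(1)[of x] has_field_derivative_at_within has_real_derivative_iff_has_vector_derivative by blast
  qed (use assms(2) continuous_on_subset in auto)
  then show ?thesis by (simp add: integral_restrict_space)
qed

definition sob_factor :: "real \<Rightarrow> real \<Rightarrow> real" where
  "sob_factor x y = bernoulli_poly 1 x * bernoulli_poly 1 y
     + bernoulli_poly 2 x * bernoulli_poly 2 y / 4 - bernoulli_poly 4 \<bar>x - y\<bar> / 24"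

definition kor_factor :: "real \<Rightarrow> real \<Rightarrow> real" where
  "kor_factor x y = 2 * clausen_cos 2 (x - y)"

lemma cos_series_minus: "cos_series a (- t) = cos_series a t"
  by (simp add: cos_series_def)

lemma cos_series_abs: "cos_series a \<bar>t\<bar> = cos_series a t"
  using cos_series_minus[of a t] by (simp add: abs_if)

lemma summable_abs_inv_power: "2 \<le> p \<Longrightarrow> summable (\<lambda>n. \<bar>1 / real (Suc n) ^ p\<bar>)"
  using summable_inv_power by simp

lemma continuous_cos_series:
  assumes "summable (\<lambda>n. \<bar>a n\<bar>)" shows "continuous_on UNIV (cos_series a)"
proof -
  have ul: "uniform_limit UNIV (\<lambda>n t. \<Sum>i<n. a i * cos (2 * pi * real (Suc i) * t)) (cos_series a) sequentially"
    unfolding cos_series_def[abs_def]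
    by (rule Weierstrass_m_test[OF _ assms]) (simp add: abs_mult mult_left_le)
  show ?thesis
    by (rule uniform_limit_theorem[OF always_eventually ul]) (auto intro!: continuous_intros)
qed

text \<open>With t |t| as a differentiable building block, antiderivatives of odd powers of |x - y|
  are global, and the integral need not be split at y = x.\<close>

lemma has_derivative_times_abs: "((\<lambda>t. t * \<bar>t\<bar>) has_real_derivative 2 * \<bar>t\<bar>) (at (t::real))"
proof (cases t "0::real" rule: linorder_cases)
  case less
  have "((\<lambda>t. - t * t) has_real_derivative 2 * \<bar>t\<bar>) (at t)"
    using less by (auto intro!: derivative_eq_intros)
  then show ?thesis
    by (rule has_field_derivative_transform_within_open[where S = "{..<0}"]) (use less in auto)
next
  case equal
  have "(\<lambda>h::real. (h * \<bar>h\<bar> - 0) / h) \<midarrow>0\<rightarrow> 0"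
  proof (rule Lim_transform_eventually)
    show "(\<lambda>h::real. \<bar>h\<bar>) \<midarrow>0\<rightarrow> 0" using tendsto_rabs_zero[OF tendsto_ident_at] by blast
    show "\<forall>\<^sub>F h in at (0::real). \<bar>h\<bar> = (h * \<bar>h\<bar> - 0) / h" unfolding eventually_at_filter by (intro always_eventually allI impI) simp
  qed
  then show ?thesis using equal by (simp add: DERIV_def)
next
  case greater
  have "((\<lambda>t. t * t) has_real_derivative 2 * \<bar>t\<bar>) (at t)"
    using greater by (auto intro!: derivative_eq_intros)
  then show ?thesis
    by (rule has_field_derivative_transform_within_open[where S = "{0<..}"]) (use greater in auto)
qed

lemma integral_B4:
  assumes x: "x \<in> {0..1}"
  shows "(\<integral>y. bernoulli_poly 4 \<bar>x - y\<bar> \<partial>unit_measure) = 0"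
proof -
  \<comment> \<open>The antiderivative of 2 |t|^3 is (t |t|) t^2 / 2 with t = x - y; the outer sign
    comes from the inner derivative -1.\<close>
  define F where "F y = - ((x - y) ^ 5 / 5 - ((x - y) * \<bar>x - y\<bar>) * (x - y)\<^sup>2 / 2 + (x - y) ^ 3 / 3 - (x - y) / 30)" for y
  have "(F has_real_derivative bernoulli_poly 4 \<bar>x - y\<bar>) (at y)" for y
  proof -
    define q :: "real \<Rightarrow> real" where "q t = t * \<bar>t\<bar>" for t
    have dq: "(q has_real_derivative 2 * \<bar>t\<bar>) (at t)" for t
      using has_derivative_times_abs unfolding q_def[abs_def] .
    have "((\<lambda>t. t ^ 5 / 5 - q t * t\<^sup>2 / 2 + t ^ 3 / 3 - t / 30) has_real_derivative
        t ^ 4 - (2 * \<bar>t\<bar> * t\<^sup>2 + (2 * t) * q t) / 2 + t\<^sup>2 - 1 / 30) (at t)" for t :: real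
      by (auto intro!: derivative_eq_intros dq)
    moreover have "((\<lambda>y. x - y) has_real_derivative -1) (at y)" by (auto intro!: derivative_eq_intros)
    ultimately
    have "((\<lambda>y. (x - y) ^ 5 / 5 - q (x - y) * (x - y)\<^sup>2 / 2 + (x - y) ^ 3 / 3 - (x - y) / 30)
        has_real_derivative ((x - y) ^ 4 - (2 * \<bar>x - y\<bar> * (x - y)\<^sup>2 + (2 * (x - y)) * q (x - y)) / 2
          + (x - y)\<^sup>2 - 1 / 30) * (-1)) (at y)"
      by (rule DERIV_chain2)
    from DERIV_minus[OF this, unfolded q_def] have "(F has_real_derivative ((x - y) ^ 4 - (2 * \<bar>x - y\<bar> * (x - y)\<^sup>2
          + (2 * (x - y)) * ((x - y) * \<bar>x - y\<bar>)) / 2 + (x - y)\<^sup>2 - 1 / 30)) (at y)"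
      unfolding F_def by simp
    moreover have "bernoulli_poly 4 \<bar>t\<bar> = t ^ 4 - (2 * \<bar>t\<bar> * t\<^sup>2 + (2 * t) * (t * \<bar>t\<bar>)) / 2 + t\<^sup>2 - 1 / 30" for t
      unfolding bernoulli_poly_4 by (simp add: abs_if eval_nat_numeral)
    ultimately show ?thesis by simp
  qed
  moreover have "continuous_on UNIV (\<lambda>y. bernoulli_poly 4 \<bar>x - y\<bar>)"
    unfolding bernoulli_poly_4 by (intro continuous_intros)
  ultimately have "(\<integral>y. bernoulli_poly 4 \<bar>x - y\<bar> \<partial>unit_measure) = F 1 - F 0"
    by (rule integral_unit_FTC)
  also have "\<dots> = 0" using x by (simp add: F_def eval_nat_numeral) (simp add: field_simps)
  finally show ?thesis .
qed

lemma integral_B2_abs: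
  fixes x :: real
  assumes x: "x \<in> {0..1}"
  shows "(\<integral>y. (x - y)\<^sup>2 - \<bar>x - y\<bar> + 1/6 \<partial>unit_measure) = 0"
proof -
  define F :: "real \<Rightarrow> real" where "F y = - ((x - y) ^ 3 / 3 - ((x - y) * \<bar>x - y\<bar>) / 2 + (x - y) / 6)" for y
  have "(F has_real_derivative (x - y)\<^sup>2 - \<bar>x - y\<bar> + 1/6) (at y)" for y
  proof -
    define q :: "real \<Rightarrow> real" where "q t = t * \<bar>t\<bar>" for t
    have dq: "(q has_real_derivative 2 * \<bar>t\<bar>) (at t)" for t
      using has_derivative_times_abs unfolding q_def[abs_def] .
    have "((\<lambda>t. t ^ 3 / 3 - q t / 2 + t / 6) has_real_derivative t\<^sup>2 - \<bar>t\<bar> + 1/6) (at t)" for t :: real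
      by (auto intro!: derivative_eq_intros dq)
    moreover have "((\<lambda>y. x - y) has_real_derivative -1) (at y)" by (auto intro!: derivative_eq_intros)
    ultimately
    have "((\<lambda>y. (x - y) ^ 3 / 3 - q (x - y) / 2 + (x - y) / 6)
        has_real_derivative ((x - y)\<^sup>2 - \<bar>x - y\<bar> + 1/6) * (-1)) (at y)"
      by (rule DERIV_chain2)
    from DERIV_minus[OF this, unfolded q_def] show ?thesis
      unfolding F_def[abs_def] by (rule DERIV_cong) simp
  qed
  moreover have "continuous_on UNIV (\<lambda>y. (x - y)\<^sup>2 - \<bar>x - y\<bar> + 1/6)"
    by (intro continuous_intros)
  ultimately have "(\<integral>y. (x - y)\<^sup>2 - \<bar>x - y\<bar> + 1/6 \<partial>unit_measure) = F 1 - F 0"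
    by (rule integral_unit_FTC)
  also have "\<dots> = 0" using x by (simp add: F_def eval_nat_numeral) (simp add: field_simps)
  finally show ?thesis .
qed

lemma kor_factor_abs: "\<bar>x - y\<bar> \<le> 1 \<Longrightarrow> kor_factor x y = 2 * pi\<^sup>2 * ((x - y)\<^sup>2 - \<bar>x - y\<bar> + 1/6)"
  unfolding kor_factor_def
  by (subst cos_series_abs[symmetric]) (simp add: cos_series_2 del: of_nat_Suc)

interpretation kor: kernel_factor kor_factor
proof
  show "kor_factor x y = kor_factor y x" for x y
    using cos_series_minus[of _ "x - y"] by (simp add: kor_factor_def)
  have "continuous_on UNIV (\<lambda>p. 2 * clausen_cos 2 (fst p - snd p))"
    by (intro continuous_intros continuous_on_compose2[OF continuous_cos_series[OF summable_abs_inv_power]]) auto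
  then show "continuous_on UNIV (\<lambda>(x, y). kor_factor x y)" by (simp add: kor_factor_def case_prod_beta)
  fix x :: real assume x: "x \<in> {0..1}"
  have "(\<integral>y. kor_factor x y \<partial>unit_measure)
      = (\<integral>y. 2 * pi\<^sup>2 * ((x - y)\<^sup>2 - \<bar>x - y\<bar> + 1/6) \<partial>unit_measure)"
    by (rule Bochner_Integration.integral_cong[OF refl])
       (use x in \<open>auto simp: space_restrict_space intro!: kor_factor_abs\<close>)
  also have "\<dots> = 0" using integral_B2_abs[OF x] by simp
  finally show "(\<integral>y. kor_factor x y \<partial>unit_measure) = 0" .
next
  fix j s :: nat
  have "(\<lambda>p. 2 * (case p of (x, y) \<Rightarrow> clausen_cos 2 (x j - y j)))
      \<in> multipliers (squares (cube s))"
    by (intro multiplier_scale cos_series_multiplier summable_abs_inv_power) auto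
  then show "(\<lambda>(x, y). kor_factor (x j) (y j)) \<in> multipliers (squares (cube s))"
    by (simp add: kor_factor_def case_prod_unfold)
qed

text \<open>The functionals have all their nodes in \<open>D\<close>. This matters because the
  Bernoulli polynomial agrees with its cosine series only for differences of modulus at most
  1.\<close>

lemma multiplier_cong_squares:
  assumes "M \<in> multipliers (squares D)" "\<And>x y. x \<in> D \<Longrightarrow> y \<in> D \<Longrightarrow> M (x, y) = M' (x, y)"
  shows "M' \<in> multipliers (squares D)"
  unfolding multipliers_def
proof (intro CollectI ballI)
  fix W assume W: "W \<in> dual_cone (squares D)"
  show "(\<lambda>p. M' p * W p) \<in> dual_cone (squares D)" unfolding cone_squares_iff
  proof
    fix l assume l: "l \<in> combs D"
    have "lin l (\<lambda>x. lin l (\<lambda>y. M' (x, y) * W (x, y))) = lin l (\<lambda>x. lin l (\<lambda>y. M (x, y) * W (x, y)))"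
      by (intro lin_cong[OF l]) (simp add: assms(2))
    then show "0 \<le> lin l (\<lambda>x. lin l (\<lambda>y. M' (x, y) * W (x, y)))"
      using multiplier_cone[OF assms(1) W] l by (simp add: cone_squares_iff)
  qed
qed

interpretation sob: kernel_factor sob_factor
proof
  show "sob_factor x y = sob_factor y x" for x y
    by (simp add: sob_factor_def abs_minus_commute mult.commute)
  show "continuous_on UNIV (\<lambda>(x, y). sob_factor x y)"
    unfolding sob_factor_def bernoulli_poly_1 bernoulli_poly_2 bernoulli_poly_4 case_prod_beta
    by (intro continuous_intros) auto
  fix x :: real assume x: "x \<in> {0..1}"
  have i1: "integrable unit_measure (bernoulli_poly 1)"
    unfolding bernoulli_poly_1[abs_def] by (intro integrable_unit continuous_intros)
  have i2: "integrable unit_measure (bernoulli_poly 2)"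
    unfolding bernoulli_poly_2[abs_def] by (intro integrable_unit continuous_intros)
  have i4: "integrable unit_measure (\<lambda>y. bernoulli_poly 4 \<bar>x - y\<bar>)"
    unfolding bernoulli_poly_4[abs_def] by (intro integrable_unit continuous_intros)
  have b1: "(\<integral>y. bernoulli_poly 1 y \<partial>unit_measure) = 0"
    unfolding bernoulli_poly_1 by (subst integral_unit_FTC[where F = "\<lambda>y. y\<^sup>2 / 2 - y / 2"]) (auto intro!: derivative_eq_intros continuous_intros)
  have b2: "(\<integral>y. bernoulli_poly 2 y \<partial>unit_measure) = 0"
    unfolding bernoulli_poly_2 by (subst integral_unit_FTC[where F = "\<lambda>y. y ^ 3 / 3 - y\<^sup>2 / 2 + y / 6"]) (auto intro!: derivative_eq_intros continuous_intros)
  show "(\<integral>y. sob_factor x y \<partial>unit_measure) = 0"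
    unfolding sob_factor_def using i1 i2 i4 b1 b2 integral_B4[OF x] by simp
next
  fix j s :: nat assume j: "j \<in> {1..s}"
  \<comment> \<open>The cosine series with exponent 4 equals -(pi^4 / 3) B_4, so -B_4 / 24 is that
    series divided by 8 pi^4.\<close>
  have "(\<lambda>p. (case p of (x, y) \<Rightarrow> bernoulli_poly 1 (x j) * bernoulli_poly 1 (y j))
      + 1/4 * (case p of (x, y) \<Rightarrow> bernoulli_poly 2 (x j) * bernoulli_poly 2 (y j))
      + 1 / (8 * pi ^ 4) * (case p of (x, y) \<Rightarrow> clausen_cos 4 (x j - y j)))
      \<in> multipliers (squares (cube s))"
    by (intro multiplier_add multiplier_scale rank_one_multiplier cos_series_multiplier summable_abs_inv_power)
       auto
  then show "(\<lambda>(x, y). sob_factor (x j) (y j)) \<in> multipliers (squares (cube s))"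
  proof (rule multiplier_cong_squares)
    fix x y assume "x \<in> cube s" "y \<in> cube s"
    then have "x j \<in> {0..1}" "y j \<in> {0..1}" using j by (auto simp: cube_def PiE_iff)
    then have "\<bar>x j - y j\<bar> \<le> 1" by auto
    then have "clausen_cos 4 (x j - y j) = - (pi ^ 4 / 3) * bernoulli_poly 4 \<bar>x j - y j\<bar>"
      by (subst cos_series_abs[symmetric]) (simp only: cos_series_4 abs_ge_zero bernoulli_poly_4)
    then show "(case (x, y) of (x, y) \<Rightarrow> bernoulli_poly 1 (x j) * bernoulli_poly 1 (y j))
      + 1/4 * (case (x, y) of (x, y) \<Rightarrow> bernoulli_poly 2 (x j) * bernoulli_poly 2 (y j))
      + 1 / (8 * pi ^ 4) * (case (x, y) of (x, y) \<Rightarrow> clausen_cos 4 (x j - y j))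
      = (case (x, y) of (x, y) \<Rightarrow> sob_factor (x j) (y j))"
      by (simp add: sob_factor_def)
  qed
qed

lemma sob_kernel_product: "sob_kernel \<gamma> s = product_kernel \<gamma> s sob_factor"
  by (intro ext) (simp add: sob_kernel_def product_kernel_def sob_factor_def)

lemma has_sum_nonzero_int:
  fixes f :: "int \<Rightarrow> 'a :: {topological_comm_monoid_add, t3_space}"
  assumes "((\<lambda>n. f (int (Suc n))) has_sum a) UNIV" "((\<lambda>n. f (- int (Suc n))) has_sum b) UNIV"
  shows "(f has_sum (a + b)) (UNIV - {0})"
proof -
  have "UNIV - {0} = range (\<lambda>n. int (Suc n)) \<union> range (\<lambda>n. - int (Suc n))"
  proof (intro set_eqI iffI)
    fix h :: int assume "h \<in> UNIV - {0}"
    then have "h = int (Suc (nat (h - 1))) \<or> h = - int (Suc (nat (- h - 1)))"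
      by (cases "0 < h") auto
    then show "h \<in> range (\<lambda>n. int (Suc n)) \<union> range (\<lambda>n. - int (Suc n))" by blast
  qed auto
  moreover have "(f has_sum a) (range (\<lambda>n. int (Suc n)))"
    by (subst has_sum_reindex) (use assms in \<open>auto simp: inj_on_def o_def\<close>)
  moreover have "(f has_sum b) (range (\<lambda>n. - int (Suc n)))"
    by (subst has_sum_reindex) (use assms in \<open>auto simp: inj_on_def o_def\<close>)
  ultimately show ?thesis by (simp only:) (intro has_sum_Un_disjoint; auto)
qed

text \<open>The terms for h and -h are conjugate, so the two half-series add up to twice the real
  part of one of them.\<close>

lemma kor_factor_has_sum:
  "((\<lambda>h::int. exp (2 * of_real pi * \<i> * of_int h * of_real (x - y)) / of_real (\<bar>real_of_int h\<bar> powr 2))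
    has_sum of_real (kor_factor x y)) (UNIV - {0})"
proof -
  let ?f = "\<lambda>h::int. exp (2 * of_real pi * \<i> * of_int h * of_real (x - y)) / of_real (\<bar>real_of_int h\<bar> powr 2) :: complex"
  define c where "c n = cis (2 * pi * real (Suc n) * (x - y)) / of_real (real (Suc n) ^ 2)" for n
  have f1: "?f (int (Suc n)) = c n" for n
    by (simp add: c_def cis_conv_exp powr_numeral mult_ac del: of_nat_Suc)
  have f2: "?f (- int (Suc n)) = cnj (c n)" for n
    by (simp add: c_def exp_cnj cis_conv_exp powr_numeral mult_ac del: of_nat_Suc)
  have sn: "summable (\<lambda>n. norm (c n))"
    using summable_inv_power[of 2] by (simp add: c_def norm_divide norm_power del: of_nat_Suc)
  have s: "c sums suminf c" using summable_norm_cancel[OF sn] by (rule summable_sums)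
  have h1: "(c has_sum suminf c) UNIV" by (rule norm_summable_imp_has_sum[OF sn s])
  have h2: "((\<lambda>n. cnj (c n)) has_sum cnj (suminf c)) UNIV"
    by (rule norm_summable_imp_has_sum) (use sn s in \<open>simp_all add: sums_cnj\<close>)
  have "Re (suminf c) = (\<Sum>n. Re (c n))" using sums_Re[OF s] by (simp add: sums_iff)
  also have "\<dots> = clausen_cos 2 (x - y)"
    unfolding cos_series_def c_def by (intro suminf_cong) (simp add: Re_divide_of_real del: of_nat_Suc)
  finally have "suminf c + cnj (suminf c) = of_real (kor_factor x y)"
    by (simp add: kor_factor_def complex_add_cnj)
  then show ?thesis using has_sum_nonzero_int[of ?f "suminf c" "cnj (suminf c)"] h1 h2 f1 f2 by simp
qed

lemma kor_kernel_product: "kor_kernel 1 \<eta> s = product_kernel \<eta> s kor_factor"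
proof (intro ext)
  fix x y :: "nat \<Rightarrow> real"
  have "kor_kernel 1 \<eta> s x y = Re (of_real (product_kernel \<eta> s kor_factor x y))"
    unfolding kor_kernel_def product_kernel_def using kor_factor_has_sum[THEN infsumI]
    by (simp del: Re_complex_of_real)
  then show "kor_kernel 1 \<eta> s x y = product_kernel \<eta> s kor_factor x y" by simp
qed

section \<open>Cosine coefficients of the tent-transformed Sobolev kernel\<close>

lemma cos_series_sums:
  "2 \<le> p \<Longrightarrow> (\<lambda>k. cos (2 * pi * real (Suc k) * t) / real (Suc k) ^ p) sums clausen_cos p t"
  using summable_sums[OF summable_trig(1)[OF summable_abs_inv_power], of p t]
  by (simp add: cos_series_def del: of_nat_Suc)

text \<open>Odd indices carry the even frequencies 2(k + 1); the factor 2 cancels the halved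
  argument and leaves 2^p in the denominator.\<close>

lemma even_cos_series_sums:
  assumes "2 \<le> p"
  shows "(\<lambda>k. of_bool (odd k) * (cos (2 * pi * real (Suc k) * (X / 2)) / real (Suc k) ^ p))
    sums (clausen_cos p X / 2 ^ p)"
proof (subst sums_mono_reindex[of "\<lambda>k. 2 * k + 1", symmetric])
  show "strict_mono (\<lambda>k::nat. 2 * k + 1)" by (auto simp: strict_mono_def)
  show "of_bool (odd k) * (cos (2 * pi * real (Suc k) * (X / 2)) / real (Suc k) ^ p) = 0"
    if "k \<notin> range (\<lambda>k. 2 * k + 1)" for k
    using that by (metis (no_types, lifting) oddE rangeI mult_eq_0_iff of_bool_eq_0_iff)
  have "of_bool (odd (2 * k + 1)) * (cos (2 * pi * real (Suc (2 * k + 1)) * (X / 2)) / real (Suc (2 * k + 1)) ^ p)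
      = cos (2 * pi * real (Suc k) * X) / real (Suc k) ^ p / 2 ^ p" for k
  proof -
    have m: "real (Suc (2 * k + 1)) = 2 * real (Suc k)" by simp
    have "2 * pi * (2 * real (Suc k)) * (X / 2) = 2 * pi * real (Suc k) * X" by simp
    then show ?thesis unfolding m by (simp only: power_mult_distrib) simp
  qed
  then show "(\<lambda>k. of_bool (odd (2 * k + 1)) * (cos (2 * pi * real (Suc (2 * k + 1)) * (X / 2)) / real (Suc (2 * k + 1)) ^ p))
      sums (clausen_cos p X / 2 ^ p)"
    by (simp only:) (intro sums_divide cos_series_sums assms)
qed

lemma odd_cos_series_sums:
  assumes "2 \<le> p"
  shows "(\<lambda>k. of_bool (even k) * (cos (2 * pi * real (Suc k) * (X / 2)) / real (Suc k) ^ p))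
    sums (clausen_cos p (X / 2) - clausen_cos p X / 2 ^ p)"
proof -
  have "of_bool (even k) * y = y - of_bool (odd k) * y" for k :: nat and y :: real by simp
  then show ?thesis
    by (simp only:) (intro sums_diff cos_series_sums even_cos_series_sums assms)
qed

text \<open>\<open>tent_coeff k l\<close> divided by \<open>((k + 1) (l + 1))\<^sup>2\<close> is the coefficient of
  \<open>cos ((k + 1) \<pi> X) cos ((l + 1) \<pi> Y)\<close> in \<open>\<pi>\<^sup>4\<close> times the Sobolev factor; as frequencies are shifted
  by one, \<open>even k\<close> selects the odd frequencies.\<close>

definition tent_coeff :: "nat \<Rightarrow> nat \<Rightarrow> real" where
  "tent_coeff k l = 52/3 * (of_bool (even k) * of_bool (even l))
     - 16 / pi\<^sup>2 * (of_bool (even k) / real (Suc k) ^ 2 * of_bool (even l)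
                + of_bool (even k) * (of_bool (even l) / real (Suc l) ^ 2))
     + 4 * (of_bool (odd k) * of_bool (odd l)) + 2 * of_bool (k = l)"

text \<open>Of 52/3, the part 16 comes from B_1 B_1, since pi^2 B_1 is -4 times the odd cosine
  series; the 4 comes from B_2 B_2 / 4, and the rest from the B_4 term. Since pi > 3, the negative
  part is at most 4, hence positivity; the upper bound 58/3 = 52/3 + 2 belongs to the odd
  diagonal.\<close>

lemma tent_coeff_bounds: "0 \<le> tent_coeff k l" "tent_coeff k l \<le> 58/3"
proof -
  define q where "q = 16 / pi\<^sup>2"
  have "3\<^sup>2 \<le> pi\<^sup>2" using pi_gt3 by (intro power_mono) auto
  then have q: "0 \<le> q" "q \<le> 2" by (auto simp: q_def field_simps)
  define a where "a i = 1 / real (Suc i) ^ 2" for i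
  have a: "0 \<le> a i" "a i \<le> 1" for i by (auto simp: a_def divide_le_eq_1)
  have b: "0 \<le> q * (a k + a l)" using q a by simp
  have b': "q * (a k + a l) \<le> 2 * 2"
    by (rule mult_mono) (use q a[of k] a[of l] in linarith)+
  have "tent_coeff k l = 52/3 * (of_bool (even k) * of_bool (even l))
     - q * (of_bool (even k) * of_bool (even l)) * (a k + a l)
     + 4 * (of_bool (odd k) * of_bool (odd l)) + 2 * of_bool (k = l)"
    unfolding tent_coeff_def q_def[symmetric] a_def by (simp add: algebra_simps)
  then show "0 \<le> tent_coeff k l" "tent_coeff k l \<le> 58/3"
    using b b' by (cases "even k"; cases "even l"; cases "k = l"; simp; fail)+
qed

text \<open>Apart from the diagonal, the coefficients are sums of products of a function of
  \<open>k\<close> and one of \<open>l\<close>, so square partial sums reduce to one-dimensional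
  ones, whose limits are known.\<close>

lemma tent_coeff_sum:
  fixes x y :: "nat \<Rightarrow> real"
  shows "(\<Sum>k<K. \<Sum>l<K. tent_coeff k l * (x k * y l)) =
     52/3 * ((\<Sum>k<K. of_bool (even k) * x k) * (\<Sum>l<K. of_bool (even l) * y l))
     - 16 / pi\<^sup>2 * ((\<Sum>k<K. of_bool (even k) * (x k / real (Suc k) ^ 2)) * (\<Sum>l<K. of_bool (even l) * y l)
        + (\<Sum>k<K. of_bool (even k) * x k) * (\<Sum>l<K. of_bool (even l) * (y l / real (Suc l) ^ 2)))
     + 4 * ((\<Sum>k<K. of_bool (odd k) * x k) * (\<Sum>l<K. of_bool (odd l) * y l))
     + 2 * (\<Sum>k<K. x k * y k)"
proof -
  have "(\<Sum>k<K. x k * y k) = (\<Sum>k<K. \<Sum>l<K. of_bool (k = l) * (x k * y l))"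
  proof (rule sum.cong[OF refl])
    fix k assume "k \<in> {..<K}"
    then have "(\<Sum>l<K. if k = l then x k * y l else 0) = x k * y k" by simp
    moreover have "of_bool (k = l) * (x k * y l) = (if k = l then x k * y l else 0)" for l by simp
    ultimately show "x k * y k = (\<Sum>l<K. of_bool (k = l) * (x k * y l))" by (simp only:)
  qed
  then have diag: "(\<Sum>k<K. \<Sum>l<K. of_bool (k = l) * (x k * y l)) = (\<Sum>k<K. x k * y k)" by simp
  define ox oy ex ey wx wy where "ox = (\<lambda>k. of_bool (even k) * x k)" and "oy = (\<lambda>k. of_bool (even k) * y k)"
    and "ex = (\<lambda>k. of_bool (odd k) * x k)" and "ey = (\<lambda>k. of_bool (odd k) * y k)"
    and "wx = (\<lambda>k. of_bool (even k) * (x k / real (Suc k) ^ 2))"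
    and "wy = (\<lambda>k. of_bool (even k) * (y k / real (Suc k) ^ 2))"
  have "(\<Sum>k<K. \<Sum>l<K. tent_coeff k l * (x k * y l)) =
    (\<Sum>k<K. \<Sum>l<K. 52/3 * (ox k * oy l) - 16 / pi\<^sup>2 * (wx k * oy l + ox k * wy l)
      + 4 * (ex k * ey l) + 2 * (of_bool (k = l) * (x k * y l)))"
    by (intro sum.cong refl)
       (simp add: tent_coeff_def ox_def oy_def ex_def ey_def wx_def wy_def algebra_simps del: of_nat_Suc)
  also have "\<dots> = 52/3 * (sum ox {..<K} * sum oy {..<K})
     - 16 / pi\<^sup>2 * (sum wx {..<K} * sum oy {..<K} + sum ox {..<K} * sum wy {..<K})
     + 4 * (sum ex {..<K} * sum ey {..<K}) + 2 * (\<Sum>k<K. \<Sum>l<K. of_bool (k = l) * (x k * y l))"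
    by (simp only: sum.distrib sum_subtractf sum_distrib_left[symmetric] sum_distrib_right[symmetric])
  finally show ?thesis by (simp only: diag ox_def oy_def ex_def ey_def wx_def wy_def)
qed

text \<open>Every one-dimensional series involved is a known polynomial on [0,1]; once the limits
  are inserted, the claim is a polynomial identity in X, Y and |X - Y|.\<close>

lemma sob_factor_cosine_expansion:
  assumes X: "X \<in> {0..1}" and Y: "Y \<in> {0..1}"
  shows "(\<lambda>K. \<Sum>k<K. \<Sum>l<K. tent_coeff k l *
      (cos (2 * pi * real (Suc k) * (X / 2)) / real (Suc k) ^ 2 *
       (cos (2 * pi * real (Suc l) * (Y / 2)) / real (Suc l) ^ 2))) \<longlonglongrightarrow> pi ^ 4 * sob_factor X Y"
proof -
  let ?x = "\<lambda>k. cos (2 * pi * real (Suc k) * (X / 2)) / real (Suc k) ^ 2"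
  let ?y = "\<lambda>k. cos (2 * pi * real (Suc k) * (Y / 2)) / real (Suc k) ^ 2"
  let ?B2 = "\<lambda>t. pi\<^sup>2 * (t\<^sup>2 - t + 1/6)"
  let ?B4 = "\<lambda>t. - (pi ^ 4 / 3) * (t ^ 4 - 2 * t ^ 3 + t\<^sup>2 - 1/30)"
  have ev: "(\<lambda>K. \<Sum>k<K. of_bool (odd k) * (cos (2 * pi * real (Suc k) * (t / 2)) / real (Suc k) ^ 2)) \<longlonglongrightarrow> ?B2 t / 4"
    and od: "(\<lambda>K. \<Sum>k<K. of_bool (even k) * (cos (2 * pi * real (Suc k) * (t / 2)) / real (Suc k) ^ 2))
      \<longlonglongrightarrow> ?B2 (t / 2) - ?B2 t / 4"
    and od4: "(\<lambda>K. \<Sum>k<K. of_bool (even k) * (cos (2 * pi * real (Suc k) * (t / 2)) / real (Suc k) ^ 2 / real (Suc k) ^ 2))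
      \<longlonglongrightarrow> ?B4 (t / 2) - ?B4 t / 16" if t: "t \<in> {0..1}" for t
  proof -
    have 2: "clausen_cos 2 t = ?B2 t" "clausen_cos 2 (t / 2) = ?B2 (t / 2)"
      using t by (intro cos_series_2; simp)+
    have 4: "clausen_cos 4 t = ?B4 t" "clausen_cos 4 (t / 2) = ?B4 (t / 2)"
      using t by (intro cos_series_4; simp)+
    have p4: "c / real (Suc k) ^ 2 / real (Suc k) ^ 2 = c / real (Suc k) ^ 4" for c k
      by (simp flip: power_add del: of_nat_Suc)
    show "(\<lambda>K. \<Sum>k<K. of_bool (odd k) * (cos (2 * pi * real (Suc k) * (t / 2)) / real (Suc k) ^ 2)) \<longlonglongrightarrow> ?B2 t / 4"
      using even_cos_series_sums[of 2 t] unfolding sums_def 2 by (simp del: of_nat_Suc)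
    show "(\<lambda>K. \<Sum>k<K. of_bool (even k) * (cos (2 * pi * real (Suc k) * (t / 2)) / real (Suc k) ^ 2))
      \<longlonglongrightarrow> ?B2 (t / 2) - ?B2 t / 4"
      using odd_cos_series_sums[of 2 t] unfolding sums_def 2 by (simp del: of_nat_Suc)
    show "(\<lambda>K. \<Sum>k<K. of_bool (even k) * (cos (2 * pi * real (Suc k) * (t / 2)) / real (Suc k) ^ 2 / real (Suc k) ^ 2))
      \<longlonglongrightarrow> ?B4 (t / 2) - ?B4 t / 16"
      using odd_cos_series_sums[of 4 t] unfolding sums_def 4 p4 by (simp del: of_nat_Suc)
  qed
  \<comment> \<open>The product of cosines splits into those of (X - Y)/2 and (X + Y)/2. The first
    may be negative, hence the absolute value; the second stays in [0,1].\<close>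
  have diag: "(\<lambda>K. \<Sum>k<K. ?x k * ?y k) \<longlonglongrightarrow> (?B4 (\<bar>X - Y\<bar> / 2) + ?B4 ((X + Y) / 2)) / 2"
  proof -
    have "?x k * ?y k = (cos (2 * pi * real (Suc k) * ((X - Y) / 2)) / real (Suc k) ^ 4
        + cos (2 * pi * real (Suc k) * ((X + Y) / 2)) / real (Suc k) ^ 4) / 2" for k
    proof -
      have "2 * pi * real (Suc k) * ((X - Y) / 2) = 2 * pi * real (Suc k) * (X / 2) - 2 * pi * real (Suc k) * (Y / 2)"
        "2 * pi * real (Suc k) * ((X + Y) / 2) = 2 * pi * real (Suc k) * (X / 2) + 2 * pi * real (Suc k) * (Y / 2)"
        by (simp_all add: field_simps)
      then show ?thesis
        by (simp only: cos_add cos_diff) (simp add: field_simps flip: power_add del: of_nat_Suc)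
    qed
    moreover have "(\<lambda>k. (cos (2 * pi * real (Suc k) * ((X - Y) / 2)) / real (Suc k) ^ 4
        + cos (2 * pi * real (Suc k) * ((X + Y) / 2)) / real (Suc k) ^ 4) / 2)
      sums ((clausen_cos 4 ((X - Y) / 2) + clausen_cos 4 ((X + Y) / 2)) / 2)"
      by (intro sums_divide sums_add cos_series_sums) auto
    moreover have "clausen_cos 4 ((X - Y) / 2) = ?B4 (\<bar>X - Y\<bar> / 2)"
    proof -
      have "clausen_cos 4 \<bar>(X - Y) / 2\<bar> = ?B4 \<bar>(X - Y) / 2\<bar>"
        using X Y by (intro cos_series_4) auto
      then show ?thesis unfolding cos_series_abs by (simp only: abs_divide abs_numeral)
    qed
    moreover have "clausen_cos 4 ((X + Y) / 2) = ?B4 ((X + Y) / 2)"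
      using X Y by (intro cos_series_4) auto
    ultimately show ?thesis by (simp only: sums_def)
  qed
  have "(\<lambda>K. \<Sum>k<K. \<Sum>l<K. tent_coeff k l * (?x k * ?y l)) \<longlonglongrightarrow>
     52/3 * ((?B2 (X / 2) - ?B2 X / 4) * (?B2 (Y / 2) - ?B2 Y / 4))
     - 16 / pi\<^sup>2 * ((?B4 (X / 2) - ?B4 X / 16) * (?B2 (Y / 2) - ?B2 Y / 4)
        + (?B2 (X / 2) - ?B2 X / 4) * (?B4 (Y / 2) - ?B4 Y / 16))
     + 4 * ((?B2 X / 4) * (?B2 Y / 4)) + 2 * ((?B4 (\<bar>X - Y\<bar> / 2) + ?B4 ((X + Y) / 2)) / 2)"
    unfolding tent_coeff_sum
    by (intro tendsto_add tendsto_diff tendsto_mult tendsto_const ev od od4 diag X Y)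
  also have "52/3 * ((?B2 (X / 2) - ?B2 X / 4) * (?B2 (Y / 2) - ?B2 Y / 4))
     - 16 / pi\<^sup>2 * ((?B4 (X / 2) - ?B4 X / 16) * (?B2 (Y / 2) - ?B2 Y / 4)
        + (?B2 (X / 2) - ?B2 X / 4) * (?B4 (Y / 2) - ?B4 Y / 16))
     + 4 * ((?B2 X / 4) * (?B2 Y / 4)) + 2 * ((?B4 (\<bar>X - Y\<bar> / 2) + ?B4 ((X + Y) / 2)) / 2)
     = pi ^ 4 * sob_factor X Y"
  proof -
    have o2: "?B2 (t / 2) - ?B2 t / 4 = pi\<^sup>2 * ((1 - 2 * t) / 8)" for t
      by (simp add: power2_eq_square field_simps)
    have o4: "?B4 (t / 2) - ?B4 t / 16 = pi ^ 4 * ((1 - 6 * t\<^sup>2 + 4 * t ^ 3) / 96)" for t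
      by (simp add: eval_nat_numeral field_simps)
    \<comment> \<open>All powers of pi are pulled out, with the polynomials as opaque variables,
      before these are expanded.\<close>
    have e: "52/3 * ((pi\<^sup>2 * a) * (pi\<^sup>2 * b)) - 16 / pi\<^sup>2 * ((pi ^ 4 * c) * (pi\<^sup>2 * b) + (pi\<^sup>2 * a) * (pi ^ 4 * d))
        + 4 * ((pi\<^sup>2 * f / 4) * (pi\<^sup>2 * g / 4)) + 2 * ((- (pi ^ 4 / 3) * h + - (pi ^ 4 / 3) * i) / 2)
        = pi ^ 4 * (52/3 * (a * b) - 16 * (c * b + a * d) + f * g / 4 - (h + i) / 3)" for a b c d f g h i
      by (simp add: field_simps flip: power_add)
    have s4: "(\<bar>X - Y\<bar> / 2) ^ 4 = (X - Y) ^ 4 / 16" "(\<bar>X - Y\<bar> / 2)\<^sup>2 = (X - Y)\<^sup>2 / 4"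
      "(\<bar>X - Y\<bar> / 2) ^ 3 = \<bar>X - Y\<bar> * (X - Y)\<^sup>2 / 8" "\<bar>X - Y\<bar> ^ 4 = (X - Y) ^ 4"
      "\<bar>X - Y\<bar> ^ 3 = \<bar>X - Y\<bar> * (X - Y)\<^sup>2"
      by (simp_all add: power_divide power3_eq_cube power2_eq_square flip: abs_mult)
    show ?thesis
      unfolding o2 o4 e sob_factor_def bernoulli_poly_1 bernoulli_poly_2 bernoulli_poly_4 s4
      by (simp add: eval_nat_numeral field_simps)
  qed
  finally show ?thesis .
qed

section \<open>Discrete cosine positivity on pairs of lattice points\<close>

lemma sum_cis_roots:
  assumes "0 < N"
  shows "(\<Sum>n<N. cis (2 * pi * of_int (a * int n) / real N)) = (if int N dvd a then of_nat N else 0)"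
proof -
  define w where "w = cis (2 * pi * of_int a / real N)"
  have wp: "cis (2 * pi * of_int (a * int n) / real N) = w ^ n" for n
  proof -
    have "2 * pi * of_int (a * int n) / real N = real n * (2 * pi * of_int a / real N)" by simp
    then show ?thesis by (simp only: w_def Complex.DeMoivre)
  qed
  have wN: "w ^ N = 1"
    using assms by (simp add: w_def Complex.DeMoivre cis_multiple_2pi)
  have w1: "w = 1 \<longleftrightarrow> int N dvd a"
  proof
    assume "w = 1"
    then have "cos (2 * pi * of_int a / real N) = 1" by (simp add: w_def complex_eq_iff)
    then obtain k :: int where "2 * pi * of_int a / real N = of_int k * 2 * pi"
      using cos_one_2pi_int by blast
    then have "real_of_int a = of_int (int N * k)" using assms by (simp add: field_simps)
    then have "a = int N * k" by linarith
    then show "int N dvd a" by simp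
  next
    assume "int N dvd a"
    then obtain k where "a = int N * k" by blast
    then have "2 * pi * of_int a / real N = 2 * pi * of_int k" using assms by simp
    then show "w = 1" by (simp add: w_def)
  qed
  show ?thesis
  proof (cases "w = 1")
    case True
    then show ?thesis using w1 by (simp only: wp) simp
  next
    case False
    then show ?thesis using w1 wN by (simp only: wp sum_gp_strict) simp
  qed
qed

definition ecos :: "nat \<Rightarrow> int \<Rightarrow> nat \<Rightarrow> real" where
  "ecos N a m = cos (2 * pi * of_int (a * int m) / real N)"

lemma ecos_mult: "ecos N a m * ecos N b m = (ecos N (a + b) m + ecos N (a - b) m) / 2"
  by (simp add: ecos_def cos_times_cos algebra_simps add_divide_distrib diff_divide_distrib)

lemma sum_ecos_nonneg: "0 < N \<Longrightarrow> 0 \<le> (\<Sum>m<N. ecos N a m)"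
  using arg_cong[OF sum_cis_roots[of N a], of Re] by (simp add: ecos_def)

text \<open>These functionals are the unnormalised discrete cosine coefficients, so the dual cone
  consists of the functions on index pairs with all of them nonnegative.\<close>

definition cosine_functionals :: "nat \<Rightarrow> (real \<times> nat \<times> nat) list set" where
  "cosine_functionals N =
     (\<lambda>(a, b). map (\<lambda>(m, n). (ecos N a m * ecos N b n, (m, n))) (List.product [0..<N] [0..<N])) ` UNIV"

lemma cone_cosine_functionals_iff:
  "W \<in> dual_cone (cosine_functionals N) \<longleftrightarrow>
    (\<forall>a b. 0 \<le> (\<Sum>m<N. \<Sum>n<N. ecos N a m * ecos N b n * W (m, n)))"
proof -
  have "lin (map (\<lambda>(m, n). (ecos N a m * ecos N b n, (m, n))) (List.product [0..<N] [0..<N])) W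
      = (\<Sum>m<N. \<Sum>n<N. ecos N a m * ecos N b n * W (m, n))" for a b
  proof -
    have "lin (map (\<lambda>(m, n). (ecos N a m * ecos N b n, (m, n))) (List.product [0..<N] [0..<N])) W
      = (\<Sum>(m, n)\<leftarrow>List.product [0..<N] [0..<N]. ecos N a m * ecos N b n * W (m, n))"
      by (simp add: lin_def o_def case_prod_unfold)
    also have "\<dots> = (\<Sum>(m, n)\<in>{..<N} \<times> {..<N}. ecos N a m * ecos N b n * W (m, n))"
      by (subst sum_list_distinct_conv_sum_set) (auto simp: distinct_product atLeast0LessThan)
    finally show ?thesis by (simp add: sum.cartesian_product)
  qed
  then show ?thesis by (simp add: dual_cone_def cosine_functionals_def split_paired_all case_prod_unfold)
qed

text \<open>The product formula for cosines turns a coefficient of the product into the mean of four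
  coefficients of \<open>W\<close> at shifted frequencies.\<close>

lemma ecos_multiplier: "(\<lambda>(m, n). ecos N k m * ecos N l n) \<in> multipliers (cosine_functionals N)"
  unfolding multipliers_def
proof (intro CollectI ballI)
  fix W assume W: "W \<in> dual_cone (cosine_functionals N)"
  define S where "S a b = (\<Sum>m<N. \<Sum>n<N. ecos N a m * ecos N b n * W (m, n))" for a b
  have S: "0 \<le> S a b" for a b using W by (simp add: cone_cosine_functionals_iff S_def)
  have *: "(\<Sum>m<N. \<Sum>n<N. ecos N a m * ecos N b n * (ecos N k m * ecos N l n * W (m, n)))
      = (S (a + k) (b + l) + S (a + k) (b - l) + S (a - k) (b + l) + S (a - k) (b - l)) / 4" for a b
  proof -
    have "ecos N a m * ecos N b n * (ecos N k m * ecos N l n * W (m, n)) =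
        (ecos N (a + k) m * ecos N (b + l) n * W (m, n) + ecos N (a + k) m * ecos N (b - l) n * W (m, n)
        + ecos N (a - k) m * ecos N (b + l) n * W (m, n) + ecos N (a - k) m * ecos N (b - l) n * W (m, n)) / 4" for m n
    proof -
      have "ecos N a m * ecos N b n * (ecos N k m * ecos N l n * W (m, n))
          = (ecos N a m * ecos N k m) * (ecos N b n * ecos N l n) * W (m, n)" by simp
      then show ?thesis by (simp only: ecos_mult) (simp add: algebra_simps)
    qed
    then show ?thesis by (simp only: S_def sum.distrib sum_divide_distrib[symmetric])
  qed
  show "(\<lambda>p. (case p of (m, n) \<Rightarrow> ecos N k m * ecos N l n) * W p) \<in> dual_cone (cosine_functionals N)"
    unfolding cone_cosine_functionals_iff prod.case * using S by (simp add: add_nonneg_nonneg)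
qed

lemma one_cone_cosine_functionals: "0 < N \<Longrightarrow> (\<lambda>p. 1) \<in> dual_cone (cosine_functionals N)"
  by (simp add: cone_cosine_functionals_iff sum_product[symmetric] sum_ecos_nonneg)

lemma cos_frac: "cos (2 * pi * real k * frac t) = cos (2 * pi * real k * t)"
proof -
  have "2 * pi * real k * t = 2 * pi * real k * frac t + 2 * pi * of_int (int k * \<lfloor>t\<rfloor>)"
    by (simp add: frac_def algebra_simps)
  also have "cos \<dots> = cos (2 * pi * real k * frac t)"
    using cos_add[of "2 * pi * real k * frac t" "2 * pi * of_int (int k * \<lfloor>t\<rfloor>)"]
    by (simp only: cos_int_2pin sin_int_2pin)
  finally show ?thesis by simp
qed

text \<open>On [0,1] the halved tent is \<open>x\<close> or its reflection \<open>1 - x\<close>, and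
  cosines of integer frequency do not distinguish these.\<close>

lemma cos_tent: "x \<in> {0..1} \<Longrightarrow> cos (2 * pi * real k * (tent x / 2)) = cos (2 * pi * real k * x)"
proof -
  assume x: "x \<in> {0..1}"
  have "tent x / 2 = x \<or> tent x / 2 = 1 - x" using x by (auto simp: tent_def abs_if)
  then show ?thesis
  proof
    assume "tent x / 2 = 1 - x"
    then show ?thesis by (simp only: cos_reflect)
  qed (simp only:)
qed

lemma tent_range: "x \<in> {0..1} \<Longrightarrow> tent x \<in> {0..1}"
  by (auto simp: tent_def abs_if)

lemma cos_tent_lattice:
  "cos (2 * pi * real (Suc k) * (tent (frac (real m * real z / real N)) / 2)) = ecos N (int (Suc k) * int z) m"
proof -
  have "cos (2 * pi * real (Suc k) * (tent (frac (real m * real z / real N)) / 2))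
      = cos (2 * pi * real (Suc k) * (real m * real z / real N))"
    by (subst cos_tent) (simp_all add: frac_lt_1 less_imp_le cos_frac del: of_nat_Suc)
  then show ?thesis by (simp add: ecos_def mult_ac del: of_nat_Suc)
qed

text \<open>In units of 1/pi^4 the coefficients of \<open>G\<close> are constantly 58/3 before
  division by the squared frequencies, so both claims are coefficientwise bounds on
  \<open>tent_coeff\<close>. The prefactor is (58/3) / (4 pi^4), as each Korobov factor is twice its
  cosine series.\<close>

lemma sob_factor_tent_multiplier:
  fixes N z :: nat
  defines "X \<equiv> \<lambda>m. tent (frac (real m * real z / real N))"
  defines "G \<equiv> \<lambda>m n. 29 / (6 * pi ^ 4) * (kor_factor (real m * real z / real N) 0 * kor_factor (real n * real z / real N) 0)"
  shows "(\<lambda>(m, n). sob_factor (X m) (X n)) \<in> multipliers (cosine_functionals N)" (is ?A)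
    and "(\<lambda>(m, n). G m n - sob_factor (X m) (X n)) \<in> multipliers (cosine_functionals N)" (is ?B)
proof -
  have X: "X m \<in> {0..1}" for m
    unfolding X_def by (rule tent_range) (simp add: frac_lt_1 less_imp_le)
  let ?e = "\<lambda>k m. ecos N (int (Suc k) * int z) m"
  define c where "c k m = ?e k m / real (Suc k) ^ 2" for k m
  have gen: "(\<lambda>p. \<Sum>k<K. \<Sum>l<K. f k l * (case p of (m, n) \<Rightarrow> c k m * c l n)) \<in> multipliers (cosine_functionals N)"
    if f: "\<And>k l. 0 \<le> f k l" for f K
  proof -
    have "(\<lambda>p. \<Sum>k<K. \<Sum>l<K. (f k l / (real (Suc k) ^ 2 * real (Suc l) ^ 2)) * (case p of (m, n) \<Rightarrow> ?e k m * ?e l n))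
        \<in> multipliers (cosine_functionals N)"
      by (intro multiplier_sum multiplier_scale ecos_multiplier) (use f in auto)
    then show ?thesis by (simp add: c_def case_prod_unfold field_simps del: of_nat_Suc)
  qed
  have s: "(\<lambda>K. \<Sum>k<K. \<Sum>l<K. tent_coeff k l * (c k m * c l n)) \<longlonglongrightarrow> pi ^ 4 * sob_factor (X m) (X n)" for m n
    using sob_factor_cosine_expansion[OF X X, of m n] unfolding X_def cos_tent_lattice c_def .
  have g: "(\<lambda>K. \<Sum>k<K. \<Sum>l<K. 58/3 * (c k m * c l n)) \<longlonglongrightarrow> pi ^ 4 * G m n" for m n
  proof -
    have "(\<lambda>K. \<Sum>k<K. c k m) \<longlonglongrightarrow> kor_factor (real m * real z / real N) 0 / 2" for m
    proof -
      have "(\<lambda>k. cos (2 * pi * real (Suc k) * (real m * real z / real N)) / real (Suc k) ^ 2)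
          sums (kor_factor (real m * real z / real N) 0 / 2)"
        using cos_series_sums[of 2 "real m * real z / real N"] by (simp add: kor_factor_def del: of_nat_Suc)
      moreover have "cos (2 * pi * real (Suc k) * (real m * real z / real N)) / real (Suc k) ^ 2 = c k m" for k
        by (simp add: c_def ecos_def mult_ac del: of_nat_Suc)
      ultimately show ?thesis by (simp only: sums_def)
    qed
    then have "(\<lambda>K. 58/3 * ((\<Sum>k<K. c k m) * (\<Sum>l<K. c l n)))
        \<longlonglongrightarrow> 58/3 * (kor_factor (real m * real z / real N) 0 / 2 * (kor_factor (real n * real z / real N) 0 / 2))"
      by (intro tendsto_intros)
    moreover have "58/3 * (kor_factor (real m * real z / real N) 0 / 2 * (kor_factor (real n * real z / real N) 0 / 2)) = pi ^ 4 * G m n"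
      by (simp add: G_def)
    moreover have "58/3 * ((\<Sum>k<K. c k m) * (\<Sum>l<K. c l n)) = (\<Sum>k<K. \<Sum>l<K. 58/3 * (c k m * c l n))" for K
      by (subst sum_product) (simp only: sum_distrib_left)
    ultimately show ?thesis by (simp only:)
  qed
  have "(\<lambda>(m, n). pi ^ 4 * sob_factor (X m) (X n)) \<in> multipliers (cosine_functionals N)"
    by (rule multiplier_limit[OF gen[OF tent_coeff_bounds(1)]]) (use s in \<open>auto split: prod.split\<close>)
  from multiplier_scale[OF _ this, of "1 / pi ^ 4"]
  show ?A by (simp add: case_prod_unfold)
  have "0 \<le> 58/3 - tent_coeff k l" for k l using tent_coeff_bounds(2)[of k l] by simp
  note * = gen[OF this]
  have "(\<lambda>(m, n). pi ^ 4 * G m n - pi ^ 4 * sob_factor (X m) (X n)) \<in> multipliers (cosine_functionals N)"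
  proof (rule multiplier_limit[OF *])
    fix p :: "nat \<times> nat"
    obtain m n where p: "p = (m, n)" by fastforce
    show "(\<lambda>K. \<Sum>k<K. \<Sum>l<K. (58/3 - tent_coeff k l) * (case p of (m, n) \<Rightarrow> c k m * c l n))
        \<longlonglongrightarrow> (case p of (m, n) \<Rightarrow> pi ^ 4 * G m n - pi ^ 4 * sob_factor (X m) (X n))"
      using tendsto_diff[OF g s, of m n] by (simp add: p left_diff_distrib sum_subtractf)
  qed
  from multiplier_scale[OF _ this, of "1 / pi ^ 4"]
  show ?B by (simp add: case_prod_unfold diff_divide_distrib right_diff_distrib)
qed

theorem sob_factor_tent_sum_le:
  fixes N :: nat and z :: "nat \<Rightarrow> nat"
  assumes N: "0 < N" and u: "finite u"
  shows "(\<Sum>m<N. \<Sum>n<N. \<Prod>j\<in>u. sob_factor (tent (frac (real m * real (z j) / real N))) (tent (frac (real n * real (z j) / real N))))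
    \<le> (29 / (6 * pi ^ 4)) ^ card u * (\<Sum>m<N. \<Prod>j\<in>u. kor_factor (real m * real (z j) / real N) 0)\<^sup>2"
proof -
  define F where "F j m n = sob_factor (tent (frac (real m * real (z j) / real N))) (tent (frac (real n * real (z j) / real N)))" for j m n
  define G where "G j m n = 29 / (6 * pi ^ 4) * (kor_factor (real m * real (z j) / real N) 0 * kor_factor (real n * real (z j) / real N) 0)" for j m n
  have GF: "(\<lambda>(m, n). G j m n - F j m n) \<in> multipliers (cosine_functionals N)" for j
    unfolding G_def F_def by (rule sob_factor_tent_multiplier(2))
  have FM: "(\<lambda>(m, n). F j m n) \<in> multipliers (cosine_functionals N)" for j
    unfolding F_def by (rule sob_factor_tent_multiplier(1))
  have GM: "(\<lambda>(m, n). G j m n) \<in> multipliers (cosine_functionals N)" for j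
    using multiplier_add[OF FM[of j] GF[of j]] by (simp add: case_prod_unfold)
  have "(\<lambda>(m, n). (\<Prod>j\<in>u. G j m n) - (\<Prod>j\<in>u. F j m n)) \<in> multipliers (cosine_functionals N)"
    using u
  proof (induction u)
    case empty
    then show ?case using multiplier_const[of 0] by (simp add: case_prod_unfold)
  next
    case (insert i u)
    \<comment> \<open>Telescoping: G_i prod G - F_i prod F = G_i (prod G - prod F) + (G_i - F_i)
      prod F, with only multipliers on the right.\<close>
    have "(\<lambda>p. (case p of (m, n) \<Rightarrow> G i m n) * (case p of (m, n) \<Rightarrow> (\<Prod>j\<in>u. G j m n) - (\<Prod>j\<in>u. F j m n))
        + (case p of (m, n) \<Rightarrow> G i m n - F i m n) * (\<Prod>j\<in>u. case p of (m, n) \<Rightarrow> F j m n))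
        \<in> multipliers (cosine_functionals N)"
      by (intro multiplier_add multiplier_mult multiplier_prod GM GF FM insert.IH)
    then show ?case using insert.hyps by (simp add: case_prod_unfold algebra_simps)
  qed
  from multiplier_cone[OF this one_cone_cosine_functionals[OF N]]
  \<comment> \<open>At frequencies 0 the cosine functional is the plain double sum.\<close>
  have "0 \<le> (\<Sum>m<N. \<Sum>n<N. ecos N 0 m * ecos N 0 n * ((\<Prod>j\<in>u. G j m n) - (\<Prod>j\<in>u. F j m n)))"
    unfolding cone_cosine_functionals_iff by simp
  then have "(\<Sum>m<N. \<Sum>n<N. \<Prod>j\<in>u. F j m n) \<le> (\<Sum>m<N. \<Sum>n<N. \<Prod>j\<in>u. G j m n)"
    by (simp add: ecos_def sum_subtractf)
  also have "(\<Sum>m<N. \<Sum>n<N. \<Prod>j\<in>u. G j m n)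
      = (29 / (6 * pi ^ 4)) ^ card u * ((\<Sum>m<N. \<Prod>j\<in>u. kor_factor (real m * real (z j) / real N) 0)
        * (\<Sum>n<N. \<Prod>j\<in>u. kor_factor (real n * real (z j) / real N) 0))"
    unfolding G_def by (subst sum_product) (simp only: sum_distrib_left prod.distrib prod_constant)
  finally show ?thesis by (simp add: F_def power2_eq_square)
qed

section \<open>Lattice sums over the dual lattice\<close>

definition residue_ints :: "nat \<Rightarrow> nat \<Rightarrow> int set" where
  "residue_ints N r = {h. h \<noteq> 0 \<and> h mod int N = int r}"

text \<open>The exponent is kept general because raising the weights |h|^(-2) to the power
  \<open>p\<close> leads to |h|^(-2 p).\<close>

definition rho :: "nat \<Rightarrow> real \<Rightarrow> nat \<Rightarrow> real" where
  "rho N p r = (\<Sum>\<^sub>\<infinity>h\<in>residue_ints N r. \<bar>real_of_int h\<bar> powr (- 2 * p))"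

lemma Union_residue_ints: "0 < N \<Longrightarrow> (\<Union>r\<in>{..<N}. residue_ints N r) = UNIV - {0}"
proof (intro set_eqI iffI)
  fix h :: int assume N: "0 < N" and h: "h \<in> UNIV - {0}"
  then have "h mod int N = int (nat (h mod int N))" "nat (h mod int N) < N"
    by (auto simp: nat_less_iff)
  then show "h \<in> (\<Union>r\<in>{..<N}. residue_ints N r)" using h
    by (auto simp: residue_ints_def intro!: bexI[of _ "nat (h mod int N)"])
qed (auto simp: residue_ints_def)

lemma residue_ints_disjoint: "r \<noteq> r' \<Longrightarrow> residue_ints N r \<inter> residue_ints N r' = {}"
  by (auto simp: residue_ints_def)

lemma zeta_has_sum:
  assumes p: "1/2 < p"
  shows "((\<lambda>h::int. \<bar>real_of_int h\<bar> powr (- 2 * p)) has_sum (2 * zeta (2 * p))) (UNIV - {0})"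
proof -
  have s: "summable (\<lambda>n. real (Suc n) powr (- 2 * p))"
    using p summable_real_powr_iff[of "- 2 * p"] by (subst summable_Suc_iff) auto
  have z: "zeta (2 * p) = (\<Sum>n. real (Suc n) powr (- 2 * p))"
    by (simp add: zeta_def powr_minus_divide)
  have "((\<lambda>n. real (Suc n) powr (- 2 * p)) has_sum zeta (2 * p)) UNIV"
    unfolding z by (rule norm_summable_imp_has_sum) (use s in \<open>auto intro: summable_sums\<close>)
  then show ?thesis
    using has_sum_nonzero_int[of "\<lambda>h. \<bar>real_of_int h\<bar> powr (- 2 * p)" "zeta (2 * p)" "zeta (2 * p)"]
    by (simp add: add.commute)
qed

lemma rho_summable:
  assumes "1/2 < p"
  shows "(\<lambda>h. \<bar>real_of_int h\<bar> powr (- 2 * p)) summable_on residue_ints N r"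
  using summable_on_subset_banach[OF has_sum_imp_summable[OF zeta_has_sum[OF assms]], of "residue_ints N r"]
  by (auto simp: residue_ints_def)

lemma rho_nonneg: "0 \<le> rho N p r"
  unfolding rho_def by (rule infsum_nonneg) simp

lemma sum_rho:
  assumes "0 < N" "1/2 < p" shows "(\<Sum>r<N. rho N p r) = 2 * zeta (2 * p)"
proof -
  have "((\<lambda>h. \<bar>real_of_int h\<bar> powr (- 2 * p)) has_sum (\<Sum>r<N. rho N p r)) (\<Union>r\<in>{..<N}. residue_ints N r)"
    unfolding rho_def
    by (rule sum_has_sum; (rule finite_lessThan | rule has_sum_infsum[OF rho_summable[OF assms(2)]]
          | erule residue_ints_disjoint))
  then show ?thesis using zeta_has_sum[OF assms(2)] has_sum_unique
    unfolding Union_residue_ints[OF assms(1)] by blast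
qed

lemma rho_zero:
  assumes "0 < N" "1/2 < p" shows "rho N p 0 = real N powr (- 2 * p) * (2 * zeta (2 * p))"
proof -
  have "residue_ints N 0 = (\<lambda>k. int N * k) ` (UNIV - {0})"
  proof (intro set_eqI iffI)
    fix h assume "h \<in> residue_ints N 0"
    then have "h \<noteq> 0" "int N dvd h" by (auto simp: residue_ints_def)
    then show "h \<in> (\<lambda>k. int N * k) ` (UNIV - {0})" by auto
  qed (use assms in \<open>auto simp: residue_ints_def\<close>)
  then have "rho N p 0 = (\<Sum>\<^sub>\<infinity>k\<in>UNIV - {0}. \<bar>real_of_int (int N * k)\<bar> powr (- 2 * p))"
    unfolding rho_def using assms(1) by (simp only:) (subst infsum_reindex, auto simp: inj_on_def o_def)
  also have "\<dots> = (\<Sum>\<^sub>\<infinity>k\<in>UNIV - {0::int}. real N powr (- 2 * p) * \<bar>real_of_int k\<bar> powr (- 2 * p))"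
    by (intro infsum_cong) (simp add: abs_mult powr_mult)
  also have "\<dots> = real N powr (- 2 * p) * (2 * zeta (2 * p))"
    by (rule infsumI[OF has_sum_cmult_right[OF zeta_has_sum[OF assms(2)]]])
  finally show ?thesis .
qed

lemma zeta_nonneg: assumes "1/2 < p" shows "0 \<le> zeta (2 * p)"
proof -
  have "0 \<le> 2 * zeta (2 * p)" by (rule has_sum_nonneg[OF zeta_has_sum[OF assms]]) simp
  then show ?thesis by simp
qed

text \<open>Since 2 p > 1, (N - 1) N^(-2 p) is at most 1. This pays for residue 0, which satisfies a
  divisible congruence for all N - 1 choices of a component.\<close>

lemma rho_zero_le:
  assumes "0 < N" "1/2 < p"
  shows "real (N - 1) * rho N p 0 \<le> 2 * zeta (2 * p)"
proof -
  have "real N powr (- 2 * p) \<le> real N powr (- 1)"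
    using assms by (intro powr_mono) auto
  then have "real (N - 1) * real N powr (- 2 * p) \<le> real N * real N powr (- 1)"
    by (intro mult_mono) auto
  also have "\<dots> = 1" using assms by (simp add: powr_minus)
  finally have "real (N - 1) * real N powr (- 2 * p) * (2 * zeta (2 * p)) \<le> 1 * (2 * zeta (2 * p))"
    by (rule mult_right_mono) (use zeta_nonneg[OF assms(2)] in simp)
  then show ?thesis by (simp add: rho_zero[OF assms] mult.assoc)
qed

text \<open>After division by the total each term lies in [0,1], where x is at most x^p.\<close>

lemma sum_powr_le:
  fixes a :: "'i \<Rightarrow> real"
  assumes p: "0 < p" "p \<le> 1" and a: "\<And>i. i \<in> I \<Longrightarrow> 0 \<le> a i"
  shows "(\<Sum>i\<in>I. a i) powr p \<le> (\<Sum>i\<in>I. a i powr p)"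
proof (cases "finite I \<and> (\<Sum>i\<in>I. a i) \<noteq> 0")
  case False
  then have "(\<Sum>i\<in>I. a i) = 0" by auto
  then show ?thesis by (simp add: sum_nonneg)
next
  case True
  define S where "S = (\<Sum>i\<in>I. a i)"
  have S: "0 < S" using True sum_nonneg[of I a] a by (simp add: S_def less_le)
  have "a i / S \<le> (a i / S) powr p" if i: "i \<in> I" for i
  proof (cases "a i = 0")
    case False
    have "a i \<le> S" unfolding S_def using True i a by (intro member_le_sum) auto
    then have "(a i / S) powr 1 \<le> (a i / S) powr p"
      using S a[OF i] False p by (intro powr_mono') auto
    then show ?thesis using S a[OF i] by simp
  qed simp
  then have "(\<Sum>i\<in>I. a i / S) \<le> (\<Sum>i\<in>I. (a i / S) powr p)" by (rule sum_mono)
  also have "(\<Sum>i\<in>I. a i / S) = 1" using S by (simp add: S_def flip: sum_divide_distrib)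
  also have "(\<Sum>i\<in>I. (a i / S) powr p) = (\<Sum>i\<in>I. a i powr p) / S powr p"
    using S a by (simp add: powr_divide sum_divide_distrib)
  finally show ?thesis using S by (simp add: S_def[symmetric] pos_le_divide_eq)
qed

text \<open>The power inequality is applied to finite partial sums; the \<open>1 / p\<close>-th
  power is then a common upper bound that passes to the infinite sum.\<close>

lemma rho_powr_le:
  assumes p: "1/2 < p" "p \<le> 1"
  shows "rho N 1 r powr p \<le> rho N p r"
proof -
  have "sum (\<lambda>h. \<bar>real_of_int h\<bar> powr (- 2 * 1)) F \<le> rho N p r powr (1 / p)"
    if F: "finite F" "F \<subseteq> residue_ints N r" for F
  proof -
    have "(\<Sum>h\<in>F. \<bar>real_of_int h\<bar> powr (- 2 * 1)) powr p \<le> (\<Sum>h\<in>F. (\<bar>real_of_int h\<bar> powr (- 2 * 1)) powr p)"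
      using p by (intro sum_powr_le) auto
    also have "\<dots> = (\<Sum>h\<in>F. \<bar>real_of_int h\<bar> powr (- 2 * p))" by (simp add: powr_powr)
    also have "\<dots> \<le> rho N p r"
      unfolding rho_def by (rule finite_sum_le_infsum[OF rho_summable[OF p(1)]]) (use F in auto)
    finally have "((\<Sum>h\<in>F. \<bar>real_of_int h\<bar> powr (- 2 * 1)) powr p) powr (1 / p) \<le> rho N p r powr (1 / p)"
      using p by (intro powr_mono2) auto
    then show ?thesis using p by (simp add: powr_powr sum_nonneg)
  qed
  then have "rho N 1 r \<le> rho N p r powr (1 / p)"
    unfolding rho_def[of N 1] by (intro infsum_le_finite_sums rho_summable) auto
  then have "rho N 1 r powr p \<le> (rho N p r powr (1 / p)) powr p"
    using p by (intro powr_mono2 rho_nonneg) auto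
  then show ?thesis using p rho_nonneg[of N p r] by (simp add: powr_powr)
qed

lemma cis_int_multiple: "cis (x + 2 * pi * of_int k) = cis x"
  by (simp flip: cis_mult)

text \<open>At a/N the exponential depends only on h mod N, so the absolutely convergent series can
  be grouped by residues.\<close>

lemma kor_factor_dft:
  assumes N: "0 < N"
  shows "of_real (kor_factor (of_int a / real N) 0)
    = (\<Sum>r<N. of_real (rho N 1 r) * cis (2 * pi * of_int (a * int r) / real N))"
proof -
  let ?f = "\<lambda>h::int. exp (2 * of_real pi * \<i> * of_int h * of_real (of_int a / real N - 0)) / of_real (\<bar>real_of_int h\<bar> powr 2) :: complex"
  have "(?f has_sum (cis (2 * pi * of_int (a * int r) / real N) * of_real (rho N 1 r))) (residue_ints N r)" for r
  proof -
    have "?f h = cis (2 * pi * of_int (a * int r) / real N) * of_real (\<bar>real_of_int h\<bar> powr (- 2 * 1))"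
      if h: "h \<in> residue_ints N r" for h
    proof -
      have "h = int r + int N * (h div int N)"
        using h mult_div_mod_eq[of "int N" h] by (simp add: residue_ints_def)
      then have "real_of_int h = real r + real N * of_int (h div int N)"
        by (metis of_int_add of_int_mult of_int_of_nat_eq)
      then have e: "2 * pi * of_int h * (of_int a / real N) = 2 * pi * of_int (a * int r) / real N + 2 * pi * of_int (a * (h div int N))"
        using N by (simp add: field_simps)
      have "exp (2 * of_real pi * \<i> * of_int h * of_real (of_int a / real N - 0)) = cis (2 * pi * of_int h * (of_int a / real N))"
        by (simp add: cis_conv_exp mult_ac)
      then show ?thesis unfolding e cis_int_multiple by (simp add: powr_minus divide_inverse)
    qed
    moreover have "((\<lambda>h. cis (2 * pi * of_int (a * int r) / real N) * of_real (\<bar>real_of_int h\<bar> powr (- 2 * 1)))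
        has_sum (cis (2 * pi * of_int (a * int r) / real N) * of_real (rho N 1 r))) (residue_ints N r)"
      unfolding rho_def
      by (intro has_sum_cmult_right has_sum_bounded_linear[OF bounded_linear_of_real] has_sum_infsum rho_summable) auto
    ultimately show ?thesis by (subst has_sum_cong) auto
  qed
  then have "(?f has_sum (\<Sum>r<N. cis (2 * pi * of_int (a * int r) / real N) * of_real (rho N 1 r))) (\<Union>r\<in>{..<N}. residue_ints N r)"
    by (rule sum_has_sum[OF finite_lessThan]) (erule residue_ints_disjoint)
  then show ?thesis
    using kor_factor_has_sum[of "of_int a / real N" 0] has_sum_unique
    unfolding Union_residue_ints[OF N] by (fastforce simp: mult.commute)
qed

text \<open>The sum of prod |h_j|^(-2 p) over vectors of nonzero integers indexed by
  \<open>u\<close> with h . z divisible by N, folded by residues into a finite sum.\<close>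

definition dual_sum :: "nat \<Rightarrow> real \<Rightarrow> nat set \<Rightarrow> (nat \<Rightarrow> nat) \<Rightarrow> real" where
  "dual_sum N p u z = (\<Sum>r\<in>PiE u (\<lambda>_. {..<N}). of_bool (N dvd (\<Sum>j\<in>u. r j * z j)) * (\<Prod>j\<in>u. rho N p (r j)))"

lemma prod_cis: "finite u \<Longrightarrow> (\<Prod>j\<in>u. cis (f j)) = cis (\<Sum>j\<in>u. f j)"
  by (induction u rule: finite_induct) (auto simp: cis_mult)

lemma prod_kor_factor_dft:
  assumes N: "0 < N" and u: "finite u"
  shows "of_real (\<Prod>j\<in>u. kor_factor (of_int (a * int (z j)) / real N) 0)
    = (\<Sum>r\<in>PiE u (\<lambda>_. {..<N}). of_real (\<Prod>j\<in>u. rho N 1 (r j)) * cis (2 * pi * of_int (int (\<Sum>j\<in>u. r j * z j) * a) / real N))"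
proof -
  have "of_real (\<Prod>j\<in>u. kor_factor (of_int (a * int (z j)) / real N) 0)
    = (\<Prod>j\<in>u. \<Sum>r<N. of_real (rho N 1 r) * cis (2 * pi * of_int (a * int (z j) * int r) / real N))"
    unfolding of_real_prod kor_factor_dft[OF N] ..
  also have "\<dots> = (\<Sum>r\<in>PiE u (\<lambda>_. {..<N}). \<Prod>j\<in>u. of_real (rho N 1 (r j)) * cis (2 * pi * of_int (a * int (z j) * int (r j)) / real N))"
    by (rule prod_sum_PiE[OF u]) auto
  also have "\<dots> = (\<Sum>r\<in>PiE u (\<lambda>_. {..<N}). of_real (\<Prod>j\<in>u. rho N 1 (r j)) * cis (2 * pi * of_int (int (\<Sum>j\<in>u. r j * z j) * a) / real N))"
  proof (rule sum.cong[OF refl])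
    fix r
    have "(\<Sum>j\<in>u. 2 * pi * of_int (a * int (z j) * int (r j)) / real N)
        = 2 * pi * of_int (int (\<Sum>j\<in>u. r j * z j) * a) / real N"
      by (simp add: sum_distrib_left sum_distrib_right sum_divide_distrib mult_ac)
    then show "(\<Prod>j\<in>u. of_real (rho N 1 (r j)) * cis (2 * pi * of_int (a * int (z j) * int (r j)) / real N))
      = of_real (\<Prod>j\<in>u. rho N 1 (r j)) * cis (2 * pi * of_int (int (\<Sum>j\<in>u. r j * z j) * a) / real N)"
      by (simp only: prod.distrib prod_cis[OF u] of_real_prod)
  qed
  finally show ?thesis .
qed

lemma lattice_sum_single:
  assumes N: "0 < N" and u: "finite u"
  shows "(\<Sum>m<N. \<Prod>j\<in>u. kor_factor (real m * real (z j) / real N) 0) = real N * dual_sum N 1 u z"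
proof -
  let ?S = "\<lambda>r. int (\<Sum>j\<in>u. r j * z j)"
  have "complex_of_real (\<Sum>m<N. \<Prod>j\<in>u. kor_factor (real m * real (z j) / real N) 0)
      = (\<Sum>m<N. complex_of_real (\<Prod>j\<in>u. kor_factor (of_int (int m * int (z j)) / real N) 0))"
    by simp
  also have "\<dots> = (\<Sum>m<N. \<Sum>r\<in>PiE u (\<lambda>_. {..<N}). of_real (\<Prod>j\<in>u. rho N 1 (r j)) * cis (2 * pi * of_int (?S r * int m) / real N))"
    unfolding prod_kor_factor_dft[OF N u] ..
  also have "\<dots> = (\<Sum>r\<in>PiE u (\<lambda>_. {..<N}). of_real (\<Prod>j\<in>u. rho N 1 (r j)) * (\<Sum>m<N. cis (2 * pi * of_int (?S r * int m) / real N)))"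
    by (subst sum.swap) (simp only: sum_distrib_left)
  also have "\<dots> = (\<Sum>r\<in>PiE u (\<lambda>_. {..<N}). of_real (\<Prod>j\<in>u. rho N 1 (r j)) * (if int N dvd ?S r then of_nat N else 0))"
    unfolding sum_cis_roots[OF N] ..
  also have "\<dots> = complex_of_real (real N * dual_sum N 1 u z)"
    unfolding dual_sum_def int_dvd_int_iff
    by (simp only: of_real_mult of_real_sum sum_distrib_left) (intro sum.cong refl, simp)
  finally show ?thesis by (simp only: of_real_eq_iff)
qed

lemma sum_sum_mult:
  fixes w :: "'c :: comm_semiring_0"
  shows "(\<Sum>m\<in>A. \<Sum>n\<in>B. w * (f m * g n)) = w * (sum f A * sum g B)"
  by (subst sum_product) (simp only: sum_distrib_left)

text \<open>Each residue vector contributes the squared modulus of a sum of roots of unity, N^2 or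
  0. The value is therefore N times the single sum, which is what links the two error
  criteria.\<close>

lemma lattice_sum_double:
  assumes N: "0 < N" and u: "finite u"
  shows "(\<Sum>m<N. \<Sum>n<N. \<Prod>j\<in>u. kor_factor (real m * real (z j) / real N) (real n * real (z j) / real N))
    = (real N)\<^sup>2 * dual_sum N 1 u z"
proof -
  let ?S = "\<lambda>r. int (\<Sum>j\<in>u. r j * z j)"
  let ?c = "\<lambda>r m. cis (2 * pi * of_int (?S r * int m) / real N)"
  have k: "kor_factor (real m * real (z j) / real N) (real n * real (z j) / real N)
      = kor_factor (of_int ((int m - int n) * int (z j)) / real N) 0" for m n j
    by (simp add: kor_factor_def diff_divide_distrib left_diff_distrib)
  have c: "cis (2 * pi * of_int (?S r * (int m - int n)) / real N) = ?c r m * cnj (?c r n)" for r m n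
    by (simp add: cis_cnj cis_mult right_diff_distrib diff_divide_distrib)
  have "complex_of_real (\<Sum>m<N. \<Sum>n<N. \<Prod>j\<in>u. kor_factor (real m * real (z j) / real N) (real n * real (z j) / real N))
      = (\<Sum>m<N. \<Sum>n<N. complex_of_real (\<Prod>j\<in>u. kor_factor (of_int ((int m - int n) * int (z j)) / real N) 0))"
    by (simp only: k of_real_sum)
  also have "\<dots> = (\<Sum>m<N. \<Sum>n<N. \<Sum>r\<in>PiE u (\<lambda>_. {..<N}). of_real (\<Prod>j\<in>u. rho N 1 (r j)) * (?c r m * cnj (?c r n)))"
    unfolding prod_kor_factor_dft[OF N u] c ..
  also have "\<dots> = (\<Sum>m<N. \<Sum>r\<in>PiE u (\<lambda>_. {..<N}). \<Sum>n<N. of_real (\<Prod>j\<in>u. rho N 1 (r j)) * (?c r m * cnj (?c r n)))"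
    by (intro sum.cong refl sum.swap)
  also have "\<dots> = (\<Sum>r\<in>PiE u (\<lambda>_. {..<N}). \<Sum>m<N. \<Sum>n<N. of_real (\<Prod>j\<in>u. rho N 1 (r j)) * (?c r m * cnj (?c r n)))"
    by (rule sum.swap)
  also have "\<dots> = (\<Sum>r\<in>PiE u (\<lambda>_. {..<N}). of_real (\<Prod>j\<in>u. rho N 1 (r j)) * ((\<Sum>m<N. ?c r m) * cnj (\<Sum>n<N. ?c r n)))"
    by (simp only: sum_sum_mult cnj_sum)
  also have "\<dots> = (\<Sum>r\<in>PiE u (\<lambda>_. {..<N}). of_real (\<Prod>j\<in>u. rho N 1 (r j))
      * ((if int N dvd ?S r then of_nat N else 0) * cnj (if int N dvd ?S r then of_nat N else 0)))"
    unfolding sum_cis_roots[OF N] ..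
  also have "\<dots> = complex_of_real ((real N)\<^sup>2 * dual_sum N 1 u z)"
    unfolding dual_sum_def int_dvd_int_iff
    by (simp only: of_real_mult of_real_sum sum_distrib_left) (intro sum.cong refl, simp add: power2_eq_square)
  finally show ?thesis by (simp only: of_real_eq_iff)
qed

lemma dual_sum_nonneg: "0 \<le> dual_sum N p u z"
  unfolding dual_sum_def by (intro sum_nonneg mult_nonneg_nonneg prod_nonneg) (auto simp: rho_nonneg)

lemma dual_sum_cong: "(\<And>j. j \<in> u \<Longrightarrow> z j = z' j) \<Longrightarrow> dual_sum N p u z = dual_sum N p u z'"
  unfolding dual_sum_def by simp

lemma dual_sum_powr_le:
  assumes p: "1/2 < p" "p \<le> 1"
  shows "dual_sum N 1 u z powr p \<le> dual_sum N p u z"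
proof -
  let ?b = "\<lambda>r. of_bool (N dvd (\<Sum>j\<in>u. r j * z j)) :: real"
  have "dual_sum N 1 u z powr p \<le> (\<Sum>r\<in>PiE u (\<lambda>_. {..<N}). (?b r * (\<Prod>j\<in>u. rho N 1 (r j))) powr p)"
    unfolding dual_sum_def using p
    by (intro sum_powr_le) (auto intro!: mult_nonneg_nonneg prod_nonneg rho_nonneg)
  also have "\<dots> \<le> (\<Sum>r\<in>PiE u (\<lambda>_. {..<N}). ?b r * (\<Prod>j\<in>u. rho N p (r j)))"
  proof (rule sum_mono)
    fix r
    have "(\<Prod>j\<in>u. rho N 1 (r j) powr p) \<le> (\<Prod>j\<in>u. rho N p (r j))"
      by (intro prod_mono conjI rho_powr_le p) simp
    then show "(?b r * (\<Prod>j\<in>u. rho N 1 (r j))) powr p \<le> ?b r * (\<Prod>j\<in>u. rho N p (r j))"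
      by (simp add: prod_powr_distrib)
  qed
  finally show ?thesis by (simp add: dual_sum_def)
qed

section \<open>Averaging over one component of the generating vector\<close>

text \<open>If N divides \<open>s\<close>, only t = 0 has solutions, and the hypothesis on
  \<open>\<rho> 0\<close> absorbs all N - 1 of them. Otherwise t = 0 has none, and every other t is
  invertible modulo N and has at most one.\<close>

lemma card_solutions_le:
  fixes \<rho> :: "nat \<Rightarrow> real"
  assumes N: "prime N" and \<rho>: "\<And>t. 0 \<le> \<rho> t" and 0: "real (N - 1) * \<rho> 0 \<le> (\<Sum>t<N. \<rho> t)"
  shows "(\<Sum>t<N. \<rho> t * (\<Sum>c=1..N-1. of_bool (N dvd s + t * c))) \<le> (\<Sum>t<N. \<rho> t)"
proof (cases "N dvd s")
  case True
  have N0: "0 < N" using N prime_gt_0_nat by blast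
  have "(\<Sum>c=1..N-1. of_bool (N dvd s + t * c)) = (if t = 0 then real (N - 1) else 0)" if t: "t < N" for t
  proof (cases "t = 0")
    case True
    then show ?thesis using \<open>N dvd s\<close> by simp
  next
    case False
    have "\<not> N dvd s + t * c" if c: "c \<in> {1..N-1}" for c
    proof
      assume "N dvd s + t * c"
      then have "N dvd t * c" using True by (simp add: dvd_add_right_iff)
      then have "N dvd t \<or> N dvd c" using N prime_dvd_mult_iff by blast
      moreover have "c < N" "0 < c" using c N0 by auto
      ultimately show False using False t nat_dvd_not_less[of t N] nat_dvd_not_less[of c N] by blast
    qed
    then have "(\<Sum>c=1..N-1. of_bool (N dvd s + t * c)) = (\<Sum>c=1..N-1. 0 :: real)"
      by (intro sum.cong) auto
    then show ?thesis using False by simp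
  qed
  then have "(\<Sum>t<N. \<rho> t * (\<Sum>c=1..N-1. of_bool (N dvd s + t * c))) = (\<Sum>t<N. if t = 0 then real (N - 1) * \<rho> 0 else 0)"
    by (intro sum.cong) auto
  also have "\<dots> = real (N - 1) * \<rho> 0" using N0 by simp
  finally show ?thesis using 0 by simp
next
  case False
  have le: "(\<Sum>c=1..N-1. of_bool (N dvd s + t * c)) \<le> (1::real)" if t: "t < N" for t
  proof -
    have "card {c \<in> {1..N-1}. N dvd s + t * c} \<le> 1"
    proof (rule card_le_Suc0_iff_eq[THEN iffD2, unfolded One_nat_def[symmetric]])
      have key: "c \<le> c' \<Longrightarrow> c = c'" if c: "c \<in> {c \<in> {1..N-1}. N dvd s + t * c}" "c' \<in> {c \<in> {1..N-1}. N dvd s + t * c}" for c c'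
      proof (rule ccontr)
        assume "c \<le> c'" "c \<noteq> c'"
        have "s + t * c' = (s + t * c) + t * (c' - c)"
          using \<open>c \<le> c'\<close> by (simp add: diff_mult_distrib2)
        moreover have "N dvd s + t * c" "N dvd s + t * c'" using c by auto
        ultimately have "N dvd t * (c' - c)" by (metis dvd_add_right_iff)
        then have "N dvd t \<or> N dvd c' - c" using N prime_dvd_mult_iff by blast
        moreover have "\<not> N dvd t" 
        proof
          assume "N dvd t"
          then have "N dvd t * c" by simp
          then show False using c(1) False by (simp add: dvd_add_left_iff)
        qed
        moreover have "0 < c' - c" "c' - c < N" using \<open>c \<le> c'\<close> \<open>c \<noteq> c'\<close> c by auto
        ultimately show False using nat_dvd_not_less by blast
      qed
      show "\<forall>c1\<in>{c \<in> {1..N-1}. N dvd s + t * c}. \<forall>c2\<in>{c \<in> {1..N-1}. N dvd s + t * c}. c1 = c2"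
      proof (intro ballI)
        fix c1 c2 assume c: "c1 \<in> {c \<in> {1..N-1}. N dvd s + t * c}" "c2 \<in> {c \<in> {1..N-1}. N dvd s + t * c}"
        show "c1 = c2"
        proof (cases "c1 \<le> c2")
          case True
          then show ?thesis by (rule key[OF c])
        next
          case False
          then have "c2 \<le> c1" by simp
          from key[OF c(2) c(1) this] show ?thesis by (rule sym)
        qed
      qed
    qed simp
    moreover have "(\<Sum>c=1..N-1. of_bool (N dvd s + t * c)) = real (card {c \<in> {1..N-1}. N dvd s + t * c})"
      by (simp add: of_bool_def sum.If_cases Int_def)
    ultimately show ?thesis by simp
  qed
  show ?thesis
    by (intro sum_mono) (use mult_left_mono[OF le \<rho>] in auto)
qed

lemma sum_PiE_insert:
  assumes "d \<notin> v"
  shows "(\<Sum>r\<in>PiE (insert d v) B. F r) = (\<Sum>r\<in>PiE v B. \<Sum>t\<in>B d. F (r(d := t)))"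
proof -
  have "(\<Sum>r\<in>PiE (insert d v) B. F r) = (\<Sum>(t, r)\<in>B d \<times> PiE v B. F (r(d := t)))"
    unfolding PiE_insert_eq using inj_combinator[OF assms, of B]
    by (subst sum.reindex) (auto simp: case_prod_unfold)
  then show ?thesis by (simp add: sum.cartesian_product[symmetric] sum.swap[of _ "PiE v B"])
qed

text \<open>With the other residues fixed, the congruence is linear in the varied component, so
  \<open>card_solutions_le\<close> bounds the inner sum by one full sum of \<open>rho\<close>; the
  remaining coordinates factor.\<close>

lemma sum_dual_sum_le:
  assumes N: "prime N" and p: "1/2 < p" and u: "finite u" "d \<in> u"
  shows "(\<Sum>c=1..N-1. dual_sum N p u (z(d := c))) \<le> (2 * zeta (2 * p)) ^ card u"
proof -
  have N0: "0 < N" using N prime_gt_0_nat by blast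
  define v where "v = u - {d}"
  have uv: "u = insert d v" "d \<notin> v" "finite v" using u by (auto simp: v_def)
  define R where "R r = (\<Prod>j\<in>v. rho N p (r j))" for r
  have R0: "0 \<le> R r" for r by (auto simp: R_def intro!: prod_nonneg rho_nonneg)
  have "dual_sum N p u (z(d := c)) = (\<Sum>r\<in>PiE v (\<lambda>_. {..<N}). \<Sum>t<N.
      of_bool (N dvd (\<Sum>j\<in>v. r j * z j) + t * c) * (rho N p t * R r))" for c
  proof -
    have "(\<Sum>j\<in>insert d v. (r(d := t)) j * (z(d := c)) j) = (\<Sum>j\<in>v. r j * z j) + t * c" for r t
    proof -
      have "(\<Sum>j\<in>v. (r(d := t)) j * (z(d := c)) j) = (\<Sum>j\<in>v. r j * z j)"
        using uv by (intro sum.cong) auto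
      then show ?thesis using uv by simp
    qed
    moreover have "(\<Prod>j\<in>insert d v. rho N p ((r(d := t)) j)) = rho N p t * R r" for r t
    proof -
      have "(\<Prod>j\<in>v. rho N p ((r(d := t)) j)) = R r"
        unfolding R_def using uv by (intro prod.cong) auto
      then show ?thesis using uv by simp
    qed
    ultimately show ?thesis unfolding dual_sum_def uv(1) sum_PiE_insert[OF uv(2)] by (simp only:)
  qed
  then have "(\<Sum>c=1..N-1. dual_sum N p u (z(d := c))) = (\<Sum>c=1..N-1. \<Sum>r\<in>PiE v (\<lambda>_. {..<N}). \<Sum>t<N.
      of_bool (N dvd (\<Sum>j\<in>v. r j * z j) + t * c) * (rho N p t * R r))" by simp
  also have "\<dots> = (\<Sum>r\<in>PiE v (\<lambda>_. {..<N}). \<Sum>t<N. \<Sum>c=1..N-1.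
      of_bool (N dvd (\<Sum>j\<in>v. r j * z j) + t * c) * (rho N p t * R r))"
    by (subst sum.swap) (intro sum.cong refl sum.swap)
  also have "\<dots> = (\<Sum>r\<in>PiE v (\<lambda>_. {..<N}). R r * (\<Sum>t<N. rho N p t * (\<Sum>c=1..N-1.
      of_bool (N dvd (\<Sum>j\<in>v. r j * z j) + t * c))))"
    by (simp only: sum_distrib_left mult_ac)
  also have "\<dots> \<le> (\<Sum>r\<in>PiE v (\<lambda>_. {..<N}). R r * (2 * zeta (2 * p)))"
    using card_solutions_le[OF N, of "rho N p"] rho_zero_le[OF N0 p] sum_rho[OF N0 p] rho_nonneg
    by (intro sum_mono mult_left_mono R0) simp
  also have "\<dots> = (\<Sum>r\<in>PiE v (\<lambda>_. {..<N}). R r) * (2 * zeta (2 * p))" by (simp add: sum_distrib_right)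
  also have "(\<Sum>r\<in>PiE v (\<lambda>_. {..<N}). R r) = (\<Prod>j\<in>v. \<Sum>t<N. rho N p t)"
    unfolding R_def by (rule prod_sum_PiE[symmetric]) (use uv in auto)
  also have "(\<Prod>j\<in>v. \<Sum>t<N. rho N p t) * (2 * zeta (2 * p)) = (2 * zeta (2 * p)) ^ card u"
    using uv by (simp add: sum_rho[OF N0 p])
  finally show ?thesis .
qed

section \<open>The component-by-component bound\<close>

text \<open>Periodicity removes the fractional parts from the Korobov side.\<close>

lemma kor_factor_shift: "kor_factor (x + of_int i) (y + of_int k) = kor_factor x y"
proof -
  have "cos (2 * pi * real m * (x + of_int i - (y + of_int k))) = cos (2 * pi * real m * (x - y))" for m
  proof -
    have "frac (x + of_int i - (y + of_int k)) = frac (x - y)"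
      using frac_add_of_int_right[of "x - y" "i - k"] by (simp add: algebra_simps)
    then show ?thesis by (metis cos_frac)
  qed
  then show ?thesis unfolding kor_factor_def cos_series_def by (simp only:)
qed

lemma kor_factor_frac_frac: "kor_factor (frac x) (frac y) = kor_factor x y"
  using kor_factor_shift[of "frac x" "\<lfloor>x\<rfloor>" "frac y" "\<lfloor>y\<rfloor>"] by (simp add: frac_def)

lemma sum_mset_lattice:
  "(\<Sum>x\<in>#lattice N s z. f x) = (\<Sum>n<N. f (\<lambda>j\<in>{1..s}. frac (real n * real (z j) / real N)))"
  by (simp add: lattice_def image_mset.compositionality o_def sum_unfold_sum_mset[symmetric] atLeast0LessThan)

lemma size_lattice: "size (lattice N s z) = N"
  by (simp add: lattice_def)

lemma lattice_nonempty: "0 < N \<Longrightarrow> lattice N s z \<noteq> {#}"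
  using size_lattice[of N s z] by auto

lemma lattice_cube: "set_mset (lattice N s z) \<subseteq> cube s"
  by (auto simp: lattice_def cube_def frac_lt_1 less_imp_le)

lemma tent_lattice_cube: "set_mset (tent_points s (lattice N s z)) \<subseteq> cube s"
proof
  fix y assume "y \<in># tent_points s (lattice N s z)"
  then obtain x where "x \<in># lattice N s z" and y: "y = (\<lambda>j\<in>{1..s}. tent (x j))"
    by (auto simp: tent_points_def)
  with lattice_cube have "x \<in> cube s" by blast
  then show "y \<in> cube s"
    using tent_range unfolding cube_def y by (auto simp: PiE_iff)
qed

lemma kor_error_sq:
  assumes N: "0 < N" and \<eta>: "\<And>u. u \<subseteq> {1..d} \<Longrightarrow> 0 \<le> \<eta> u"
  shows "(worst_case_error d (lattice N d z) (kor_space 1 \<eta> d))\<^sup>2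
      = (\<Sum>u\<in>Pow {1..d} - {{}}. \<eta> u * dual_sum N 1 u z)"
proof -
  have "(\<Sum>x\<in>#lattice N d z. \<Sum>y\<in>#lattice N d z. \<Prod>j\<in>u. kor_factor (x j) (y j)) = (real N)\<^sup>2 * dual_sum N 1 u z"
    if u: "u \<in> Pow {1..d} - {{}}" for u
  proof -
    have "(\<Sum>x\<in>#lattice N d z. \<Sum>y\<in>#lattice N d z. \<Prod>j\<in>u. kor_factor (x j) (y j))
        = (\<Sum>m<N. \<Sum>n<N. \<Prod>j\<in>u. kor_factor (real m * real (z j) / real N) (real n * real (z j) / real N))"
      unfolding sum_mset_lattice
    proof (intro sum.cong refl prod.cong)
      fix m n j assume "j \<in> u"
      then have "j \<in> {1..d}" using u by auto
      then show "kor_factor ((\<lambda>j\<in>{1..d}. frac (real m * real (z j) / real N)) j) ((\<lambda>j\<in>{1..d}. frac (real n * real (z j) / real N)) j)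
          = kor_factor (real m * real (z j) / real N) (real n * real (z j) / real N)"
        by (simp only: restrict_apply if_True kor_factor_frac_frac)
    qed
    also have "\<dots> = (real N)\<^sup>2 * dual_sum N 1 u z"
      by (rule lattice_sum_double[OF N]) (use u finite_subset in auto)
    finally show ?thesis .
  qed
  then have "(\<Sum>u\<in>Pow {1..d} - {{}}. \<eta> u * (\<Sum>x\<in>#lattice N d z. \<Sum>y\<in>#lattice N d z. \<Prod>j\<in>u. kor_factor (x j) (y j)))
      = (real N)\<^sup>2 * (\<Sum>u\<in>Pow {1..d} - {{}}. \<eta> u * dual_sum N 1 u z)"
    by (simp add: sum_distrib_left mult_ac)
  then show ?thesis
    unfolding kor_space_def kor_kernel_product
    by (simp only: kor.worst_case_error_product_kernel(1)[OF \<eta> lattice_nonempty[OF N] lattice_cube] size_lattice)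
       (use N in simp)
qed

text \<open>The factor under the root in \<open>\<eta> u\<close> is exactly the one from the tent
  comparison, so each summand of the squared Sobolev error is at most the square of the
  corresponding summand of the squared Korobov error.\<close>

lemma sob_error_le:
  assumes N: "0 < N" and \<gamma>: "\<And>u. u \<subseteq> {1..s} \<Longrightarrow> 0 \<le> \<gamma> u"
    and \<eta>: "\<And>u. \<eta> u = sqrt (\<gamma> u * (29 / (6 * pi ^ 4)) ^ card u)"
  shows "worst_case_error s (tent_points s (lattice N s z)) (sob_space \<gamma> s)
    \<le> (worst_case_error s (lattice N s z) (kor_space 1 \<eta> s))\<^sup>2"
proof -
  define P where "P = tent_points s (lattice N s z)"
  have sP: "size P = N" by (simp add: P_def tent_points_def size_lattice)
  then have P0: "P \<noteq> {#}" using N by auto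
  have sum_P: "(\<Sum>x\<in>#P. f x) = (\<Sum>n<N. f (\<lambda>j\<in>{1..s}. tent (frac (real n * real (z j) / real N))))" for f :: "_ \<Rightarrow> real"
  proof -
    have "(\<Sum>x\<in>#P. f x) = (\<Sum>x\<in>#lattice N s z. f (\<lambda>j\<in>{1..s}. tent (x j)))"
      by (simp add: P_def tent_points_def image_mset.compositionality o_def)
    then show ?thesis by (simp add: sum_mset_lattice cong: restrict_cong)
  qed
  have PC: "set_mset P \<subseteq> cube s" unfolding P_def by (rule tent_lattice_cube)
  have \<eta>0: "0 \<le> \<eta> u" if "u \<subseteq> {1..s}" for u using \<gamma>[OF that] by (simp add: \<eta>)
  let ?U = "Pow {1..s} - {{}}"
  have summand: "\<gamma> u * (\<Sum>x\<in>#P. \<Sum>y\<in>#P. \<Prod>j\<in>u. sob_factor (x j) (y j)) \<le> (real N)\<^sup>2 * (\<eta> u * dual_sum N 1 u z)\<^sup>2"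
    if u: "u \<in> ?U" for u
  proof -
    have fu: "finite u" using u finite_subset by auto
    have "(\<Sum>x\<in>#P. \<Sum>y\<in>#P. \<Prod>j\<in>u. sob_factor (x j) (y j)) = (\<Sum>m<N. \<Sum>n<N. \<Prod>j\<in>u.
        sob_factor (tent (frac (real m * real (z j) / real N))) (tent (frac (real n * real (z j) / real N))))"
      unfolding sum_P
    proof (intro sum.cong refl prod.cong)
      fix m n j assume "j \<in> u"
      then have "j \<in> {1..s}" using u by auto
      then show "sob_factor ((\<lambda>j\<in>{1..s}. tent (frac (real m * real (z j) / real N))) j)
          ((\<lambda>j\<in>{1..s}. tent (frac (real n * real (z j) / real N))) j)
        = sob_factor (tent (frac (real m * real (z j) / real N))) (tent (frac (real n * real (z j) / real N)))"
        by (simp only: restrict_apply if_True)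
    qed
    also have "\<dots> \<le> (29 / (6 * pi ^ 4)) ^ card u * (real N * dual_sum N 1 u z)\<^sup>2"
      using sob_factor_tent_sum_le[OF N fu, of z] unfolding lattice_sum_single[OF N fu] .
    finally have "\<gamma> u * (\<Sum>x\<in>#P. \<Sum>y\<in>#P. \<Prod>j\<in>u. sob_factor (x j) (y j))
        \<le> \<gamma> u * ((29 / (6 * pi ^ 4)) ^ card u * (real N * dual_sum N 1 u z)\<^sup>2)"
      by (rule mult_left_mono) (use \<gamma> u in auto)
    also have "\<dots> = (real N)\<^sup>2 * (\<eta> u * dual_sum N 1 u z)\<^sup>2"
      using \<gamma>[of u] u by (simp add: \<eta> power_mult_distrib)
    finally show ?thesis .
  qed
  have "(worst_case_error s P (sob_space \<gamma> s))\<^sup>2 = (\<Sum>u\<in>?U. \<gamma> u * (\<Sum>x\<in>#P. \<Sum>y\<in>#P. \<Prod>j\<in>u. sob_factor (x j) (y j))) / (real N)\<^sup>2"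
    by (simp only: sob_space_def sob_kernel_product sob.worst_case_error_product_kernel(1)[OF \<gamma> P0 PC] sP)
  also have "\<dots> \<le> (\<Sum>u\<in>?U. (real N)\<^sup>2 * (\<eta> u * dual_sum N 1 u z)\<^sup>2) / (real N)\<^sup>2"
    by (intro divide_right_mono sum_mono summand) auto
  also have "\<dots> = (\<Sum>u\<in>?U. (\<eta> u * dual_sum N 1 u z)\<^sup>2)"
    using N by (simp flip: sum_distrib_left)
  \<comment> \<open>For nonnegative numbers the sum of squares is at most the square of the
    sum.\<close>
  also have "\<dots> \<le> (\<Sum>u\<in>?U. \<eta> u * dual_sum N 1 u z)\<^sup>2"
  proof -
    let ?a = "\<lambda>u. \<eta> u * dual_sum N 1 u z"
    have a0: "0 \<le> ?a u" if "u \<in> ?U" for u using \<eta>0 that dual_sum_nonneg by simp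
    have "(\<Sum>u\<in>?U. ?a u * ?a u) \<le> (\<Sum>u\<in>?U. ?a u * (\<Sum>u\<in>?U. ?a u))"
      by (intro sum_mono mult_left_mono member_le_sum a0) auto
    then show ?thesis by (simp only: power2_eq_square sum_distrib_right)
  qed
  also have "\<dots> = ((worst_case_error s (lattice N s z) (kor_space 1 \<eta> s))\<^sup>2)\<^sup>2"
    by (simp only: kor_error_sq[OF N \<eta>0])
  finally show ?thesis unfolding P_def by (rule power2_le_imp_le) simp
qed

section \<open>Outputs of the construction and their error bound\<close>

text \<open>A run is extended by a minimiser of the next criterion; locality of the criterion keeps
  the earlier minimality conditions valid.\<close>

lemma cbc_output_nonempty:
  assumes N: "2 \<le> N" and loc: "\<And>d z z'. (\<And>j. j \<in> {1..d} \<Longrightarrow> z j = z' j) \<Longrightarrow> crit d z = crit d z'"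
  shows "cbc_output N s crit \<noteq> {}"
proof (induction s)
  case 0
  have "(\<lambda>_. 1) \<in> cbc_output N 0 crit" by (simp add: cbc_output_def)
  then show ?case by blast
next
  case (Suc s)
  then obtain z where z: "z \<in> cbc_output N s crit" by blast
  show ?case
  \<comment> \<open>The first component is prescribed, so dimension 1 involves no
    minimisation.\<close>
  proof (cases "s = 0")
    case True
    then have "z \<in> cbc_output N (Suc s) crit" using z by (simp add: cbc_output_def)
    then show ?thesis by blast
  next
    case False
    define c where "c = arg_min_on (\<lambda>c. crit (Suc s) (z(Suc s := c))) {1..N-1}"
    have ne: "{1..N-1} \<noteq> {}" using N by auto
    have c: "c \<in> {1..N-1}" unfolding c_def by (rule arg_min_if_finite(1)) (use ne in auto)
    have cm: "crit (Suc s) (z(Suc s := c)) \<le> crit (Suc s) (z(Suc s := c'))" if "c' \<in> {1..N-1}" for c'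
      unfolding c_def by (rule arg_min_least) (use ne that in auto)
    have "z(Suc s := c) \<in> cbc_output N (Suc s) crit"
      unfolding cbc_output_def
    proof (intro CollectI conjI ballI)
      show "(z(Suc s := c)) 1 = 1" using z False by (simp add: cbc_output_def)
      fix d assume d: "d \<in> {2..Suc s}"
      show "(z(Suc s := c)) d \<in> {1..N-1}"
        using d z c by (cases "d = Suc s") (auto simp: cbc_output_def)
      fix c' assume c': "c' \<in> {1..N-1}"
      show "crit d (z(Suc s := c)) \<le> crit d ((z(Suc s := c))(d := c'))"
      proof (cases "d = Suc s")
        case True
        then show ?thesis using cm[OF c'] by simp
      next
        case False
        then have "crit d (z(Suc s := c)) = crit d z" "crit d ((z(Suc s := c))(d := c')) = crit d (z(d := c'))"
          using d by (intro loc; auto)+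
        then show ?thesis using z d False c' by (auto simp: cbc_output_def)
      qed
    qed
    then show ?thesis by blast
  qed
qed

lemma kor_criterion_cong:
  assumes "\<And>j. j \<in> {1..d} \<Longrightarrow> z j = z' j"
  shows "kor_criterion N \<beta> \<eta> d z = kor_criterion N \<beta> \<eta> d z'"
proof -
  have "lattice N d z = lattice N d z'"
    unfolding lattice_def using assms by (intro image_mset_cong restrict_ext) simp
  then show ?thesis by (simp add: kor_criterion_def)
qed

lemma Pow_Suc_split:
  "Pow {1..Suc d} - {{}} = (Pow {1..d} - {{}}) \<union> {u. u \<subseteq> {1..Suc d} \<and> Suc d \<in> u}"
  "(Pow {1..d} - {{}}) \<inter> {u. u \<subseteq> {1..Suc d} \<and> Suc d \<in> u} = {}"
proof -
  have "u \<subseteq> {1..d}" if "u \<subseteq> {1..Suc d}" "Suc d \<notin> u" for u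
    using that by (auto simp: subset_iff le_Suc_eq)
  then show "Pow {1..Suc d} - {{}} = (Pow {1..d} - {{}}) \<union> {u. u \<subseteq> {1..Suc d} \<and> Suc d \<in> u}" by auto
  show "(Pow {1..d} - {{}}) \<inter> {u. u \<subseteq> {1..Suc d} \<and> Suc d \<in> u} = {}" by auto
qed

text \<open>A component prime to N admits only residue 0, so in dimension 1 every choice has the
  same value and the prescribed 1 is a minimiser.\<close>

lemma dual_sum_singleton:
  assumes "prime N" "c \<in> {1..N-1}" "z d = c"
  shows "dual_sum N p {d} z = rho N p 0"
proof -
  have N0: "0 < N" using assms(1) prime_gt_0_nat by blast
  have "0 < c" "c < N" using assms(2) N0 by auto
  then have cN: "\<not> N dvd c" by (rule nat_dvd_not_less)
  have "dual_sum N p {d} z = (\<Sum>r\<in>PiE ({} :: nat set) (\<lambda>_. {..<N}). \<Sum>t<N. of_bool (N dvd t * c) * rho N p t)"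
    unfolding dual_sum_def by (subst sum_PiE_insert) (simp_all add: assms(3))
  also have "\<dots> = (\<Sum>t<N. if t = 0 then rho N p 0 else 0)"
  proof -
    have "of_bool (N dvd t * c) * rho N p t = (if t = 0 then rho N p 0 else 0)" if "t < N" for t
      using that cN assms(1) nat_dvd_not_less[of t N] by (cases "t = 0") (auto simp: prime_dvd_mult_iff)
    then show ?thesis by simp
  qed
  also have "\<dots> = rho N p 0" using N0 by simp
  finally show ?thesis .
qed

text \<open>Induction over dimensions: the subsets containing the new coordinate form a part
  controlled by averaging, and subadditivity of the p-th power adds it to the bound for the earlier
  part.\<close>

theorem cbc_error_bound:
  assumes N: "prime N" and \<eta>: "\<And>u. u \<subseteq> {1..s} \<Longrightarrow> 0 \<le> \<eta> u"
    and z: "z \<in> cbc_output N s (kor_criterion N 1 \<eta>)" and p: "1/2 < p" "p \<le> 1" and d: "d \<le> s"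
  shows "(\<Sum>u\<in>Pow {1..d} - {{}}. \<eta> u * dual_sum N 1 u z) powr p
    \<le> 1 / real (N - 1) * (\<Sum>u\<in>Pow {1..d} - {{}}. \<eta> u powr p * (2 * zeta (2 * p)) ^ card u)"
  using d
proof (induction d)
  case 0
  then show ?case by simp
next
  case (Suc d)
  have N2: "2 \<le> N" using N prime_ge_2_nat by blast
  then have N0: "0 < N" by simp
  let ?T = "{u. u \<subseteq> {1..Suc d} \<and> Suc d \<in> u}"
  let ?U = "Pow {1..d} - {{}}"
  have finT: "finite ?T" by (rule finite_subset[of _ "Pow {1..Suc d}"]) auto
  have "{1..Suc d} \<subseteq> {1..s}" using Suc.prems by auto
  then have \<eta>d: "0 \<le> \<eta> u" if "u \<subseteq> {1..Suc d}" for u using \<eta>[OF subset_trans[OF that]] by blast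
  then have \<eta>T: "0 \<le> \<eta> u" if "u \<in> ?T" for u using that by blast
  define \<theta> where "\<theta> z = (\<Sum>u\<in>?T. \<eta> u * dual_sum N 1 u z)" for z
  have split: "(\<Sum>u\<in>Pow {1..Suc d} - {{}}. f u) = (\<Sum>u\<in>?U. f u) + (\<Sum>u\<in>?T. f u)" for f :: "nat set \<Rightarrow> real"
    unfolding Pow_Suc_split(1) by (rule sum.union_disjoint) (use finT Pow_Suc_split(2) in auto)
  have crit: "kor_criterion N 1 \<eta> (Suc d) z = (\<Sum>u\<in>?U. \<eta> u * dual_sum N 1 u z) + \<theta> z" for z
    unfolding kor_criterion_def \<theta>_def by (simp only: kor_error_sq[OF N0 \<eta>d] split)
  \<comment> \<open>Subsets without the new coordinate do not see its component, so minimising the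
    criterion minimises \<open>\<theta>\<close>. The later components of \<open>z\<close> do not
    enter.\<close>
  have \<theta>min: "\<theta> z \<le> \<theta> (z(Suc d := c))" if c: "c \<in> {1..N-1}" for c
  proof (cases "d = 0")
    case True
    have "?T = {{Suc d}}" using True by auto
    moreover have "dual_sum N 1 {Suc d} z = rho N 1 0"
      using z True N2 by (intro dual_sum_singleton[OF N, of 1]) (auto simp: cbc_output_def)
    moreover have "dual_sum N 1 {Suc d} (z(Suc d := c)) = rho N 1 0"
      by (rule dual_sum_singleton[OF N c]) simp
    ultimately show ?thesis by (simp add: \<theta>_def)
  next
    case False
    then have "kor_criterion N 1 \<eta> (Suc d) z \<le> kor_criterion N 1 \<eta> (Suc d) (z(Suc d := c))"
      using z c Suc.prems by (auto simp: cbc_output_def)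
    moreover have "(\<Sum>u\<in>?U. \<eta> u * dual_sum N 1 u (z(Suc d := c))) = (\<Sum>u\<in>?U. \<eta> u * dual_sum N 1 u z)"
      by (intro sum.cong refl arg_cong2[where f = times] dual_sum_cong) auto
    ultimately show ?thesis by (simp add: crit)
  qed
  have \<theta>0: "0 \<le> \<theta> z" for z unfolding \<theta>_def by (intro sum_nonneg mult_nonneg_nonneg \<eta>T dual_sum_nonneg)
  \<comment> \<open>The minimum is at most the average; the average is taken of p-th powers, so that
    the power can be distributed over the sums first.\<close>
  have "real (N - 1) * \<theta> z powr p = (\<Sum>c=1..N-1. \<theta> z powr p)" by simp
  also have "\<dots> \<le> (\<Sum>c=1..N-1. \<theta> (z(Suc d := c)) powr p)"
    using p by (intro sum_mono powr_mono2 \<theta>min \<theta>0) auto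
  also have "\<dots> \<le> (\<Sum>c=1..N-1. \<Sum>u\<in>?T. \<eta> u powr p * dual_sum N p u (z(Suc d := c)))"
  proof (rule sum_mono)
    fix c
    have "\<theta> (z(Suc d := c)) powr p \<le> (\<Sum>u\<in>?T. (\<eta> u * dual_sum N 1 u (z(Suc d := c))) powr p)"
      unfolding \<theta>_def using p by (intro sum_powr_le mult_nonneg_nonneg \<eta>T dual_sum_nonneg) auto
    also have "\<dots> \<le> (\<Sum>u\<in>?T. \<eta> u powr p * dual_sum N p u (z(Suc d := c)))"
      unfolding powr_mult by (intro sum_mono mult_left_mono dual_sum_powr_le p) simp
    finally show "\<theta> (z(Suc d := c)) powr p \<le> (\<Sum>u\<in>?T. \<eta> u powr p * dual_sum N p u (z(Suc d := c)))" .
  qed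
  also have "\<dots> = (\<Sum>u\<in>?T. \<eta> u powr p * (\<Sum>c=1..N-1. dual_sum N p u (z(Suc d := c))))"
    by (subst sum.swap) (simp only: sum_distrib_left)
  also have "\<dots> \<le> (\<Sum>u\<in>?T. \<eta> u powr p * (2 * zeta (2 * p)) ^ card u)"
    by (intro sum_mono mult_left_mono sum_dual_sum_le[OF N p(1)]) (auto intro: finite_subset)
  finally have \<theta>: "\<theta> z powr p \<le> 1 / real (N - 1) * (\<Sum>u\<in>?T. \<eta> u powr p * (2 * zeta (2 * p)) ^ card u)"
    using N2 by (simp add: field_simps)
  have "((\<Sum>u\<in>?U. \<eta> u * dual_sum N 1 u z) + \<theta> z) powr p \<le> (\<Sum>u\<in>?U. \<eta> u * dual_sum N 1 u z) powr p + \<theta> z powr p"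
  proof -
    have "0 \<le> (\<Sum>u\<in>?U. \<eta> u * dual_sum N 1 u z)"
      by (intro sum_nonneg mult_nonneg_nonneg \<eta>d dual_sum_nonneg) auto
    then show ?thesis
      using sum_powr_le[of p "{True, False}" "\<lambda>b. if b then \<Sum>u\<in>?U. \<eta> u * dual_sum N 1 u z else \<theta> z"] p \<theta>0 by simp
  qed
  also have "\<dots> \<le> 1 / real (N - 1) * (\<Sum>u\<in>?U. \<eta> u powr p * (2 * zeta (2 * p)) ^ card u)
      + 1 / real (N - 1) * (\<Sum>u\<in>?T. \<eta> u powr p * (2 * zeta (2 * p)) ^ card u)"
    using Suc.IH Suc.prems \<theta> by (intro add_mono) auto
  finally show ?case unfolding split \<theta>_def by (simp only: distrib_left)
qed

text \<open>Nonemptiness of the output set says that the algorithm succeeds; the estimates then hold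
  for every output, that is, for every way of breaking ties, and one vector serves all exponents
  \<open>p\<close>.\<close>

theorem corollary1:
  fixes N s :: nat and \<gamma> \<gamma>' \<eta> :: "nat set \<Rightarrow> real" and c' :: real
  assumes "prime N" and "1 \<le> s"
    and "\<And>u. u \<subseteq> {1..s} \<Longrightarrow> 0 \<le> \<gamma> u"
    and "c' = 58 / 3"
    and "\<And>u. \<gamma>' u = \<gamma> u * (c' / (4 * pi ^ 4)) ^ card u"
    and "\<And>u. \<eta> u = sqrt (\<gamma>' u)"
  shows "cbc_output N s (kor_criterion N 1 \<eta>) \<noteq> {} \<and>
    (\<forall>z\<in>cbc_output N s (kor_criterion N 1 \<eta>).
       (\<forall>j\<in>{1..s}. z j \<in> {1..N - 1}) \<and>
       worst_case_error s (tent_points s (lattice N s z)) (sob_space \<gamma> s)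
         \<le> (worst_case_error s (lattice N s z) (kor_space 1 \<eta> s))\<^sup>2 \<and>
       (\<forall>p\<in>{1/2<..1}.
          (worst_case_error s (lattice N s z) (kor_space 1 \<eta> s))\<^sup>2
            \<le> 1 / real (N - 1) powr (1 / p) *
              (\<Sum>u\<in>Pow {1..s} - {{}}.
                 \<gamma> u powr (p / 2) *
                 (2 powr (1 - p) * c' powr (p / 2) * zeta (2 * p) / pi powr (2 * p)) ^ card u)
              powr (1 / p)))"
proof -
  have N2: "2 \<le> N" using assms(1) prime_ge_2_nat by blast
  have N0: "0 < N" using N2 by simp
  have \<eta>: "\<eta> u = sqrt (\<gamma> u * (29 / (6 * pi ^ 4)) ^ card u)" for u
    by (simp add: assms(4-6))
  have \<eta>0: "0 \<le> \<eta> u" if "u \<subseteq> {1..s}" for u using assms(3)[OF that] by (simp add: \<eta>)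
  have ne: "cbc_output N s (kor_criterion N 1 \<eta>) \<noteq> {}"
    by (rule cbc_output_nonempty[OF N2]) (rule kor_criterion_cong)
  have rng: "z j \<in> {1..N - 1}" if z: "z \<in> cbc_output N s (kor_criterion N 1 \<eta>)" and j: "j \<in> {1..s}" for z j
  proof (cases "j = 1")
    case True
    then show ?thesis using z N2 by (auto simp: cbc_output_def)
  next
    case False
    then have "j \<in> {2..s}" using j by auto
    then show ?thesis using z by (auto simp: cbc_output_def)
  qed
  \<comment> \<open>The root halves the exponent, so each coordinate carries (c' / (4 pi^4))^(p/2)
    times 2 zeta(2 p); here 4^(p/2) = 2^p combines with the 2 to 2^(1 - p).\<close>
  have wt: "\<eta> u powr p * (2 * zeta (2 * p)) ^ card u
      = \<gamma> u powr (p / 2) * (2 powr (1 - p) * c' powr (p / 2) * zeta (2 * p) / pi powr (2 * p)) ^ card u"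
    if u: "u \<subseteq> {1..s}" and p: "1/2 < p" for u p
  proof -
    have g: "0 \<le> \<gamma> u" by (rule assms(3)[OF u])
    define C where "C = c' / (4 * pi ^ 4)"
    have C: "0 < C" using assms(4) by (simp add: C_def)
    have half: "sqrt x powr p = x powr (p / 2)" if "0 \<le> x" for x
      using that by (simp add: powr_half_sqrt[symmetric] powr_powr)
    have "\<eta> u powr p = (\<gamma> u * C ^ card u) powr (p / 2)"
      unfolding assms(5,6) C_def[symmetric] by (rule half) (use g C in simp)
    also have "\<dots> = \<gamma> u powr (p / 2) * (C powr (p / 2)) ^ card u"
    proof -
      have "(C ^ card u) powr (p / 2) = (C powr (p / 2)) ^ card u"
        using C powr_realpow[of "C powr (p / 2)" "card u"] powr_realpow[of C "card u"]
          powr_powr_swap[of C "real (card u)" "p / 2"] by simp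
      then show ?thesis by (simp only: powr_mult)
    qed
    also note C_def
    finally have "\<eta> u powr p * (2 * zeta (2 * p)) ^ card u
        = \<gamma> u powr (p / 2) * ((c' / (4 * pi ^ 4)) powr (p / 2) * (2 * zeta (2 * p))) ^ card u"
      by (simp add: power_mult_distrib)
    also have "(c' / (4 * pi ^ 4)) powr (p / 2) * (2 * zeta (2 * p))
        = 2 powr (1 - p) * c' powr (p / 2) * zeta (2 * p) / pi powr (2 * p)"
    proof -
      have "4 powr (p / 2) = (2 powr 2) powr (p / 2)" by simp
      also have "\<dots> = 2 powr p" by (simp only: powr_powr) simp
      finally have 4: "4 powr (p / 2) = 2 powr p" .
      have "(pi ^ 4) powr (p / 2) = (pi powr 4) powr (p / 2)" by simp
      also have "\<dots> = pi powr (2 * p)" by (simp only: powr_powr) simp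
      finally have pi4: "(pi ^ 4) powr (p / 2) = pi powr (2 * p)" .
      have "(c' / (4 * pi ^ 4)) powr (p / 2) = c' powr (p / 2) / (2 powr p * pi powr (2 * p))"
        using assms(4) by (simp only: powr_divide powr_mult 4 pi4)
      moreover have "2 powr (1 - p) = 2 / 2 powr p" by (simp add: powr_diff)
      ultimately show ?thesis by simp
    qed
    finally show ?thesis .
  qed
  have bd: "(worst_case_error s (lattice N s z) (kor_space 1 \<eta> s))\<^sup>2
      \<le> 1 / real (N - 1) powr (1 / p) * (\<Sum>u\<in>Pow {1..s} - {{}}. \<gamma> u powr (p / 2) *
          (2 powr (1 - p) * c' powr (p / 2) * zeta (2 * p) / pi powr (2 * p)) ^ card u) powr (1 / p)"
    if z: "z \<in> cbc_output N s (kor_criterion N 1 \<eta>)" and p: "p \<in> {1/2<..1}" for z p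
  proof -
    have p': "1/2 < p" "p \<le> 1" using p by auto
    define e where "e = (worst_case_error s (lattice N s z) (kor_space 1 \<eta> s))\<^sup>2"
    have e: "e = (\<Sum>u\<in>Pow {1..s} - {{}}. \<eta> u * dual_sum N 1 u z)"
      unfolding e_def by (rule kor_error_sq[OF N0 \<eta>0])
    define S where "S = (\<Sum>u\<in>Pow {1..s} - {{}}. \<eta> u powr p * (2 * zeta (2 * p)) ^ card u)"
    have S0: "0 \<le> S" unfolding S_def
      using zeta_nonneg[OF p'(1)] by (intro sum_nonneg mult_nonneg_nonneg zero_le_power) auto
    have "e powr p \<le> 1 / real (N - 1) * S"
      using cbc_error_bound[OF assms(1) _ z p' order_refl] \<eta>0 by (simp only: S_def e)
    then have "(e powr p) powr (1 / p) \<le> (1 / real (N - 1) * S) powr (1 / p)"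
      using p' by (intro powr_mono2) auto
    also have "(e powr p) powr (1 / p) = e" using p' by (simp add: powr_powr e_def)
    also have "(1 / real (N - 1) * S) powr (1 / p) = 1 / real (N - 1) powr (1 / p) * S powr (1 / p)"
      using S0 by (simp add: powr_mult powr_divide)
    also have "S = (\<Sum>u\<in>Pow {1..s} - {{}}. \<gamma> u powr (p / 2) *
          (2 powr (1 - p) * c' powr (p / 2) * zeta (2 * p) / pi powr (2 * p)) ^ card u)"
      unfolding S_def by (intro sum.cong refl wt p') auto
    finally show ?thesis by (simp only: e_def)
  qed
  have sob: "worst_case_error s (tent_points s (lattice N s z)) (sob_space \<gamma> s)
      \<le> (worst_case_error s (lattice N s z) (kor_space 1 \<eta> s))\<^sup>2" for z
    by (rule sob_error_le[OF N0 assms(3) \<eta>])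
  show ?thesis by (intro conjI ballI ne rng sob bd)
qed

end
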